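(* Let $(M,F)$ be a Finsler manifold, $\mathbf{k}\ge 0$ a real number, and suppose that the index of $\mathbf{k}$-nullity $\mu_{\mathbf{k}}$ is constant on an open subset $U\subseteq M$. Then the $\mathbf{k}$-nullity distribution $x\in U\mapsto \mathcal{N}^{\mathbf{k}}_x\subseteq T_xM$ is completely integrable (involutive) on $U$.
   Context: Setting. $M$ is a connected differentiable manifold of dimension $n$, $\pi:TM_0\to M$ is the bundle of non-zero tangent vectors, $\pi^*TM\to TM_0$ the pulled-back tangent bundle, points of $TM_0$ are $z=(x,v)$ with $x=\pi z$, and $\varrho:TTM_0\to\pi^*TM$ is the bundle map induced by $\pi_*$. The vertical space is $\mathcal{V}_zTM=\ker\pi_*$. A Finsler structure is $F:TM_0\to(0,\infty)$, $C^\infty$, with $F(x,\lambda v)=\lambda F(x,v)$ for $\lambda>0$ and $g_{ij}(x,v)=\frac12\frac{\partial^2F^2}{\partial v^i\partial v^j}$ positive definite; $g=(g_{ij})$ is a metric on the bundle $\pi^*TM$. $\mathbf{v}=v^i\partial_i$ is the canonical section of $\pi^*TM$. Cartan connection. For a linear connection $\nabla$ on $\pi^*TM$ put $\mu(\hat X)=\nabla_{\hat X}\mathbf{v}$. $\nabla$ is regular if $\mu$ restricts to an isomorphism $\mathcal{V}TM\to\pi^*TM$; then $TTM_0=\mathcal{H}TM\oplus\mathcal{V}TM$ with horizontal distribution $\mathcal{H}TM=\ker\mu$, and $\hat X=H\hat X+V\hat X$ denotes the decomposition. For vector fields $\hat X,\hat Y,\hat Z$ on $TM_0$ write $X=\varrho(\hat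 X)$, $Y=\varrho(\hat Y)$, $Z=\varrho(\hat Z)$. Torsion and curvature are $\tau(\hat X,\hat Y)=\nabla_{\hat X}Y-\nabla_{\hat Y}X-\varrho[\hat X,\hat Y]$ and $\Omega(\hat X,\hat Y)Z=\nabla_{\hat X}\nabla_{\hat Y}Z-\nabla_{\hat Y}\nabla_{\hat X}Z-\nabla_{[\hat X,\hat Y]}Z$. The Cartan connection $\nabla$ of $F$ is the unique regular connection with $\nabla g=0$, $\tau(H\hat X,H\hat Y)=0$ and $g(\tau(V\hat X,\hat Y),Z)=g(\tau(V\hat X,\hat Z),Y)$. Its $hv$-curvature $P$ is given by $P(X,\dot Y)=\Omega(H\hat X,V\hat Y)$ with $X=\varrho(\hat X)$, $\dot Y=\mu(\hat Y)$; thus $P(X,Y)$ is an endomorphism of $\pi^*TM$ for all sections $X,Y$ of $\pi^*TM$. Its symmetric and anti-symmetric parts are ${}^sP(X,Y)=\frac12(P(X,Y)+P(Y,X))$ and ${}^aP(X,Y)=\frac12(P(X,Y)-P(Y,X))$. $\mathbf{k}$-nullity. For a real number $\mathbf{k}\ge0$ let $\eta^{\mathbf{k}}(\hat X,\hat Y)Z=\mathbf{k}\{g(Y,Z)X-g(X,Z)Y\}+{}^aP(X,\dot Y)Z$ with $\dot Y=\mu(\hat Y)$, and $\bar\Omega(\hat X,\hat Y)Z=\Omega(\hat X,\hat Y)Z-\eta^{\mathbf{k}}(\hat X,\hat Y)Z$ (the related curvature operator of $\Omega$). For $z\in TM_0$ let $N^{\mathbf{k}}_z=\{\hat X\in\mathcal{H}_zTM:\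 \bar\Omega(\hat X,\hat Y)=0\ \ \forall\hat Y\in\mathcal{H}_zTM\}$. For $x=\pi z$ the $\mathbf{k}$-nullity space at $x$ is $\mathcal{N}^{\mathbf{k}}_x=\varrho(N^{\mathbf{k}}_z)\subseteq T_xM$; it is part of the setting that this subspace depends only on $x$. The index of $\mathbf{k}$-nullity is $\mu_{\mathbf{k}}(x)=\dim\mathcal{N}^{\mathbf{k}}_x$. Standing assumption: $0<\mu_{\mathbf{k}}<n$. *)

theory Defs
  imports "HOL-Analysis.Analysis" "HOL-Library.Function_Algebras"
begin

section \<open>Preliminaries\<close>

text \<open>Pointwise scalar multiplication. Together with the pointwise addition of
  \<^theory>\<open>HOL-Library.Function_Algebras\<close> it makes tangent vectors (families of vectors
  indexed by charts) and sections elements of real vector spaces, so that the library notions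
  \<^const>\<open>subspace\<close>, \<^const>\<open>span\<close> and \<^const>\<open>dim\<close> apply.\<close>

instantiation "fun" :: (type, real_vector) real_vector
begin

definition scaleR_fun :: "real \<Rightarrow> ('a \<Rightarrow> 'b) \<Rightarrow> 'a \<Rightarrow> 'b"
  where "scaleR_fun r f = (\<lambda>x. r *\<^sub>R f x)"

instance
  by standard (simp_all add: scaleR_fun_def fun_eq_iff algebra_simps)

end

definition extend_by_zero :: "'a set \<Rightarrow> ('a \<Rightarrow> 'b::zero) \<Rightarrow> 'a \<Rightarrow> 'b"
  where "extend_by_zero S f = (\<lambda>x. if x \<in> S then f x else 0)"

text \<open>Differentiability classes; meaningful for open sets \<open>S\<close>.\<close>

primrec C_k_on ::
  "nat \<Rightarrow> 'a::euclidean_space set \<Rightarrow> ('a \<Rightarrow> 'b::real_normed_vector) \<Rightarrow> bool" where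
  "C_k_on 0 S f \<longleftrightarrow> continuous_on S f"
| "C_k_on (Suc k) S f \<longleftrightarrow>
     (\<forall>x\<in>S. f differentiable (at x)) \<and>
     (\<forall>b\<in>Basis. C_k_on k S (\<lambda>x. frechet_derivative f (at x) b))"

definition smooth_on :: "'a::euclidean_space set \<Rightarrow> ('a \<Rightarrow> 'b::real_normed_vector) \<Rightarrow> bool"
  where "smooth_on S f \<longleftrightarrow> (\<forall>k. C_k_on k S f)"


section \<open>Smooth manifolds, tangent vectors, vector fields\<close>

text \<open>A chart is a pair of a domain and a coordinate map; the values of the coordinate map
  outside the domain are irrelevant.\<close>

type_synonym ('m, 'e) chart = "'m set \<times> ('m \<Rightarrow> 'e)"

definition chart_inv :: "('m, 'e) chart \<Rightarrow> 'e \<Rightarrow> 'm"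
  where "chart_inv c = inv_into (fst c) (snd c)"

definition transition :: "('m, 'e) chart \<Rightarrow> ('m, 'e) chart \<Rightarrow> 'e \<Rightarrow> 'e"
  where "transition c c' = snd c' \<circ> chart_inv c"

definition smooth_manifold ::
  "'m topology \<Rightarrow> ('m, 'e::euclidean_space) chart set \<Rightarrow> bool" where
  "smooth_manifold M A \<longleftrightarrow>
     Hausdorff_space M \<and> second_countable M \<and> \<Union>(fst ` A) = topspace M \<and>
     (\<forall>c\<in>A. openin M (fst c) \<and> open (snd c ` fst c) \<and>
        homeomorphic_map (subtopology M (fst c)) (top_of_set (snd c ` fst c)) (snd c)) \<and>
     (\<forall>c\<in>A. \<forall>c'\<in>A. smooth_on (snd c ` (fst c \<inter> fst c')) (transition c c'))"

text \<open>The notions below depend on the atlas only, so that they apply to \<open>M\<close> as well as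
  to the slit tangent bundle, whose atlas is defined further down.\<close>

definition carrier_of :: "('m, 'e) chart set \<Rightarrow> 'm set"
  where "carrier_of A = \<Union>(fst ` A)"

definition charts_at :: "('m, 'e) chart set \<Rightarrow> 'm \<Rightarrow> ('m, 'e) chart set"
  where "charts_at A x = {c \<in> A. x \<in> fst c}"

definition some_chart :: "('m, 'e) chart set \<Rightarrow> 'm \<Rightarrow> ('m, 'e) chart"
  where "some_chart A x = (SOME c. c \<in> charts_at A x)"

text \<open>A tangent vector at \<open>x\<close> is the family of its coordinate representations in all charts
  at \<open>x\<close>, which are related by the Jacobians of the transition maps (and the family is \<open>0\<close>
  at the other indices).\<close>

type_synonym ('m, 'e) tvec = "('m, 'e) chart \<Rightarrow> 'e"

definition tangent_space :: "('m, 'e::euclidean_space) chart set \<Rightarrow> 'm \<Rightarrow> ('m, 'e) tvec set"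
  where "tangent_space A x =
    {v. (\<forall>c. c \<notin> charts_at A x \<longrightarrow> v c = 0) \<and>
        (\<forall>c\<in>charts_at A x. \<forall>c'\<in>charts_at A x.
           v c' = frechet_derivative (transition c c') (at (snd c x)) (v c))}"

definition differential ::
  "('m, 'e::euclidean_space) chart set \<Rightarrow> ('n, 'f::euclidean_space) chart set \<Rightarrow> ('m \<Rightarrow> 'n)
     \<Rightarrow> 'm \<Rightarrow> ('m, 'e) tvec \<Rightarrow> ('n, 'f) tvec"
  where "differential A B f x \<xi> = (\<lambda>c'. if c' \<in> charts_at B (f x)
     then let c = some_chart A x
          in frechet_derivative (snd c' \<circ> f \<circ> chart_inv c) (at (snd c x)) (\<xi> c)
     else 0)"

definition smooth_function ::
  "('m, 'e::euclidean_space) chart set \<Rightarrow> ('m \<Rightarrow> real) \<Rightarrow> bool"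
  where "smooth_function A f \<longleftrightarrow> (\<forall>c\<in>A. smooth_on (snd c ` fst c) (f \<circ> chart_inv c))"

definition deriv_along ::
  "('m, 'e::euclidean_space) chart set \<Rightarrow> 'm \<Rightarrow> ('m, 'e) tvec \<Rightarrow> ('m \<Rightarrow> real) \<Rightarrow> real"
  where "deriv_along A x \<xi> f =
    (let c = some_chart A x in frechet_derivative (f \<circ> chart_inv c) (at (snd c x)) (\<xi> c))"

definition vector_field_on ::
  "('m, 'e::euclidean_space) chart set \<Rightarrow> 'm set \<Rightarrow> ('m \<Rightarrow> ('m, 'e) tvec) \<Rightarrow> bool"
  where "vector_field_on A V X \<longleftrightarrow>
    (\<forall>x\<in>V. X x \<in> tangent_space A x) \<and> (\<forall>x. x \<notin> V \<longrightarrow> X x = 0) \<and>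
    (\<forall>c\<in>A. smooth_on (snd c ` (fst c \<inter> V)) (\<lambda>u. X (chart_inv c u) c))"

abbreviation vector_field ::
  "('m, 'e::euclidean_space) chart set \<Rightarrow> ('m \<Rightarrow> ('m, 'e) tvec) \<Rightarrow> bool"
  where "vector_field A \<equiv> vector_field_on A (carrier_of A)"

text \<open>In every chart \<open>[X,Y]\<^sup>i = X\<^sup>j \<partial>\<^sub>j Y\<^sup>i - Y\<^sup>j \<partial>\<^sub>j X\<^sup>i\<close>.\<close>

definition lie_bracket ::
  "('m, 'e::euclidean_space) chart set \<Rightarrow> ('m \<Rightarrow> ('m, 'e) tvec) \<Rightarrow> ('m \<Rightarrow> ('m, 'e) tvec)
     \<Rightarrow> 'm \<Rightarrow> ('m, 'e) tvec"
  where "lie_bracket A X Y x = (\<lambda>c. if c \<in> charts_at A x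
     then frechet_derivative (\<lambda>u. Y (chart_inv c u) c) (at (snd c x)) (X x c)
        - frechet_derivative (\<lambda>u. X (chart_inv c u) c) (at (snd c x)) (Y x c)
     else 0)"

text \<open>A (smooth) distribution of rank \<open>r\<close> on an open set \<open>U\<close> is a field of \<open>r\<close>-dimensional
  subspaces of the tangent spaces that is locally spanned by \<open>r\<close> smooth vector fields.\<close>

definition distribution_on ::
  "'m topology \<Rightarrow> ('m, 'e::euclidean_space) chart set \<Rightarrow> 'm set \<Rightarrow> nat
     \<Rightarrow> ('m \<Rightarrow> ('m, 'e) tvec set) \<Rightarrow> bool"
  where "distribution_on M A U r D \<longleftrightarrow>
    (\<forall>x\<in>U. subspace (D x) \<and> D x \<subseteq> tangent_space A x \<and> dim (D x) = r) \<and>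
    (\<forall>x\<in>U. \<exists>V E. openin M V \<and> x \<in> V \<and> V \<subseteq> U \<and>
       (\<forall>i<r. vector_field_on A V (E i)) \<and>
       (\<forall>y\<in>V. D y = span ((\<lambda>i::nat. E i y) ` {..<r})))"

definition involutive_on ::
  "'m topology \<Rightarrow> ('m, 'e::euclidean_space) chart set \<Rightarrow> 'm set
     \<Rightarrow> ('m \<Rightarrow> ('m, 'e) tvec set) \<Rightarrow> bool"
  where "involutive_on M A U D \<longleftrightarrow>
    (\<forall>V X Y. openin M V \<and> V \<subseteq> U \<and> vector_field_on A V X \<and> vector_field_on A V Y \<and>
       (\<forall>x\<in>V. X x \<in> D x \<and> Y x \<in> D x) \<longrightarrow> (\<forall>x\<in>V. lie_bracket A X Y x \<in> D x))"


section \<open>The slit tangent bundle and the pulled-back bundle\<close>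

type_synonym ('m, 'e) tpoint = "'m \<times> ('m, 'e) tvec"

definition TM0 :: "('m, 'e::euclidean_space) chart set \<Rightarrow> ('m, 'e) tpoint set"
  where "TM0 A = {(x, v). x \<in> carrier_of A \<and> v \<in> tangent_space A x \<and> v \<noteq> 0}"

text \<open>The chart \<open>(x\<^sup>i, v\<^sup>i)\<close> of the slit tangent bundle induced by a chart \<open>(x\<^sup>i)\<close> of \<open>M\<close>.\<close>

definition slit_chart ::
  "('m, 'e::euclidean_space) chart set \<Rightarrow> ('m, 'e) chart \<Rightarrow> (('m, 'e) tpoint, 'e \<times> 'e) chart"
  where "slit_chart A c = ({z \<in> TM0 A. fst z \<in> fst c}, \<lambda>z. (snd c (fst z), snd z c))"

definition slit_atlas ::
  "('m, 'e::euclidean_space) chart set \<Rightarrow> (('m, 'e) tpoint, 'e \<times> 'e) chart set"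
  where "slit_atlas A = slit_chart A ` A"

text \<open>Tangent vectors of, and vector fields on, the slit tangent bundle.\<close>

type_synonym ('m, 'e) ttvec = "(('m, 'e) tpoint, 'e \<times> 'e) tvec"
type_synonym ('m, 'e) tfield = "('m, 'e) tpoint \<Rightarrow> ('m, 'e) ttvec"

text \<open>Sections of \<open>\<pi>\<^sup>*TM\<close>; its fibre over \<open>z = (x, v)\<close> is the tangent space at \<open>x\<close>.\<close>

type_synonym ('m, 'e) psection = "('m, 'e) tpoint \<Rightarrow> ('m, 'e) tvec"

definition pullback_section ::
  "('m, 'e::euclidean_space) chart set \<Rightarrow> ('m, 'e) psection \<Rightarrow> bool"
  where "pullback_section A Y \<longleftrightarrow>
    (\<forall>z\<in>TM0 A. Y z \<in> tangent_space A (fst z)) \<and> (\<forall>z. z \<notin> TM0 A \<longrightarrow> Y z = 0) \<and>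
    (\<forall>c\<in>A. smooth_on (snd (slit_chart A c) ` fst (slit_chart A c))
              (\<lambda>p. Y (chart_inv (slit_chart A c) p) c))"

definition canonical_section ::
  "('m, 'e::euclidean_space) chart set \<Rightarrow> ('m, 'e) psection"
  where "canonical_section A = extend_by_zero (TM0 A) snd"

definition rho_at ::
  "('m, 'e::euclidean_space) chart set \<Rightarrow> ('m, 'e) tpoint \<Rightarrow> ('m, 'e) ttvec \<Rightarrow> ('m, 'e) tvec"
  where "rho_at A z = differential (slit_atlas A) A fst z"

definition rho ::
  "('m, 'e::euclidean_space) chart set \<Rightarrow> ('m, 'e) tfield \<Rightarrow> ('m, 'e) psection"
  where "rho A X = extend_by_zero (TM0 A) (\<lambda>z. rho_at A z (X z))"

definition vertical_space ::
  "('m, 'e::euclidean_space) chart set \<Rightarrow> ('m, 'e) tpoint \<Rightarrow> ('m, 'e) ttvec set"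
  where "vertical_space A z = {\<xi> \<in> tangent_space (slit_atlas A) z. rho_at A z \<xi> = 0}"


section \<open>Finsler structures\<close>

text \<open>\<open>g\<^sub>i\<^sub>j = 1/2 \<partial>\<^sup>2F\<^sup>2/\<partial>v\<^sup>i\<partial>v\<^sup>j\<close>; in the chart \<open>(x, v)\<close> the coordinate vector of \<open>v\<^sup>i\<close> is \<open>(0, i)\<close>
  where \<open>i\<close> is a basis vector of the model space.\<close>

definition metric_coeff ::
  "('m, 'e::euclidean_space) chart set \<Rightarrow> (('m, 'e) tpoint \<Rightarrow> real) \<Rightarrow> ('m, 'e) chart
     \<Rightarrow> ('m, 'e) tpoint \<Rightarrow> 'e \<Rightarrow> 'e \<Rightarrow> real"
  where "metric_coeff A F c z i j =
    (let C = slit_chart A c; E = (\<lambda>z. (F z)\<^sup>2) \<circ> chart_inv C in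
     1/2 * frechet_derivative (\<lambda>p. frechet_derivative E (at p) (0, j)) (at (snd C z)) (0, i))"

definition finsler_metric ::
  "('m, 'e::euclidean_space) chart set \<Rightarrow> (('m, 'e) tpoint \<Rightarrow> real)
     \<Rightarrow> ('m, 'e) tpoint \<Rightarrow> ('m, 'e) tvec \<Rightarrow> ('m, 'e) tvec \<Rightarrow> real"
  where "finsler_metric A F z a b =
    (let c = some_chart A (fst z) in
     \<Sum>i\<in>Basis. \<Sum>j\<in>Basis. metric_coeff A F c z i j * (a c \<bullet> i) * (b c \<bullet> j))"

definition finsler_structure ::
  "('m, 'e::euclidean_space) chart set \<Rightarrow> (('m, 'e) tpoint \<Rightarrow> real) \<Rightarrow> bool"
  where "finsler_structure A F \<longleftrightarrow>
    (\<forall>z\<in>TM0 A. 0 < F z) \<and> smooth_function (slit_atlas A) F \<and>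
    (\<forall>(x, v)\<in>TM0 A. \<forall>t>0. F (x, t *\<^sub>R v) = t * F (x, v)) \<and>
    (\<forall>z\<in>TM0 A. \<forall>a\<in>tangent_space A (fst z). a \<noteq> 0 \<longrightarrow> 0 < finsler_metric A F z a a)"


section \<open>Linear connections on the pulled-back bundle\<close>

text \<open>A connection \<open>D\<close> is given pointwise: \<open>D z \<xi> Y\<close> is the covariant derivative of the
  section \<open>Y\<close> in the direction of the tangent vector \<open>\<xi>\<close> of the slit tangent bundle at \<open>z\<close>.\<close>

type_synonym ('m, 'e) conn =
  "('m, 'e) tpoint \<Rightarrow> ('m, 'e) ttvec \<Rightarrow> ('m, 'e) psection \<Rightarrow> ('m, 'e) tvec"

definition covd ::
  "('m, 'e::euclidean_space) chart set \<Rightarrow> ('m, 'e) conn \<Rightarrow> ('m, 'e) tfield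
     \<Rightarrow> ('m, 'e) psection \<Rightarrow> ('m, 'e) psection"
  where "covd A D X Y = extend_by_zero (TM0 A) (\<lambda>z. D z (X z) Y)"

definition linear_connection ::
  "('m, 'e::euclidean_space) chart set \<Rightarrow> ('m, 'e) conn \<Rightarrow> bool"
  where "linear_connection A D \<longleftrightarrow>
    (\<forall>z\<in>TM0 A. \<forall>Y. pullback_section A Y \<longrightarrow>
       (\<forall>\<xi>\<in>tangent_space (slit_atlas A) z. D z \<xi> Y \<in> tangent_space A (fst z)) \<and>
       (\<forall>\<xi>\<in>tangent_space (slit_atlas A) z. \<forall>\<zeta>\<in>tangent_space (slit_atlas A) z. \<forall>s t.
          D z (s *\<^sub>R \<xi> + t *\<^sub>R \<zeta>) Y = s *\<^sub>R D z \<xi> Y + t *\<^sub>R D z \<zeta> Y)) \<and>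
    (\<forall>z\<in>TM0 A. \<forall>\<xi>\<in>tangent_space (slit_atlas A) z. \<forall>Y Y'.
       pullback_section A Y \<and> pullback_section A Y' \<longrightarrow>
         D z \<xi> (Y + Y') = D z \<xi> Y + D z \<xi> Y') \<and>
    (\<forall>z\<in>TM0 A. \<forall>\<xi>\<in>tangent_space (slit_atlas A) z. \<forall>f Y.
       smooth_function (slit_atlas A) f \<and> pullback_section A Y \<longrightarrow>
         D z \<xi> (\<lambda>w. f w *\<^sub>R Y w) =
           deriv_along (slit_atlas A) z \<xi> f *\<^sub>R Y z + f z *\<^sub>R D z \<xi> Y) \<and>
    (\<forall>X Y. vector_field (slit_atlas A) X \<and> pullback_section A Y \<longrightarrow>
       pullback_section A (covd A D X Y))"

definition mu_at ::
  "('m, 'e::euclidean_space) chart set \<Rightarrow> ('m, 'e) conn \<Rightarrow> ('m, 'e) tpoint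
     \<Rightarrow> ('m, 'e) ttvec \<Rightarrow> ('m, 'e) tvec"
  where "mu_at A D z \<xi> = D z \<xi> (canonical_section A)"

definition mu ::
  "('m, 'e::euclidean_space) chart set \<Rightarrow> ('m, 'e) conn \<Rightarrow> ('m, 'e) tfield
     \<Rightarrow> ('m, 'e) psection"
  where "mu A D X = covd A D X (canonical_section A)"

definition regular_connection ::
  "('m, 'e::euclidean_space) chart set \<Rightarrow> ('m, 'e) conn \<Rightarrow> bool"
  where "regular_connection A D \<longleftrightarrow> linear_connection A D \<and>
    (\<forall>z\<in>TM0 A. bij_betw (mu_at A D z) (vertical_space A z) (tangent_space A (fst z)))"

definition horizontal_space ::
  "('m, 'e::euclidean_space) chart set \<Rightarrow> ('m, 'e) conn \<Rightarrow> ('m, 'e) tpoint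
     \<Rightarrow> ('m, 'e) ttvec set"
  where "horizontal_space A D z = {\<xi> \<in> tangent_space (slit_atlas A) z. mu_at A D z \<xi> = 0}"

definition hpart ::
  "('m, 'e::euclidean_space) chart set \<Rightarrow> ('m, 'e) conn \<Rightarrow> ('m, 'e) tfield \<Rightarrow> ('m, 'e) tfield"
  where "hpart A D X = extend_by_zero (TM0 A)
    (\<lambda>z. THE \<xi>. \<xi> \<in> horizontal_space A D z \<and> X z - \<xi> \<in> vertical_space A z)"

definition vpart ::
  "('m, 'e::euclidean_space) chart set \<Rightarrow> ('m, 'e) conn \<Rightarrow> ('m, 'e) tfield \<Rightarrow> ('m, 'e) tfield"
  where "vpart A D X = X - hpart A D X"

definition torsion ::
  "('m, 'e::euclidean_space) chart set \<Rightarrow> ('m, 'e) conn \<Rightarrow> ('m, 'e) tfield \<Rightarrow> ('m, 'e) tfield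
     \<Rightarrow> ('m, 'e) psection"
  where "torsion A D X Y =
    covd A D X (rho A Y) - covd A D Y (rho A X) - rho A (lie_bracket (slit_atlas A) X Y)"

definition curvature ::
  "('m, 'e::euclidean_space) chart set \<Rightarrow> ('m, 'e) conn \<Rightarrow> ('m, 'e) tfield \<Rightarrow> ('m, 'e) tfield
     \<Rightarrow> ('m, 'e) psection \<Rightarrow> ('m, 'e) psection"
  where "curvature A D X Y Z =
    covd A D X (covd A D Y Z) - covd A D Y (covd A D X Z)
      - covd A D (lie_bracket (slit_atlas A) X Y) Z"

definition cartan_connection ::
  "('m, 'e::euclidean_space) chart set \<Rightarrow> (('m, 'e) tpoint \<Rightarrow> real) \<Rightarrow> ('m, 'e) conn \<Rightarrow> bool"
  where "cartan_connection A F D \<longleftrightarrow> regular_connection A D \<and>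
    (\<forall>z\<in>TM0 A. \<forall>\<xi>\<in>tangent_space (slit_atlas A) z. \<forall>Y Z.
       pullback_section A Y \<and> pullback_section A Z \<longrightarrow>
         deriv_along (slit_atlas A) z \<xi> (\<lambda>w. finsler_metric A F w (Y w) (Z w)) =
           finsler_metric A F z (D z \<xi> Y) (Z z) + finsler_metric A F z (Y z) (D z \<xi> Z)) \<and>
    (\<forall>X Y. vector_field (slit_atlas A) X \<and> vector_field (slit_atlas A) Y \<longrightarrow>
       torsion A D (hpart A D X) (hpart A D Y) = 0) \<and>
    (\<forall>X Y Z. vector_field (slit_atlas A) X \<and> vector_field (slit_atlas A) Y \<and>
       vector_field (slit_atlas A) Z \<longrightarrow>
       (\<forall>z\<in>TM0 A.
          finsler_metric A F z (torsion A D (vpart A D X) Y z) (rho A Z z) =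
          finsler_metric A F z (torsion A D (vpart A D X) Z z) (rho A Y z)))"

text \<open>The \<open>hv\<close>-curvature \<open>P(X, Y)\<close> of sections \<open>X\<close>, \<open>Y\<close> is \<open>\<Omega>(H\<xi>, V\<zeta>)\<close> for any fields \<open>\<xi>\<close>, \<open>\<zeta>\<close> with
  \<open>\<rho>(\<xi>) = X\<close> and \<open>\<mu>(\<zeta>) = Y\<close>. For a regular connection the two arguments are determined by \<open>X\<close>
  and \<open>Y\<close>: \<open>H\<xi>\<close> is the horizontal field over \<open>X\<close>, and \<open>V\<zeta>\<close> is the vertical field that \<open>\<mu>\<close> maps
  to \<open>Y\<close>.\<close>

definition hlift ::
  "('m, 'e::euclidean_space) chart set \<Rightarrow> ('m, 'e) conn \<Rightarrow> ('m, 'e) psection \<Rightarrow> ('m, 'e) tfield"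
  where "hlift A D X = extend_by_zero (TM0 A)
    (\<lambda>z. THE \<xi>. \<xi> \<in> horizontal_space A D z \<and> rho_at A z \<xi> = X z)"

definition vlift ::
  "('m, 'e::euclidean_space) chart set \<Rightarrow> ('m, 'e) conn \<Rightarrow> ('m, 'e) psection \<Rightarrow> ('m, 'e) tfield"
  where "vlift A D Y = extend_by_zero (TM0 A)
    (\<lambda>z. THE \<xi>. \<xi> \<in> vertical_space A z \<and> mu_at A D z \<xi> = Y z)"

definition hv_curvature ::
  "('m, 'e::euclidean_space) chart set \<Rightarrow> ('m, 'e) conn \<Rightarrow> ('m, 'e) psection
     \<Rightarrow> ('m, 'e) psection \<Rightarrow> ('m, 'e) psection \<Rightarrow> ('m, 'e) psection"
  where "hv_curvature A D X Y Z = curvature A D (hlift A D X) (vlift A D Y) Z"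

definition hv_curvature_antisym ::
  "('m, 'e::euclidean_space) chart set \<Rightarrow> ('m, 'e) conn \<Rightarrow> ('m, 'e) psection
     \<Rightarrow> ('m, 'e) psection \<Rightarrow> ('m, 'e) psection \<Rightarrow> ('m, 'e) psection"
  where "hv_curvature_antisym A D X Y Z =
    (1/2) *\<^sub>R (hv_curvature A D X Y Z - hv_curvature A D Y X Z)"


section \<open>Nullity\<close>

definition eta ::
  "('m, 'e::euclidean_space) chart set \<Rightarrow> (('m, 'e) tpoint \<Rightarrow> real) \<Rightarrow> ('m, 'e) conn \<Rightarrow> real
     \<Rightarrow> ('m, 'e) tfield \<Rightarrow> ('m, 'e) tfield \<Rightarrow> ('m, 'e) psection \<Rightarrow> ('m, 'e) psection"
  where "eta A F D k X Y Z = (\<lambda>z.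
    k *\<^sub>R (finsler_metric A F z (rho A Y z) (Z z) *\<^sub>R rho A X z
         - finsler_metric A F z (rho A X z) (Z z) *\<^sub>R rho A Y z)
    + hv_curvature_antisym A D (rho A X) (mu A D Y) Z z)"

definition related_curvature ::
  "('m, 'e::euclidean_space) chart set \<Rightarrow> (('m, 'e) tpoint \<Rightarrow> real) \<Rightarrow> ('m, 'e) conn \<Rightarrow> real
     \<Rightarrow> ('m, 'e) tfield \<Rightarrow> ('m, 'e) tfield \<Rightarrow> ('m, 'e) psection \<Rightarrow> ('m, 'e) psection"
  where "related_curvature A F D k X Y Z = curvature A D X Y Z - eta A F D k X Y Z"

text \<open>The related curvature operator is a tensor, so its value on tangent vectors at \<open>z\<close> is
  its value at \<open>z\<close> on arbitrary fields and sections extending them.\<close>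

definition nullity_hspace ::
  "('m, 'e::euclidean_space) chart set \<Rightarrow> (('m, 'e) tpoint \<Rightarrow> real) \<Rightarrow> ('m, 'e) conn \<Rightarrow> real
     \<Rightarrow> ('m, 'e) tpoint \<Rightarrow> ('m, 'e) ttvec set"
  where "nullity_hspace A F D k z = {\<xi> \<in> horizontal_space A D z.
    \<forall>X Y Z. vector_field (slit_atlas A) X \<and> vector_field (slit_atlas A) Y \<and>
      pullback_section A Z \<and> X z = \<xi> \<and> Y z \<in> horizontal_space A D z \<longrightarrow>
      related_curvature A F D k X Y Z z = 0}"

definition nullity_independent_of_direction ::
  "('m, 'e::euclidean_space) chart set \<Rightarrow> (('m, 'e) tpoint \<Rightarrow> real) \<Rightarrow> ('m, 'e) conn \<Rightarrow> real
     \<Rightarrow> bool"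
  where "nullity_independent_of_direction A F D k \<longleftrightarrow>
    (\<forall>z\<in>TM0 A. \<forall>w\<in>TM0 A. fst z = fst w \<longrightarrow>
       rho_at A z ` nullity_hspace A F D k z = rho_at A w ` nullity_hspace A F D k w)"

text \<open>Under \<^const>\<open>nullity_independent_of_direction\<close> all members of the union coincide.\<close>

definition nullity_space ::
  "('m, 'e::euclidean_space) chart set \<Rightarrow> (('m, 'e) tpoint \<Rightarrow> real) \<Rightarrow> ('m, 'e) conn \<Rightarrow> real
     \<Rightarrow> 'm \<Rightarrow> ('m, 'e) tvec set"
  where "nullity_space A F D k x =
    (\<Union>z\<in>{z \<in> TM0 A. fst z = x}. rho_at A z ` nullity_hspace A F D k z)"

definition nullity_index ::
  "('m, 'e::euclidean_space) chart set \<Rightarrow> (('m, 'e) tpoint \<Rightarrow> real) \<Rightarrow> ('m, 'e) conn \<Rightarrow> real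
     \<Rightarrow> 'm \<Rightarrow> nat"
  where "nullity_index A F D k x = dim (nullity_space A F D k x)"

end

theory Submission
  imports Defs
begin

text \<open>
  Let \<open>R\<close> be the curvature of the Cartan connection on horizontal vectors, \<open>P\<close> its \<open>hv\<close>-curvature
  and \<open>B(X,Y)Z = k {g(Y,Z)X - g(X,Z)Y}\<close>. On horizontal vectors the antisymmetric part of \<open>P\<close> in
  the related curvature operator is evaluated on \<open>\<mu> = 0\<close> and drops out, so a vector \<open>X\<close> is a nullity
  vector at \<open>z = (x,v)\<close> iff \<open>Rb(X,Y) = R(X,Y) - B(X,Y)\<close> is zero for all \<open>Y\<close>.

  The second Bianchi identity for \<open>R\<close> has the right-hand side \<open>P(Z, R(X,Y)v)\<close>, summed
  cyclically, because brackets of horizontal fields have the vertical part \<open>-R(X,Y)v\<close>;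
  for \<open>B\<close>, which is parallel, the right-hand side is zero. On two nullity fields \<open>X\<close>, \<open>Y\<close> with bracket
  \<open>T\<close> the difference of the two identities reads, up to sign,
  \<open>Rb(T,Z) = P(Z, R(X,Y)v) + P(X, R(Y,Z)v) + P(Y, R(Z,X)v)\<close>, and the nullity of \<open>X\<close> and \<open>Y\<close> turns the
  right-hand side into \<open>k\<close> times the cyclic sum of \<open>g(X,v) {P(Y,Z) - P(Z,Y)}\<close>. This sum has no
  reason to vanish for all \<open>v\<close>. Since the nullity spaces do not depend on the direction, one
  direction suffices, and two observations settle it.

  First, \<open>P(X,Y)v\<close> is symmetric in \<open>X\<close> and \<open>Y\<close>, so that \<open>Rb(T,Z)v = 0\<close> for \<^emph>\<open>every\<close> direction \<open>v\<close> over
  \<open>x\<close>. An identity along the whole fibre may be differentiated vertically; together with the first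
  Bianchi identity and the symmetry of \<open>Z \<mapsto> R(Z,v)v\<close> this gives \<open>Rb(T,v) = 0\<close> (\<open>Rb_canonical\<close>).
  Secondly, as the nullity space is not the whole tangent space, it has a non-zero
  \<open>g\<^sub>v\<close>-orthogonal direction \<open>v\<close>: minimise \<open>F\<close> on a translate of it (\<open>orthogonal_direction\<close>). There
  \<open>Rb(T,Z) = g(Z,v) A\<close> with \<open>A\<close> independent of \<open>Z\<close>; putting \<open>Z = v\<close> yields \<open>A = 0\<close>, so \<open>T\<close> is a nullity
  vector (\<open>nullity_involutive\<close>).

  That the nullity spaces form a smooth distribution is the fact that the kernels of a smooth family
  of linear maps have smooth local frames where their dimension is constant (\<open>kernel_frame\<close>).

  All of this is computed in a chart. A connection acts on global sections only; multiplication
  by a bump function of the base point makes it a connection form \<open>om\<close> over a small open set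
  (\<open>D_coord\<close>), and the conditions defining the Cartan connection become the axioms of the locales
  \<open>local_metric_connection\<close> and \<open>local_cartan\<close>.
\<close>

section \<open>Calculus of smooth maps between Euclidean spaces\<close>

abbreviation dd :: "('a::euclidean_space \<Rightarrow> 'b::real_normed_vector) \<Rightarrow> 'a \<Rightarrow> 'a \<Rightarrow> 'b"
  where "dd f p \<equiv> frechet_derivative f (at p)"

lemma frechet_derivative_cong_open:
  assumes "open S" "x \<in> S" "\<And>y. y \<in> S \<Longrightarrow> f y = g y"
  shows "dd f x = dd g x"
proof -
  have "(f has_derivative f') (at x) \<longleftrightarrow> (g has_derivative f') (at x)" for f'
    using assms by (metis has_derivative_transform_within_open)
  then show ?thesis by (simp add: frechet_derivative_def)
qed

lemma differentiable_cong_open: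
  assumes "f differentiable (at x)" "open S" "x \<in> S" "\<And>y. y \<in> S \<Longrightarrow> f y = g y"
  shows "g differentiable (at x)"
  using assms unfolding differentiable_def by (metis has_derivative_transform_within_open)

lemma dd_eqI: "(f has_derivative f') (at x) \<Longrightarrow> dd f x = f'"
  using frechet_derivative_at by metis

lemma C_k_on_cong:
  assumes "open S" "\<And>x. x \<in> S \<Longrightarrow> f x = g x" "C_k_on k S f"
  shows "C_k_on k S g"
  using assms(2,3)
proof (induction k arbitrary: f g)
  case 0
  then show ?case by (simp cong: continuous_on_cong)
next
  case (Suc k)
  have "g differentiable at x" if "x \<in> S" for x
    using Suc.prems that assms(1) differentiable_cong_open[of f x S g] by auto
  moreover have "C_k_on k S (\<lambda>x. dd g x b)" if "b \<in> Basis" for b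
    by (rule Suc.IH[of "\<lambda>x. dd f x b"])
      (use Suc.prems that assms(1) in \<open>auto simp: frechet_derivative_cong_open[of S _ f g]\<close>)
  ultimately show ?case by simp
qed

lemma smooth_on_cong:
  assumes "open S" "\<And>x. x \<in> S \<Longrightarrow> f x = g x" "smooth_on S f"
  shows "smooth_on S g"
  using assms C_k_on_cong unfolding smooth_on_def by blast

lemma C_k_on_Suc_has_derivative:
  "C_k_on (Suc k) S f \<Longrightarrow> x \<in> S \<Longrightarrow> (f has_derivative dd f x) (at x)"
  using frechet_derivative_works by auto

lemma C_k_on_imp_continuous: "C_k_on k S f \<Longrightarrow> continuous_on S f"
proof (cases k)
  case (Suc j)
  assume "C_k_on k S f"
  then have "\<forall>x\<in>S. f differentiable (at x)" using Suc by simp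
  then show ?thesis
    by (meson continuous_at_imp_continuous_on differentiable_imp_continuous_within)
qed simp

lemma C_k_on_SucD: "C_k_on (Suc k) S f \<Longrightarrow> C_k_on k S f"
proof (induction k arbitrary: f)
  case 0
  then show ?case using C_k_on_imp_continuous[of "Suc 0"] by (metis C_k_on.simps(1))
next
  case (Suc k)
  then show ?case by (metis C_k_on.simps(2))
qed

lemma C_k_on_subset: "C_k_on k S f \<Longrightarrow> T \<subseteq> S \<Longrightarrow> C_k_on k T f"
proof (induction k arbitrary: f)
  case 0 then show ?case by (auto intro: continuous_on_subset)
next
  case (Suc k) then show ?case by (simp add: subset_iff)
qed

lemma smooth_on_subset: "smooth_on S f \<Longrightarrow> T \<subseteq> S \<Longrightarrow> smooth_on T f"
  using C_k_on_subset unfolding smooth_on_def by blast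

lemma C_k_on_local:
  assumes "\<And>x. x \<in> S \<Longrightarrow> \<exists>T. open T \<and> x \<in> T \<and> C_k_on k T f"
  shows "C_k_on k S f"
  using assms
proof (induction k arbitrary: f)
  case 0
  have "continuous (at x) f" if "x \<in> S" for x
    using 0[OF that] continuous_on_eq_continuous_at by auto
  then show ?case by (simp add: continuous_at_imp_continuous_on)
next
  case (Suc k)
  have "f differentiable at x" if "x \<in> S" for x using Suc.prems[OF that] by auto
  moreover have "C_k_on k S (\<lambda>x. dd f x b)" if "b \<in> Basis" for b
    by (rule Suc.IH) (metis C_k_on.simps(2) Suc.prems that)
  ultimately show ?case by simp
qed

lemma smooth_on_local:
  assumes "\<And>x. x \<in> S \<Longrightarrow> \<exists>T. open T \<and> x \<in> T \<and> smooth_on T f"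
  shows "smooth_on S f"
  unfolding smooth_on_def
proof
  fix k show "C_k_on k S f"
    by (rule C_k_on_local) (use assms smooth_on_def in blast)
qed

lemma smooth_on_differentiable: "smooth_on S f \<Longrightarrow> x \<in> S \<Longrightarrow> f differentiable (at x)"
  unfolding smooth_on_def by (meson C_k_on.simps(2))

lemma smooth_on_has_derivative: "smooth_on S f \<Longrightarrow> x \<in> S \<Longrightarrow> (f has_derivative dd f x) (at x)"
  using smooth_on_differentiable frechet_derivative_works by blast

lemma smooth_on_linear_dd: "smooth_on S f \<Longrightarrow> x \<in> S \<Longrightarrow> linear (dd f x)"
  using smooth_on_differentiable linear_frechet_derivative by blast

lemma smooth_on_imp_continuous: "smooth_on S f \<Longrightarrow> continuous_on S f"
  unfolding smooth_on_def using C_k_on_imp_continuous by blast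

lemma C_k_on_const: "C_k_on k S (\<lambda>x. c)"
  by (induction k arbitrary: c) auto

lemma smooth_on_const [simp, intro]: "smooth_on S (\<lambda>x. c)"
  by (simp add: smooth_on_def C_k_on_const)

lemma C_k_on_bounded_linear:
  assumes "bounded_linear h" "open S" "C_k_on k S f"
  shows "C_k_on k S (\<lambda>x. h (f x))"
  using assms(3)
proof (induction k arbitrary: f)
  case 0
  then show ?case
    using bounded_linear.continuous_on[OF assms(1)] by auto
next
  case (Suc k)
  have d: "((\<lambda>x. h (f x)) has_derivative (\<lambda>y. h (dd f x y))) (at x)" if "x \<in> S" for x
    by (rule bounded_linear.has_derivative[OF assms(1) C_k_on_Suc_has_derivative[OF Suc.prems that]])
  have "C_k_on k S (\<lambda>x. dd (\<lambda>x. h (f x)) x b)" if "b \<in> Basis" for b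
    by (rule C_k_on_cong[OF assms(2) _ Suc.IH[of "\<lambda>x. dd f x b"]])
      (use Suc.prems that in \<open>auto simp: dd_eqI[OF d]\<close>)
  then show ?case by (simp add: differentiableI[OF d])
qed

lemma smooth_on_bounded_linear:
  "bounded_linear h \<Longrightarrow> open S \<Longrightarrow> smooth_on S f \<Longrightarrow> smooth_on S (\<lambda>x. h (f x))"
  unfolding smooth_on_def by (metis C_k_on_bounded_linear)

lemma smooth_on_ident [simp, intro]: "smooth_on S (\<lambda>x. x)"
proof -
  have "C_k_on k S (\<lambda>x. x)" for k
    by (cases k) (auto simp: C_k_on_const)
  then show ?thesis by (simp add: smooth_on_def)
qed

lemma smooth_on_linear: "bounded_linear h \<Longrightarrow> open S \<Longrightarrow> smooth_on S h"
  using smooth_on_bounded_linear[of h S "\<lambda>x. x"] by simp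

lemma C_k_on_add:
  assumes "open S" "C_k_on k S f" "C_k_on k S g"
  shows "C_k_on k S (\<lambda>x. f x + g x)"
  using assms(2,3)
proof (induction k arbitrary: f g)
  case 0 then show ?case by (auto intro: continuous_intros)
next
  case (Suc k)
  have d: "((\<lambda>x. f x + g x) has_derivative (\<lambda>y. dd f x y + dd g x y)) (at x)" if "x \<in> S" for x
    by (intro has_derivative_add C_k_on_Suc_has_derivative[OF Suc.prems(1) that]
        C_k_on_Suc_has_derivative[OF Suc.prems(2) that])
  have "C_k_on k S (\<lambda>x. dd (\<lambda>x. f x + g x) x b)" if "b \<in> Basis" for b
    by (rule C_k_on_cong[OF assms(1) _ Suc.IH[of "\<lambda>x. dd f x b" "\<lambda>x. dd g x b"]])
      (use Suc.prems that in \<open>auto simp: dd_eqI[OF d]\<close>)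
  then show ?case by (simp add: differentiableI[OF d])
qed

lemma smooth_on_add:
  "open S \<Longrightarrow> smooth_on S f \<Longrightarrow> smooth_on S g \<Longrightarrow> smooth_on S (\<lambda>x. f x + g x)"
  unfolding smooth_on_def by (metis C_k_on_add)

lemma smooth_on_uminus: "open S \<Longrightarrow> smooth_on S f \<Longrightarrow> smooth_on S (\<lambda>x. - f x)"
  by (rule smooth_on_bounded_linear[OF bounded_linear_minus[OF bounded_linear_ident]])

lemma smooth_on_diff:
  "open S \<Longrightarrow> smooth_on S f \<Longrightarrow> smooth_on S g \<Longrightarrow> smooth_on S (\<lambda>x. f x - g x)"
  using smooth_on_add[of S f "\<lambda>x. - g x"] smooth_on_uminus by auto

lemma C_k_on_sum:
  "open S \<Longrightarrow> (\<And>i. i \<in> I \<Longrightarrow> C_k_on k S (f i)) \<Longrightarrow> C_k_on k S (\<lambda>x. \<Sum>i\<in>I. f i x)"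
  by (induction I rule: infinite_finite_induct) (auto intro: C_k_on_add C_k_on_const)

lemma smooth_on_sum:
  "open S \<Longrightarrow> (\<And>i. i \<in> I \<Longrightarrow> smooth_on S (f i)) \<Longrightarrow> smooth_on S (\<lambda>x. \<Sum>i\<in>I. f i x)"
  unfolding smooth_on_def by (intro allI C_k_on_sum) auto

lemma C_k_on_bilinear:
  assumes "bounded_bilinear h" "open S" "C_k_on k S f" "C_k_on k S g"
  shows "C_k_on k S (\<lambda>x. h (f x) (g x))"
  using assms(3,4)
proof (induction k arbitrary: f g)
  case 0
  then show ?case using bounded_bilinear.continuous_on[OF assms(1)] by auto
next
  case (Suc k)
  have d: "((\<lambda>x. h (f x) (g x)) has_derivative
      (\<lambda>y. h (f x) (dd g x y) + h (dd f x y) (g x))) (at x)" if "x \<in> S" for x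
    by (intro bounded_bilinear.FDERIV[OF assms(1)] C_k_on_Suc_has_derivative[OF Suc.prems(1) that]
        C_k_on_Suc_has_derivative[OF Suc.prems(2) that])
  have "C_k_on k S (\<lambda>x. dd (\<lambda>x. h (f x) (g x)) x b)" if "b \<in> Basis" for b
    by (rule C_k_on_cong[OF assms(2) _ C_k_on_add[OF assms(2) Suc.IH[of f "\<lambda>x. dd g x b"]
            Suc.IH[of "\<lambda>x. dd f x b" g]]])
      (use Suc.prems that C_k_on_SucD[OF Suc.prems(1)] C_k_on_SucD[OF Suc.prems(2)]
        in \<open>auto simp: dd_eqI[OF d]\<close>)
  then show ?case by (simp add: differentiableI[OF d])
qed

lemma smooth_on_bilinear:
  "bounded_bilinear h \<Longrightarrow> open S \<Longrightarrow> smooth_on S f \<Longrightarrow> smooth_on S g \<Longrightarrow>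
    smooth_on S (\<lambda>x. h (f x) (g x))"
  unfolding smooth_on_def by (metis C_k_on_bilinear)

lemmas smooth_on_scaleR = smooth_on_bilinear[OF bounded_bilinear_scaleR]
lemmas smooth_on_mult = smooth_on_bilinear[OF bounded_bilinear_mult]
lemmas smooth_on_inner = smooth_on_bilinear[OF bounded_bilinear_inner]

lemma smooth_on_Pair:
  assumes "open S" "smooth_on S f" "smooth_on S g"
  shows "smooth_on S (\<lambda>x. (f x, g x))"
proof -
  have "bounded_linear (\<lambda>y. (y, 0))" "bounded_linear (\<lambda>y. (0, y))"
    by (auto intro: bounded_linear_intros)
  from smooth_on_add[OF assms(1) smooth_on_bounded_linear[OF this(1) assms(1,2)]
      smooth_on_bounded_linear[OF this(2) assms(1,3)]]
  show ?thesis by simp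
qed

lemma smooth_on_fst: "open S \<Longrightarrow> smooth_on S f \<Longrightarrow> smooth_on S (\<lambda>x. fst (f x))"
  by (rule smooth_on_bounded_linear[OF bounded_linear_fst])

lemma dd_basis_expansion:
  assumes "f differentiable (at x)"
  shows "dd f x w = (\<Sum>i\<in>Basis. (w \<bullet> i) *\<^sub>R dd f x i)"
proof -
  interpret linear "dd f x" using assms linear_frechet_derivative by blast
  have "dd f x w = dd f x (\<Sum>i\<in>Basis. (w \<bullet> i) *\<^sub>R i)" by (simp add: euclidean_representation)
  then show ?thesis by (simp add: sum scale)
qed

text \<open>Expanding \<open>w x\<close> in the basis reduces this to the partial derivatives, whose smoothness is part
  of the definition.\<close>

lemma smooth_on_dd:
  assumes "open S" "smooth_on S f" "smooth_on S w"
  shows "smooth_on S (\<lambda>x. dd f x (w x))"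
proof -
  have "smooth_on S (\<lambda>x. dd f x b)" if "b \<in> Basis" for b
    unfolding smooth_on_def
  proof
    fix k
    have "C_k_on (Suc k) S f" using assms(2) by (simp add: smooth_on_def)
    then show "C_k_on k S (\<lambda>x. dd f x b)" using that by simp
  qed
  then have "smooth_on S (\<lambda>x. \<Sum>i\<in>Basis. (w x \<bullet> i) *\<^sub>R dd f x i)"
    using assms by (intro smooth_on_sum smooth_on_scaleR smooth_on_inner) auto
  then show ?thesis
    by (rule smooth_on_cong[OF assms(1), rotated])
      (rule dd_basis_expansion[OF smooth_on_differentiable[OF assms(2)], symmetric])
qed

lemmas smooth_on_dd_const = smooth_on_dd[OF _ _ smooth_on_const]

lemma C_k_on_compose:
  fixes f :: "'a::euclidean_space \<Rightarrow> 'b::euclidean_space"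
  assumes "open S" "open T" "f ` S \<subseteq> T" "C_k_on k S f" "C_k_on k T g"
  shows "C_k_on k S (\<lambda>x. g (f x))"
  using assms(4,5)
proof (induction k arbitrary: g)
  case 0
  then show ?case using continuous_on_compose2[OF _ _ assms(3), of g] by simp
next
  case (Suc k)
  have d: "((\<lambda>x. g (f x)) has_derivative (\<lambda>y. dd g (f x) (dd f x y))) (at x)" if "x \<in> S" for x
    by (rule has_derivative_compose[OF C_k_on_Suc_has_derivative[OF Suc.prems(1) that]
          C_k_on_Suc_has_derivative[OF Suc.prems(2)]]) (use assms(3) that in auto)
  have "C_k_on k S (\<lambda>x. dd (\<lambda>x. g (f x)) x b)" if b: "b \<in> Basis" for b
  proof (rule C_k_on_cong[OF assms(1)])
    show "C_k_on k S (\<lambda>x. \<Sum>i\<in>Basis. (dd f x b \<bullet> i) *\<^sub>R dd g (f x) i)"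
    proof (intro C_k_on_sum C_k_on_bilinear[OF bounded_bilinear_scaleR]
          C_k_on_bilinear[OF bounded_bilinear_inner] assms C_k_on_const)
      show "C_k_on k S (\<lambda>x. dd f x b)" using Suc.prems(1) b by simp
      show "C_k_on k S (\<lambda>x. dd g (f x) i)" if "i \<in> Basis" for i
        using Suc.IH[OF C_k_on_SucD[OF Suc.prems(1)], of "\<lambda>y. dd g y i"] Suc.prems(2) that by simp
    qed
    show "(\<Sum>i\<in>Basis. (dd f x b \<bullet> i) *\<^sub>R dd g (f x) i) = dd (\<lambda>x. g (f x)) x b" if "x \<in> S" for x
    proof -
      have "g differentiable (at (f x))" using that assms(3) Suc.prems(2) by auto
      from dd_basis_expansion[OF this, of "dd f x b"] show ?thesis
        by (simp only: dd_eqI[OF d[OF that]])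
    qed
  qed
  then show ?case by (simp add: differentiableI[OF d])
qed

lemma smooth_on_compose:
  fixes f :: "'a::euclidean_space \<Rightarrow> 'b::euclidean_space"
  shows "open S \<Longrightarrow> open T \<Longrightarrow> f ` S \<subseteq> T \<Longrightarrow> smooth_on S f \<Longrightarrow> smooth_on T g \<Longrightarrow>
    smooth_on S (\<lambda>x. g (f x))"
  unfolding smooth_on_def by (metis C_k_on_compose)

lemma dd_compose:
  fixes f :: "'a::euclidean_space \<Rightarrow> 'b::euclidean_space"
  assumes "f differentiable (at x)" "g differentiable (at (f x))"
  shows "dd (\<lambda>x. g (f x)) x w = dd g (f x) (dd f x w)"
proof -
  have "((\<lambda>x. g (f x)) has_derivative (\<lambda>y. dd g (f x) (dd f x y))) (at x)"
    by (rule has_derivative_compose[OF assms[unfolded frechet_derivative_works]])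
  then show ?thesis by (simp add: dd_eqI)
qed

lemma dd_add:
  assumes "f differentiable (at x)" "g differentiable (at x)"
  shows "dd (\<lambda>x. f x + g x) x w = dd f x w + dd g x w"
proof -
  have "((\<lambda>x. f x + g x) has_derivative (\<lambda>w. dd f x w + dd g x w)) (at x)"
    by (rule has_derivative_add[OF assms[unfolded frechet_derivative_works]])
  then show ?thesis by (simp add: dd_eqI)
qed

lemma dd_diff:
  assumes "f differentiable (at x)" "g differentiable (at x)"
  shows "dd (\<lambda>x. f x - g x) x w = dd f x w - dd g x w"
proof -
  have "((\<lambda>x. f x - g x) has_derivative (\<lambda>w. dd f x w - dd g x w)) (at x)"
    by (rule has_derivative_diff[OF assms[unfolded frechet_derivative_works]])
  then show ?thesis by (simp add: dd_eqI)
qed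

lemma dd_bounded_linear:
  assumes "bounded_linear h" "f differentiable (at x)"
  shows "dd (\<lambda>x. h (f x)) x w = h (dd f x w)"
proof -
  have "((\<lambda>x. h (f x)) has_derivative (\<lambda>w. h (dd f x w))) (at x)"
    by (rule bounded_linear.has_derivative[OF assms(1) assms(2)[unfolded frechet_derivative_works]])
  then show ?thesis by (simp add: dd_eqI)
qed

lemma dd_Pair:
  assumes "f differentiable (at x)" "g differentiable (at x)"
  shows "dd (\<lambda>x. (f x, g x)) x w = (dd f x w, dd g x w)"
proof -
  have "((\<lambda>x. (f x, g x)) has_derivative (\<lambda>w. (dd f x w, dd g x w))) (at x)"
    by (rule has_derivative_Pair[OF assms[unfolded frechet_derivative_works]])
  then show ?thesis by (simp add: dd_eqI)
qed

subsection \<open>Symmetry of second derivatives\<close>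

text \<open>Both mixed partial derivatives are limits of the second difference quotient over a small
  parallelogram; the mean value theorem along each of its two sides shows this.\<close>

lemma mean_value_along:
  fixes f :: "'a::euclidean_space \<Rightarrow> real"
  assumes "0 < s" "\<And>t. 0 \<le> t \<Longrightarrow> t \<le> s \<Longrightarrow> f differentiable (at (p + t *\<^sub>R a))"
  obtains t where "0 < t" "t < s" "f (p + s *\<^sub>R a) - f p = s * dd f (p + t *\<^sub>R a) a"
proof -
  have d: "DERIV (\<lambda>t. f (p + t *\<^sub>R a)) t :> dd f (p + t *\<^sub>R a) a" if "0 \<le> t" "t \<le> s" for t
  proof -
    have "(f has_derivative dd f (p + t *\<^sub>R a)) (at (p + t *\<^sub>R a))"
      using assms(2)[OF that] frechet_derivative_works by blast
    moreover have "((\<lambda>t. p + t *\<^sub>R a) has_derivative (\<lambda>h. h *\<^sub>R a)) (at t)"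
      by (auto intro!: derivative_eq_intros)
    ultimately have "((\<lambda>t. f (p + t *\<^sub>R a)) has_derivative (\<lambda>h. dd f (p + t *\<^sub>R a) (h *\<^sub>R a))) (at t)"
      by (rule has_derivative_compose[rotated])
    moreover have "dd f (p + t *\<^sub>R a) (h *\<^sub>R a) = dd f (p + t *\<^sub>R a) a * h" for h
      using linear_frechet_derivative[OF assms(2)[OF that]] by (simp add: linear_cmul)
    ultimately show ?thesis by (simp add: has_field_derivative_def)
  qed
  obtain z where "z > 0" "z < s" "f (p + s *\<^sub>R a) - f (p + 0 *\<^sub>R a) = (s - 0) * dd f (p + z *\<^sub>R a) a"
    using MVT2[OF assms(1) d, of ] by auto
  then show ?thesis using that by simp
qed

lemma dist_add_self: "dist p (p + w) = norm (w::'a::real_normed_vector)"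
  by (simp add: dist_norm)

lemma dd_dd_commute_real:
  fixes f :: "'a::euclidean_space \<Rightarrow> real"
  assumes S: "open S" "p \<in> S" and f: "smooth_on S f"
  shows "dd (\<lambda>q. dd f q a) p b = dd (\<lambda>q. dd f q b) p a"
proof -
  define A where "A = (\<lambda>q. dd (\<lambda>q. dd f q a) q b)"
  define B where "B = (\<lambda>q. dd (\<lambda>q. dd f q b) q a)"
  have sa: "smooth_on S (\<lambda>q. dd f q a)" "smooth_on S (\<lambda>q. dd f q b)"
    by (rule smooth_on_dd_const[OF S(1) f])+
  have contA: "isCont A p" "isCont B p"
    using smooth_on_imp_continuous[OF smooth_on_dd_const[OF S(1) sa(1)]]
      smooth_on_imp_continuous[OF smooth_on_dd_const[OF S(1) sa(2)]] S
    unfolding A_def B_def by (auto simp: continuous_on_eq_continuous_at)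
  obtain d where d: "d > 0" "ball p d \<subseteq> S" using S openE by blast
  have key: "\<exists>q r. q \<in> ball p e \<and> r \<in> ball p e \<and> A q = B r" if e: "0 < e" "e \<le> d" for e
  proof -
    define s where "s = e / (norm a + norm b + 1) / 2"
    have np: "norm a + norm b + 1 > 0" by (smt (verit) norm_ge_zero)
    have s: "s > 0" using e np by (simp add: s_def)
    have "s * (norm a + norm b + 1) = e/2"
    proof -
      have "e / m / 2 * m = e / 2" if "m > 0" for m :: real using that by simp
      from this[OF np] show ?thesis unfolding s_def .
    qed
    then have bd: "s * norm a + s * norm b < e" using e s by (simp add: algebra_simps)
    have inb: "p + t *\<^sub>R a + u *\<^sub>R b \<in> ball p e" if "0 \<le> t" "t \<le> s" "0 \<le> u" "u \<le> s" for t u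
    proof -
      have "norm (t *\<^sub>R a + u *\<^sub>R b) \<le> norm (t *\<^sub>R a) + norm (u *\<^sub>R b)" by (rule norm_triangle_ineq)
      also have "\<dots> \<le> s * norm a + s * norm b"
        using that by (auto intro!: add_mono mult_right_mono)
      finally have "norm (t *\<^sub>R a + u *\<^sub>R b) < e" using bd by simp
      moreover have "dist p (p + t *\<^sub>R a + u *\<^sub>R b) = norm (t *\<^sub>R a + u *\<^sub>R b)"
        using dist_add_self[of p "t *\<^sub>R a + u *\<^sub>R b"] by (simp only: add.assoc)
      ultimately show ?thesis by simp
    qed
    have inS: "p + t *\<^sub>R a + u *\<^sub>R b \<in> S" if "0 \<le> t" "t \<le> s" "0 \<le> u" "u \<le> s" for t u
      using inb[OF that] d e by auto
    have step: "\<exists>q. q \<in> ball p e \<and>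
        f (p + s *\<^sub>R a' + s *\<^sub>R b') - f (p + s *\<^sub>R a') - f (p + s *\<^sub>R b') + f p
          = s * s * dd (\<lambda>q. dd f q a') q b'"
      if inb: "\<And>t u. 0 \<le> t \<Longrightarrow> t \<le> s \<Longrightarrow> 0 \<le> u \<Longrightarrow> u \<le> s \<Longrightarrow> p + t *\<^sub>R a' + u *\<^sub>R b' \<in> ball p e"
        and sa: "smooth_on S (\<lambda>q. dd f q a')" for a' b'
    proof -
      have inS: "p + t *\<^sub>R a' + u *\<^sub>R b' \<in> S" if "0 \<le> t" "t \<le> s" "0 \<le> u" "u \<le> s" for t u
        using inb[OF that] d e by auto
      have dfa: "(\<lambda>x. f (x + s *\<^sub>R b')) differentiable at x \<and> dd (\<lambda>x. f (x + s *\<^sub>R b')) x w = dd f (x + s *\<^sub>R b') w"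
        if "x + s *\<^sub>R b' \<in> S" for x w
      proof -
        have "((\<lambda>x. f (x + s *\<^sub>R b')) has_derivative dd f (x + s *\<^sub>R b')) (at x)"
          by (rule has_derivative_compose[OF has_derivative_add_const[OF has_derivative_ident]
                smooth_on_has_derivative[OF f that]])
        then show ?thesis by (auto simp: dd_eqI differentiable_def)
      qed
      have diff: "(\<lambda>x. f (x + s *\<^sub>R b') - f x) differentiable at (p + t *\<^sub>R a')" if "0 \<le> t" "t \<le> s" for t
        using inS[OF that, of s] inS[OF that, of 0] s dfa smooth_on_differentiable[OF f]
        by (auto intro!: differentiable_diff)
      obtain t where t: "0 < t" "t < s"
        "f (p + s *\<^sub>R a' + s *\<^sub>R b') - f (p + s *\<^sub>R a') - (f (p + s *\<^sub>R b') - f p)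
         = s * dd (\<lambda>x. f (x + s *\<^sub>R b') - f x) (p + t *\<^sub>R a') a'"
        using mean_value_along[of s "\<lambda>x. f (x + s *\<^sub>R b') - f x" p a', OF s diff] by blast
      have tt: "p + t *\<^sub>R a' + s *\<^sub>R b' \<in> S" "p + t *\<^sub>R a' \<in> S"
        using inS[of t s] inS[of t 0] t s by auto
      have "dd (\<lambda>x. f (x + s *\<^sub>R b') - f x) (p + t *\<^sub>R a') a'
          = dd f (p + t *\<^sub>R a' + s *\<^sub>R b') a' - dd f (p + t *\<^sub>R a') a'"
        using dd_diff[of "\<lambda>x. f (x + s *\<^sub>R b')" "p + t *\<^sub>R a'" f a'] tt dfa smooth_on_differentiable[OF f]
        by auto
      moreover have "(\<lambda>q. dd f q a') differentiable (at (p + t *\<^sub>R a' + u *\<^sub>R b'))" if "0 \<le> u" "u \<le> s" for u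
        using smooth_on_differentiable[OF sa] inS[of t u] t that by auto
      then obtain u where u: "0 < u" "u < s"
        "dd f (p + t *\<^sub>R a' + s *\<^sub>R b') a' - dd f (p + t *\<^sub>R a') a'
          = s * dd (\<lambda>q. dd f q a') (p + t *\<^sub>R a' + u *\<^sub>R b') b'"
        using mean_value_along[of s "\<lambda>q. dd f q a'" "p + t *\<^sub>R a'" b', OF s] by blast
      have "p + t *\<^sub>R a' + u *\<^sub>R b' \<in> ball p e" using inb[of t u] t u by auto
      moreover have "f (p + s *\<^sub>R a' + s *\<^sub>R b') - f (p + s *\<^sub>R a') - f (p + s *\<^sub>R b') + f p
          = s * s * dd (\<lambda>q. dd f q a') (p + t *\<^sub>R a' + u *\<^sub>R b') b'"
        using t(3) u(3) calculation(1) by simp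
      ultimately show ?thesis by blast
    qed
    obtain q where q: "q \<in> ball p e"
      "f (p + s *\<^sub>R a + s *\<^sub>R b) - f (p + s *\<^sub>R a) - f (p + s *\<^sub>R b) + f p = s * s * A q"
      using step[of a b] inb sa unfolding A_def by blast
    have "p + t *\<^sub>R b + u *\<^sub>R a \<in> ball p e" if "0 \<le> t" "t \<le> s" "0 \<le> u" "u \<le> s" for t u
      using inb[OF that(3,4,1,2)] by (simp add: add.assoc add.commute[of "u *\<^sub>R a"])
    then obtain r where r: "r \<in> ball p e"
      "f (p + s *\<^sub>R b + s *\<^sub>R a) - f (p + s *\<^sub>R b) - f (p + s *\<^sub>R a) + f p = s * s * B r"
      using step[of b a] sa unfolding B_def by blast
    have "p + s *\<^sub>R a + s *\<^sub>R b = p + s *\<^sub>R b + s *\<^sub>R a" by simp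
    from q(2)[unfolded this] r(2) have "s * s * A q = s * s * B r" by linarith
    then have "A q = B r" using s by simp
    then show ?thesis using q(1) r(1) by blast
  qed
  have "A p = B p"
  proof (rule ccontr)
    assume ne: "A p \<noteq> B p"
    define m where "m = dist (A p) (B p) / 2"
    have m: "m > 0" using ne by (simp add: m_def)
    obtain e1 where e1: "e1 > 0" "\<And>q. dist q p < e1 \<Longrightarrow> dist (A q) (A p) < m"
      using contA(1)[unfolded continuous_at_eps_delta, rule_format, OF m] by blast
    obtain e2 where e2: "e2 > 0" "\<And>q. dist q p < e2 \<Longrightarrow> dist (B q) (B p) < m"
      using contA(2)[unfolded continuous_at_eps_delta, rule_format, OF m] by blast
    obtain q r where qr: "q \<in> ball p (min d (min e1 e2))" "r \<in> ball p (min d (min e1 e2))" "A q = B r"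
      using key[of "min d (min e1 e2)"] d e1 e2 by auto
    have "dist (A q) (A p) < m" "dist (A q) (B p) < m"
      using e1(2)[of q] e2(2)[of r] qr by (auto simp: dist_commute)
    then have "dist (A p) (B p) < 2 * m"
      using dist_triangle[of "A p" "B p" "A q"] by (simp add: dist_commute)
    then show False by (simp add: m_def)
  qed
  then show ?thesis by (simp add: A_def B_def)
qed

lemma dd_dd_commute:
  fixes f :: "'a::euclidean_space \<Rightarrow> 'b::euclidean_space"
  assumes S: "open S" "p \<in> S" and f: "smooth_on S f"
  shows "dd (\<lambda>q. dd f q a) p b = dd (\<lambda>q. dd f q b) p a"
proof (rule euclidean_eqI)
  fix i :: 'b assume "i \<in> Basis"
  have bl: "bounded_linear (\<lambda>y. y \<bullet> i)" by (rule bounded_linear_inner_left)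
  have c: "dd (\<lambda>q. dd f q u) p w \<bullet> i = dd (\<lambda>q. dd (\<lambda>q. f q \<bullet> i) q u) p w" for u w
  proof -
    have "dd (\<lambda>q. dd f q u \<bullet> i) p w = dd (\<lambda>q. dd f q u) p w \<bullet> i"
      by (rule dd_bounded_linear[OF bl smooth_on_differentiable[OF smooth_on_dd_const[OF S(1) f] S(2)]])
    moreover have "dd (\<lambda>q. dd f q u \<bullet> i) p = dd (\<lambda>q. dd (\<lambda>q. f q \<bullet> i) q u) p"
      by (rule frechet_derivative_cong_open[OF S])
        (rule dd_bounded_linear[OF bl smooth_on_differentiable[OF f], symmetric])
    ultimately show ?thesis by simp
  qed
  show "dd (\<lambda>q. dd f q a) p b \<bullet> i = dd (\<lambda>q. dd f q b) p a \<bullet> i"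
    unfolding c by (rule dd_dd_commute_real[OF S smooth_on_bounded_linear[OF bl S(1) f]])
qed

subsection \<open>Families of linear maps\<close>

text \<open>A family of linear maps is a finite combination of its values on basis vectors, so the calculus
  of \<open>\<Phi> q (y q)\<close> needs smoothness of \<open>\<lambda>q. \<Phi> q b\<close> for constant \<open>b\<close> only. Connection forms,
  metrics and curvature tensors are all treated in this way, without a normed space of tensors.\<close>

lemma linear_family_expand:
  assumes "linear (\<Phi> :: 'b::euclidean_space \<Rightarrow> 'c::real_normed_vector)"
  shows "\<Phi> y = (\<Sum>i\<in>Basis. (y \<bullet> i) *\<^sub>R \<Phi> i)"
proof -
  have "\<Phi> y = \<Phi> (\<Sum>i\<in>Basis. (y \<bullet> i) *\<^sub>R i)" by (simp add: euclidean_representation)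
  then show ?thesis using assms by (simp add: linear_sum linear_cmul)
qed

lemma has_derivative_linear_family:
  fixes \<Phi> :: "'a::euclidean_space \<Rightarrow> 'b::euclidean_space \<Rightarrow> 'c::real_normed_vector"
  assumes S: "open S" "x \<in> S" and lin: "\<And>q. q \<in> S \<Longrightarrow> linear (\<Phi> q)"
    and d: "\<And>b. (\<lambda>q. \<Phi> q b) differentiable (at x)" and y: "(y has_derivative y') (at x)"
  shows "((\<lambda>q. \<Phi> q (y q)) has_derivative (\<lambda>w. dd (\<lambda>q. \<Phi> q (y x)) x w + \<Phi> x (y' w))) (at x)"
proof -
  have sc: "((\<lambda>q. (u q \<bullet> i) *\<^sub>R \<Phi> q i) has_derivative
      (\<lambda>w. (u x \<bullet> i) *\<^sub>R dd (\<lambda>q. \<Phi> q i) x w + (u' w \<bullet> i) *\<^sub>R \<Phi> x i)) (at x)"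
    if "(u has_derivative u') (at x)" for u u' i
    by (rule has_derivative_scaleR[OF has_derivative_inner_left[OF that] d[unfolded frechet_derivative_works]])
  have ex: "((\<lambda>q. \<Phi> q (u q)) has_derivative
      (\<lambda>w. \<Sum>i\<in>Basis. (u x \<bullet> i) *\<^sub>R dd (\<lambda>q. \<Phi> q i) x w + (u' w \<bullet> i) *\<^sub>R \<Phi> x i)) (at x)"
    if "(u has_derivative u') (at x)" for u u'
    by (rule has_derivative_transform_within_open[OF has_derivative_sum[OF sc[OF that]] S])
      (rule linear_family_expand[OF lin, symmetric])
  have "dd (\<lambda>q. \<Phi> q (y x)) x w = (\<Sum>i\<in>Basis. (y x \<bullet> i) *\<^sub>R dd (\<lambda>q. \<Phi> q i) x w)" for w
    using dd_eqI[OF ex[OF has_derivative_const[of "y x"]]] by simp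
  moreover have "\<Phi> x (y' w) = (\<Sum>i\<in>Basis. (y' w \<bullet> i) *\<^sub>R \<Phi> x i)" for w
    by (rule linear_family_expand[OF lin[OF S(2)]])
  ultimately show ?thesis using ex[OF y] by (simp add: sum.distrib)
qed

lemma C_k_on_linear_family:
  fixes \<Phi> :: "'a::euclidean_space \<Rightarrow> 'b::euclidean_space \<Rightarrow> 'c::real_normed_vector"
  assumes S: "open S" and lin: "\<And>q. q \<in> S \<Longrightarrow> linear (\<Phi> q)"
    and d: "\<And>b. C_k_on k S (\<lambda>q. \<Phi> q b)" and y: "C_k_on k S y"
  shows "C_k_on k S (\<lambda>q. \<Phi> q (y q))"
proof (rule C_k_on_cong[OF S])
  show "C_k_on k S (\<lambda>q. \<Sum>i\<in>Basis. (y q \<bullet> i) *\<^sub>R \<Phi> q i)"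
    by (intro C_k_on_sum C_k_on_bilinear[OF bounded_bilinear_scaleR] S d
        C_k_on_bilinear[OF bounded_bilinear_inner] y C_k_on_const)
qed (rule linear_family_expand[OF lin, symmetric])

lemma smooth_on_linear_family:
  fixes \<Phi> :: "'a::euclidean_space \<Rightarrow> 'b::euclidean_space \<Rightarrow> 'c::real_normed_vector"
  assumes "open S" "\<And>q. q \<in> S \<Longrightarrow> linear (\<Phi> q)"
    "\<And>b. smooth_on S (\<lambda>q. \<Phi> q b)" "smooth_on S y"
  shows "smooth_on S (\<lambda>q. \<Phi> q (y q))"
  unfolding smooth_on_def
proof
  fix k show "C_k_on k S (\<lambda>q. \<Phi> q (y q))"
    by (rule C_k_on_linear_family) (use assms in \<open>simp_all add: smooth_on_def\<close>)
qed

lemma dd_linear_family: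
  fixes \<Phi> :: "'a::euclidean_space \<Rightarrow> 'b::euclidean_space \<Rightarrow> 'c::real_normed_vector"
  assumes "open S" "x \<in> S" "\<And>q. q \<in> S \<Longrightarrow> linear (\<Phi> q)"
    "\<And>b. smooth_on S (\<lambda>q. \<Phi> q b)" "y differentiable (at x)"
  shows "dd (\<lambda>q. \<Phi> q (y q)) x w = dd (\<lambda>q. \<Phi> q (y x)) x w + \<Phi> x (dd y x w)"
  using dd_eqI[OF has_derivative_linear_family[OF assms(1-3) smooth_on_differentiable[OF assms(4,2)]
        assms(5)[unfolded frechet_derivative_works]]] by (rule fun_cong)

lemma linear_family_dd:
  fixes \<Phi> :: "'a::euclidean_space \<Rightarrow> 'b::real_normed_vector \<Rightarrow> 'c::real_normed_vector"
  assumes "open S" "x \<in> S" "\<And>q. q \<in> S \<Longrightarrow> linear (\<Phi> q)" "\<And>b. smooth_on S (\<lambda>q. \<Phi> q b)"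
  shows "linear (\<lambda>b. dd (\<lambda>q. \<Phi> q b) x w)"
proof (rule linearI)
  note d = smooth_on_has_derivative[OF assms(4,2)]
  fix a b :: 'b and r :: real
  have "((\<lambda>q. \<Phi> q (a + b)) has_derivative (\<lambda>w. dd (\<lambda>q. \<Phi> q a) x w + dd (\<lambda>q. \<Phi> q b) x w)) (at x)"
    by (rule has_derivative_transform_within_open[OF has_derivative_add[OF d d] assms(1,2)])
      (rule linear_add[OF assms(3), symmetric])
  then show "dd (\<lambda>q. \<Phi> q (a + b)) x w = dd (\<lambda>q. \<Phi> q a) x w + dd (\<lambda>q. \<Phi> q b) x w"
    by (simp add: dd_eqI)
  have "((\<lambda>q. \<Phi> q (r *\<^sub>R a)) has_derivative (\<lambda>w. r *\<^sub>R dd (\<lambda>q. \<Phi> q a) x w)) (at x)"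
    by (rule has_derivative_transform_within_open[OF has_derivative_scaleR_right[OF d] assms(1,2)])
      (rule linear_cmul[OF assms(3), symmetric])
  then show "dd (\<lambda>q. \<Phi> q (r *\<^sub>R a)) x w = r *\<^sub>R dd (\<lambda>q. \<Phi> q a) x w"
    by (simp add: dd_eqI)
qed

text \<open>Injectivity of a linear endomorphism is stable under small perturbations, with a uniform lower
  bound; \<open>G\<close> is the size of the perturbation.\<close>

lemma linear_family_bounded_below:
  fixes \<Phi> :: "'a::euclidean_space \<Rightarrow> 'b::euclidean_space \<Rightarrow> 'b"
  assumes S: "open S" "x \<in> S" and lin: "\<And>q. q \<in> S \<Longrightarrow> linear (\<Phi> q)"
    and c: "\<And>b. continuous_on S (\<lambda>q. \<Phi> q b)" and inj: "\<And>y. \<Phi> x y = 0 \<Longrightarrow> y = 0"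
  shows "\<exists>G B T. 0 < B \<and> open T \<and> x \<in> T \<and> T \<subseteq> S \<and> (\<forall>q\<in>T. \<forall>y. B * norm y \<le> norm (\<Phi> q y)) \<and>
    (G \<longlongrightarrow> 0) (at x) \<and> (\<forall>q\<in>S. \<forall>y. norm (\<Phi> q y - \<Phi> x y) \<le> G q * norm y)"
proof -
  define G where "G = (\<lambda>q. \<Sum>i\<in>Basis. norm (\<Phi> q i - \<Phi> x i))"
  have cG: "continuous_on S G" unfolding G_def by (intro continuous_intros c)
  have "isCont G x" using cG S continuous_on_eq_continuous_at by blast
  moreover have "G x = 0" by (simp add: G_def)
  ultimately have G0: "(G \<longlongrightarrow> 0) (at x)" by (simp add: isCont_def)
  have G: "norm (\<Phi> q y - \<Phi> x y) \<le> G q * norm y" if "q \<in> S" for q y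
  proof -
    have "\<Phi> q y - \<Phi> x y = (\<Sum>i\<in>Basis. (y \<bullet> i) *\<^sub>R (\<Phi> q i - \<Phi> x i))"
      using linear_family_expand[OF lin[OF that], of y] linear_family_expand[OF lin[OF S(2)], of y]
      by (simp add: sum_subtractf scaleR_diff_right)
    also have "norm \<dots> \<le> (\<Sum>i\<in>Basis. norm ((y \<bullet> i) *\<^sub>R (\<Phi> q i - \<Phi> x i)))" by (rule norm_sum)
    also have "\<dots> \<le> (\<Sum>i\<in>Basis. norm y * norm (\<Phi> q i - \<Phi> x i))"
      by (rule sum_mono) (simp add: mult_right_mono Basis_le_norm)
    finally show ?thesis by (simp add: G_def sum_distrib_left mult.commute)
  qed
  have "inj (\<Phi> x)" using inj lin[OF S(2)] by (metis linear_injective_0)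
  then obtain B where B: "0 < B" "\<And>y. B * norm y \<le> norm (\<Phi> x y)"
    using linear_inj_bounded_below_pos[OF lin[OF S(2)]] by (metis mult.commute)
  define T where "T = {q \<in> S. G q < B / 2}"
  have oT: "open T" unfolding T_def
    using continuous_open_preimage[OF cG S(1), of "{..<B/2}"] by (auto simp: vimage_def Int_def)
  have xT: "x \<in> T" using S B by (simp add: T_def G_def)
  have TS: "T \<subseteq> S" by (auto simp: T_def)
  have lb: "B / 2 * norm y \<le> norm (\<Phi> q y)" if "q \<in> T" for q y
  proof -
    have "norm (\<Phi> x y) \<le> norm (\<Phi> q y) + norm (\<Phi> q y - \<Phi> x y)"
      using norm_triangle_ineq4[of "\<Phi> q y" "\<Phi> q y - \<Phi> x y"] by simp
    also have "norm (\<Phi> q y - \<Phi> x y) \<le> G q * norm y" using G that T_def by blast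
    also have "\<dots> \<le> B / 2 * norm y" using that by (intro mult_right_mono) (auto simp: T_def)
    finally show ?thesis using B(2)[of y] by (simp add: field_simps)
  qed
  have "0 < B / 2" using B(1) by simp
  with oT xT TS lb G0 G show ?thesis by (intro exI[of _ G] exI[of _ "B/2"] exI[of _ T]) simp
qed

text \<open>The derivative of a solution of \<open>\<Phi> q (y q) = w q\<close> is found by differentiating the equation.
  With \<open>L = inv (\<Phi> x)\<close> the remainder \<open>y q - y x - L (r' (q - x))\<close> is mapped by \<open>\<Phi> q\<close> to the remainder of \<open>r\<close>
  plus a term of size \<open>G q * norm (q - x)\<close>, and \<open>\<Phi> q\<close> is bounded below.\<close>

lemma has_derivative_linear_solve:
  fixes \<Phi> :: "'a::euclidean_space \<Rightarrow> 'b::euclidean_space \<Rightarrow> 'b"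
  assumes S: "open S" "x \<in> S" and lin: "\<And>q. q \<in> S \<Longrightarrow> linear (\<Phi> q)"
    and sm: "\<And>b. smooth_on S (\<lambda>q. \<Phi> q b)" and inj: "\<And>y. \<Phi> x y = 0 \<Longrightarrow> y = 0"
    and w: "w differentiable (at x)" and sol: "\<And>q. q \<in> S \<Longrightarrow> \<Phi> q (y q) = w q"
  shows "y differentiable (at x)"
proof -
  obtain G B T where GB: "0 < B" "open T" "x \<in> T" "T \<subseteq> S"
    "\<And>q y. q \<in> T \<Longrightarrow> B * norm y \<le> norm (\<Phi> q y)"
    "(G \<longlongrightarrow> 0) (at x)" "\<And>q y. q \<in> S \<Longrightarrow> norm (\<Phi> q y - \<Phi> x y) \<le> G q * norm y"
  proof -
    have "\<exists>G B T. 0 < B \<and> open T \<and> x \<in> T \<and> T \<subseteq> S \<and> (\<forall>q\<in>T. \<forall>y. B * norm y \<le> norm (\<Phi> q y)) \<and>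
        (G \<longlongrightarrow> 0) (at x) \<and> (\<forall>q\<in>S. \<forall>y. norm (\<Phi> q y - \<Phi> x y) \<le> G q * norm y)"
      by (rule linear_family_bounded_below[of S x \<Phi>, OF S lin smooth_on_imp_continuous[OF sm] inj])
    then show thesis by (elim exE conjE) (rule that, (assumption | blast)+)
  qed
  have linx: "linear (\<Phi> x)" by (rule lin[OF S(2)])
  have "inj (\<Phi> x)" using inj linx by (metis linear_injective_0)
  then obtain L where L: "linear L" "\<And>z. L (\<Phi> x z) = z" "\<And>z. \<Phi> x (L z) = z"
    using linear_injective_isomorphism[OF linx] by blast
  define r where "r = (\<lambda>q. w q - \<Phi> q (y x))"
  have "r differentiable (at x)" unfolding r_def
    by (intro differentiable_diff w smooth_on_differentiable[OF sm S(2)])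
  then obtain r' where r': "(r has_derivative r') (at x)" by (auto simp: differentiable_def)
  have rx: "r x = 0" using sol[OF S(2)] by (simp add: r_def)
  have blr: "bounded_linear r'" using r' has_derivative_bounded_linear by blast
  have blL: "bounded_linear (\<lambda>h. L (r' h))"
    using bounded_linear_compose[OF _ blr, of L] L(1) linear_conv_bounded_linear by blast
  obtain K where K: "\<And>h. norm (L (r' h)) \<le> norm h * K"
    using bounded_linear.bounded[OF blL] by blast
  have "(y has_derivative (\<lambda>h. L (r' h))) (at x)"
    unfolding has_derivative_iff_norm
  proof (intro conjI blL)
    let ?e = "\<lambda>q. norm (r q - r x - r' (q - x)) / norm (q - x)"
    have "(?e \<longlongrightarrow> 0) (at x)" using r' by (simp add: has_derivative_iff_norm)
    then have lim: "((\<lambda>q. (?e q + \<bar>G q\<bar> * \<bar>K\<bar>) / B) \<longlongrightarrow> (0 + \<bar>0\<bar> * \<bar>K\<bar>) / B) (at x)"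
      by (intro tendsto_intros GB(6)) (use GB(1) in auto)
    have ev: "eventually (\<lambda>q. q \<in> T \<and> q \<noteq> x) (at x)"
      using GB(2,3) eventually_at_topological by blast
    have bound: "norm (y q - y x - L (r' (q - x))) / norm (q - x) \<le> (?e q + \<bar>G q\<bar> * \<bar>K\<bar>) / B"
      if q: "q \<in> T \<and> q \<noteq> x" for q
    proof -
      define z where "z = L (r' (q - x))"
      have qS: "q \<in> S" using q GB(4) by blast
      have z: "\<Phi> x z = r' (q - x)" by (simp add: z_def L)
      have "\<Phi> q (y q - y x - z) = w q - \<Phi> q (y x) - \<Phi> q z"
        using lin[OF qS] sol[OF qS] by (simp add: linear_diff)
      also have "\<dots> = (r q - r x - r' (q - x)) - (\<Phi> q z - \<Phi> x z)"
        by (simp add: rx z) (simp add: r_def)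
      finally have "norm (\<Phi> q (y q - y x - z)) \<le> norm (r q - r x - r' (q - x)) + norm (\<Phi> q z - \<Phi> x z)"
        using norm_triangle_ineq4 by metis
      moreover have "norm (\<Phi> q z - \<Phi> x z) \<le> \<bar>G q\<bar> * \<bar>K\<bar> * norm (q - x)"
      proof -
        have "norm (\<Phi> q z - \<Phi> x z) \<le> \<bar>G q\<bar> * norm z"
          using GB(7)[OF qS, of z] mult_right_mono[OF abs_ge_self[of "G q"], of "norm z"] by simp
        also have "norm z \<le> \<bar>K\<bar> * norm (q - x)"
          using K[of "q - x"] mult_right_mono[OF abs_ge_self[of K], of "norm (q - x)"]
          by (simp add: z_def mult.commute)
        finally show ?thesis by (simp add: mult_left_mono mult.assoc)
      qed
      moreover have "B * norm (y q - y x - z) \<le> norm (\<Phi> q (y q - y x - z))" using GB(5) q by blast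
      ultimately have "B * norm (y q - y x - z)
          \<le> norm (r q - r x - r' (q - x)) + \<bar>G q\<bar> * \<bar>K\<bar> * norm (q - x)" by linarith
      moreover have "norm (q - x) > 0" using q by simp
      ultimately show ?thesis using GB(1) unfolding z_def[symmetric]
        by (simp add: field_simps)
    qed
    show "((\<lambda>q. norm (y q - y x - L (r' (q - x))) / norm (q - x)) \<longlongrightarrow> 0) (at x)"
    proof (rule tendsto_sandwich[OF _ _ tendsto_const])
      show "((\<lambda>q. (?e q + \<bar>G q\<bar> * \<bar>K\<bar>) / B) \<longlongrightarrow> 0) (at x)" using lim by simp
      show "eventually (\<lambda>q. 0 \<le> norm (y q - y x - L (r' (q - x))) / norm (q - x)) (at x)" by simp
      show "eventually (\<lambda>q. norm (y q - y x - L (r' (q - x))) / norm (q - x) \<le> (?e q + \<bar>G q\<bar> * \<bar>K\<bar>) / B) (at x)"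
        using ev by (rule eventually_mono) (rule bound)
    qed
  qed
  then show ?thesis by (auto simp: differentiable_def)
qed

text \<open>Differentiating the equation shows that a partial derivative of \<open>y\<close> solves an equation with the
  same \<open>\<Phi>\<close> whose right-hand side is as regular as \<open>y\<close>. Hence the induction over \<open>k\<close> for arbitrary
  right-hand sides.\<close>

lemma C_k_on_linear_solve:
  fixes \<Phi> :: "'a::euclidean_space \<Rightarrow> 'b::euclidean_space \<Rightarrow> 'b"
  assumes S: "open S" and lin: "\<And>q. q \<in> S \<Longrightarrow> linear (\<Phi> q)"
    and sm: "\<And>b. smooth_on S (\<lambda>q. \<Phi> q b)" and inj: "\<And>q y. q \<in> S \<Longrightarrow> \<Phi> q y = 0 \<Longrightarrow> y = 0"
    and w: "C_k_on k S w" and sol: "\<And>q. q \<in> S \<Longrightarrow> \<Phi> q (y q) = w q"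
  shows "C_k_on k S y"
  using w sol
proof (induction k arbitrary: w y)
  case 0
  have "isCont y x" if x: "x \<in> S" for x
  proof -
    obtain G B T where GB: "0 < B" "open T" "x \<in> T" "T \<subseteq> S"
      "\<And>q y. q \<in> T \<Longrightarrow> B * norm y \<le> norm (\<Phi> q y)"
      "(G \<longlongrightarrow> 0) (at x)" "\<And>q y. q \<in> S \<Longrightarrow> norm (\<Phi> q y - \<Phi> x y) \<le> G q * norm y"
    proof -
    have "\<exists>G B T. 0 < B \<and> open T \<and> x \<in> T \<and> T \<subseteq> S \<and> (\<forall>q\<in>T. \<forall>y. B * norm y \<le> norm (\<Phi> q y)) \<and>
        (G \<longlongrightarrow> 0) (at x) \<and> (\<forall>q\<in>S. \<forall>y. norm (\<Phi> q y - \<Phi> x y) \<le> G q * norm y)"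
      by (rule linear_family_bounded_below[of S x \<Phi>, OF S x lin smooth_on_imp_continuous[OF sm] inj[OF x]])
    then show thesis by (elim exE conjE) (rule that, (assumption | blast)+)
  qed
    have "continuous_on S (\<lambda>q. norm (w q - \<Phi> q (y x)) / B)"
      by (intro continuous_intros smooth_on_imp_continuous[OF sm]) (use 0 GB(1) in auto)
    then have "isCont (\<lambda>q. norm (w q - \<Phi> q (y x)) / B) x"
      using S x continuous_on_eq_continuous_at by blast
    then have lim: "((\<lambda>q. norm (w q - \<Phi> q (y x)) / B) \<longlongrightarrow> 0) (at x)"
      using 0(2)[OF x] by (simp add: isCont_def)
    have "((\<lambda>q. y q - y x) \<longlongrightarrow> 0) (at x)"
    proof (rule Lim_null_comparison[OF _ lim])
      have "eventually (\<lambda>q. q \<in> T) (at x)" using GB(2,3) eventually_at_topological by blast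
      then show "eventually (\<lambda>q. norm (y q - y x) \<le> norm (w q - \<Phi> q (y x)) / B) (at x)"
      proof (rule eventually_mono)
        fix q assume q: "q \<in> T"
        then have "\<Phi> q (y q - y x) = w q - \<Phi> q (y x)"
          using lin GB(4) 0(2) by (metis linear_diff subsetD)
        then have "B * norm (y q - y x) \<le> norm (w q - \<Phi> q (y x))"
          using GB(5)[OF q, of "y q - y x"] by metis
        then show "norm (y q - y x) \<le> norm (w q - \<Phi> q (y x)) / B"
          using GB(1) by (simp add: pos_le_divide_eq mult.commute)
      qed
    qed
    then show ?thesis by (simp add: isCont_def LIM_zero_iff)
  qed
  then show ?case by (simp add: continuous_at_imp_continuous_on)
next
  case (Suc k)
  have yk: "C_k_on k S y" by (rule Suc.IH[OF C_k_on_SucD[OF Suc.prems(1)] Suc.prems(2)])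
  have wd: "w differentiable (at x)" if "x \<in> S" for x using Suc.prems(1) that by simp
  have yd: "y differentiable (at x)" if x: "x \<in> S" for x
    by (rule has_derivative_linear_solve[OF S x lin sm inj[OF x] wd[OF x] Suc.prems(2)])
  have "C_k_on k S (\<lambda>x. dd y x b)" if b: "b \<in> Basis" for b
  proof (rule Suc.IH)
    have lin': "linear (\<lambda>z. dd (\<lambda>q. \<Phi> q z) x b)" if "x \<in> S" for x
      by (rule linear_family_dd[OF S that lin sm])
    have sm': "C_k_on k S (\<lambda>x. dd (\<lambda>q. \<Phi> q z) x b)" for z
      using smooth_on_dd_const[OF S sm] by (simp add: smooth_on_def)
    have "C_k_on k S (\<lambda>x. dd (\<lambda>q. \<Phi> q (y x)) x b)"
      by (rule C_k_on_linear_family[of S "\<lambda>x z. dd (\<lambda>q. \<Phi> q z) x b", OF S lin' sm' yk])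
    from C_k_on_add[OF S _ C_k_on_bounded_linear[OF bounded_linear_minus[OF bounded_linear_ident] S this]]
    show "C_k_on k S (\<lambda>x. dd w x b + - dd (\<lambda>q. \<Phi> q (y x)) x b)"
      using Suc.prems(1) b by simp
    show "\<Phi> x (dd y x b) = dd w x b + - dd (\<lambda>q. \<Phi> q (y x)) x b" if x: "x \<in> S" for x
    proof -
      have "dd w x b = dd (\<lambda>q. \<Phi> q (y q)) x b"
        using frechet_derivative_cong_open[OF S x, of "\<lambda>q. \<Phi> q (y q)" w] Suc.prems(2) by simp
      also have "\<dots> = dd (\<lambda>q. \<Phi> q (y x)) x b + \<Phi> x (dd y x b)"
        by (rule dd_linear_family[OF S x lin sm yd[OF x]])
      finally show ?thesis by simp
    qed
  qed
  then show ?case using yd by simp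
qed

lemma smooth_on_linear_solve:
  fixes \<Phi> :: "'a::euclidean_space \<Rightarrow> 'b::euclidean_space \<Rightarrow> 'b"
  assumes "open S" "\<And>q. q \<in> S \<Longrightarrow> linear (\<Phi> q)" "\<And>b. smooth_on S (\<lambda>q. \<Phi> q b)"
    "\<And>q y. q \<in> S \<Longrightarrow> \<Phi> q y = 0 \<Longrightarrow> y = 0" "smooth_on S w" "\<And>q. q \<in> S \<Longrightarrow> \<Phi> q (y q) = w q"
  shows "smooth_on S y"
  unfolding smooth_on_def
proof
  fix k
  have "C_k_on k S w" using assms(5) by (simp add: smooth_on_def)
  from C_k_on_linear_solve[OF assms(1-4) this assms(6)] show "C_k_on k S y" .
qed

subsection \<open>Bump functions\<close>

text \<open>The functions \<open>p(1/t) exp(-1/t)\<close>, continued by zero, are closed under differentiation, which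
  makes all of them smooth.\<close>

definition flat_exp :: "real poly \<Rightarrow> real \<Rightarrow> real"
  where "flat_exp p t = (if t > 0 then poly p (inverse t) * exp (- inverse t) else 0)"

lemma poly_exp_tendsto_0: "((\<lambda>s::real. poly p s * exp (- s)) \<longlongrightarrow> 0) at_top"
proof -
  have "((\<lambda>s::real. \<Sum>i\<le>degree p. coeff p i * (s ^ i / exp s)) \<longlongrightarrow> (\<Sum>i\<le>degree p. coeff p i * 0)) at_top"
    by (intro tendsto_sum tendsto_mult_left tendsto_power_div_exp_0)
  then show ?thesis
    by (simp add: poly_altdef sum_distrib_right exp_minus divide_inverse mult.assoc)
qed

lemma has_field_derivative_flat_exp:
  "(flat_exp p has_field_derivative flat_exp ([:0, 0, 1:] * (p - pderiv p)) t) (at t)"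
proof -
  consider "t > 0" | "t < 0" | "t = 0" by linarith
  then show ?thesis
  proof cases
    case 1
    have "((\<lambda>t. poly p (inverse t) * exp (- inverse t)) has_field_derivative
        flat_exp ([:0, 0, 1:] * (p - pderiv p)) t) (at t)"
      using 1 by (auto intro!: derivative_eq_intros DERIV_chain'[OF _ poly_DERIV]
          simp: flat_exp_def field_simps power2_eq_square)
    then show ?thesis
      by (rule has_field_derivative_transform_within_open[where S = "{0<..}"])
        (use 1 in \<open>auto simp: flat_exp_def\<close>)
  next
    case 2
    have "((\<lambda>t. 0) has_field_derivative flat_exp ([:0, 0, 1:] * (p - pderiv p)) t) (at t)"
      using 2 by (simp add: flat_exp_def)
    then show ?thesis
      by (rule has_field_derivative_transform_within_open[where S = "{..<0}"])
        (use 2 in \<open>auto simp: flat_exp_def\<close>)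
  next
    case 3
    have "((\<lambda>h. flat_exp p h / h) \<longlongrightarrow> 0) (at_right 0)"
    proof -
      have "((\<lambda>h. poly ([:0, 1:] * p) (inverse h) * exp (- inverse h)) \<longlongrightarrow> 0) (at_right 0)"
        by (rule filterlim_compose[OF poly_exp_tendsto_0 filterlim_inverse_at_top_right])
      then show ?thesis
        by (rule Lim_transform_eventually)
          (auto simp: eventually_at_filter flat_exp_def divide_inverse)
    qed
    moreover have "((\<lambda>h. flat_exp p h / h) \<longlongrightarrow> 0) (at_left 0)"
      by (rule Lim_transform_eventually[OF tendsto_const])
        (auto simp: eventually_at_filter flat_exp_def)
    ultimately have "((\<lambda>h. flat_exp p h / h) \<longlongrightarrow> 0) (at 0)"
      by (simp add: filterlim_at_split)
    then show ?thesis using 3 by (simp add: DERIV_def flat_exp_def)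
  qed
qed

lemma smooth_flat_exp: "smooth_on UNIV (flat_exp p)"
proof -
  have "C_k_on k UNIV (flat_exp p)" for k
  proof (induction k arbitrary: p)
    case 0
    show ?case
      using DERIV_isCont[OF has_field_derivative_flat_exp]
      by (auto intro!: continuous_at_imp_continuous_on)
  next
    case (Suc k)
    have d: "(flat_exp p has_derivative (\<lambda>h. flat_exp ([:0, 0, 1:] * (p - pderiv p)) t * h)) (at t)" for t
      using has_field_derivative_flat_exp by (simp add: has_field_derivative_def)
    show ?case using Suc.IH[of "[:0, 0, 1:] * (p - pderiv p)"]
      by (simp add: differentiableI[OF d] dd_eqI[OF d] del: mult_pCons_left)
  qed
  then show ?thesis by (simp add: smooth_on_def)
qed

text \<open>The quotient \<open>f(t) / (f(t) + f(1 - t))\<close> of flat functions is smooth as the solution of a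
  one-dimensional linear equation.\<close>

lemma smooth_step:
  obtains \<psi> :: "real \<Rightarrow> real"
  where "smooth_on UNIV \<psi>" "\<And>t. t \<le> 0 \<Longrightarrow> \<psi> t = 0" "\<And>t. 1 \<le> t \<Longrightarrow> \<psi> t = 1"
proof -
  define f where "f = flat_exp 1"
  have f: "smooth_on UNIV f" "\<And>t. t \<le> 0 \<Longrightarrow> f t = 0" "\<And>t. t > 0 \<Longrightarrow> f t > 0"
    by (auto simp: f_def smooth_flat_exp flat_exp_def)
  have aff: "smooth_on UNIV (\<lambda>t::real. 1 - t)" by (intro smooth_on_diff) auto
  have f1: "smooth_on UNIV (\<lambda>t. f (1 - t))"
    by (rule smooth_on_compose[OF _ _ _ aff f(1)]) auto
  define g where "g = (\<lambda>t. f t + f (1 - t))"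
  have g: "smooth_on UNIV g" unfolding g_def by (intro smooth_on_add f f1) auto
  have gpos: "g t > 0" for t
  proof (cases "t > 0")
    case True then show ?thesis using f(2)[of "1 - t"] f(3)[of t] f(3)[of "1 - t"]
      by (cases "1 - t \<le> 0") (auto simp: g_def)
  next
    case False then show ?thesis using f(2)[of t] f(3)[of "1 - t"] by (auto simp: g_def)
  qed
  have "smooth_on UNIV (\<lambda>t. f t / g t)"
  proof (rule smooth_on_linear_solve[where \<Phi> = "\<lambda>t y. g t * y" and w = f])
    show "linear ((*) (g q))" for q by (simp add: linear_times)
    show "smooth_on UNIV (\<lambda>q. g q * b)" for b by (intro smooth_on_mult g) auto
    show "y = 0" if "g q * y = 0" for q y using gpos[of q] that by simp
    show "g q * (f q / g q) = f q" for q using gpos[of q] by simp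
  qed (use f in auto)
  moreover have "f t / g t = 0" if "t \<le> 0" for t using f(2)[OF that] by simp
  moreover have "f t / g t = 1" if "1 \<le> t" for t
    using f(2)[of "1 - t"] f(3)[of t] that by (simp add: g_def)
  ultimately show ?thesis using that by blast
qed

lemma bump_function:
  fixes a :: "'a::euclidean_space"
  assumes "0 < r"
  obtains h :: "'a \<Rightarrow> real"
  where "smooth_on UNIV h" "\<And>x. x \<in> ball a r \<Longrightarrow> h x = 1" "\<And>x. x \<notin> cball a (2 * r) \<Longrightarrow> h x = 0"
proof -
  obtain \<psi> :: "real \<Rightarrow> real" where \<psi>: "smooth_on UNIV \<psi>" "\<And>t. t \<le> 0 \<Longrightarrow> \<psi> t = 0" "\<And>t. 1 \<le> t \<Longrightarrow> \<psi> t = 1"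
    using smooth_step by blast
  \<comment> \<open>at least \<open>1\<close> on \<open>ball a r\<close> and at most \<open>0\<close> outside \<open>cball a (2 * r)\<close>\<close>
  define n where "n = (\<lambda>x. (4 - ((x - a) \<bullet> (x - a)) * (1 / r\<^sup>2)) * (1/3))"
  have "smooth_on UNIV n" unfolding n_def
    by (intro smooth_on_mult smooth_on_diff smooth_on_inner) auto
  then have "smooth_on UNIV (\<lambda>x. \<psi> (n x))"
    using smooth_on_compose[OF open_UNIV open_UNIV subset_UNIV _ \<psi>(1)] by blast
  moreover have "\<psi> (n x) = 1" if "x \<in> ball a r" for x
  proof -
    have "(norm (x - a))\<^sup>2 \<le> r\<^sup>2" using that by (intro power_mono) (auto simp: dist_norm norm_minus_commute)
    then have "(norm (x - a))\<^sup>2 * (1 / r\<^sup>2) \<le> 1" using assms by (simp add: field_simps)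
    then show ?thesis by (intro \<psi>(3)) (simp add: n_def power2_norm_eq_inner)
  qed
  moreover have "\<psi> (n x) = 0" if "x \<notin> cball a (2 * r)" for x
  proof -
    have "(2 * r)\<^sup>2 \<le> (norm (x - a))\<^sup>2" using that assms by (intro power_mono) (auto simp: dist_norm norm_minus_commute)
    then have "4 \<le> (norm (x - a))\<^sup>2 * (1 / r\<^sup>2)" using assms by (simp add: field_simps)
    then show ?thesis by (intro \<psi>(2)) (simp add: n_def power2_norm_eq_inner)
  qed
  ultimately show ?thesis using that by blast
qed

subsection \<open>Bilinear families and derivatives along fibres\<close>

lemma smooth_on_bilinear_family:
  fixes \<Phi> :: "'a::euclidean_space \<Rightarrow> 'b::euclidean_space \<Rightarrow> 'c::euclidean_space \<Rightarrow> 'd::real_normed_vector"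
  assumes S: "open S" and l1: "\<And>q c. q \<in> S \<Longrightarrow> linear (\<lambda>b. \<Phi> q b c)" and l2: "\<And>q b. q \<in> S \<Longrightarrow> linear (\<lambda>c. \<Phi> q b c)"
    and sm: "\<And>b c. smooth_on S (\<lambda>q. \<Phi> q b c)" and y: "smooth_on S y" and z: "smooth_on S z"
  shows "smooth_on S (\<lambda>q. \<Phi> q (y q) (z q))"
proof -
  have "smooth_on S (\<lambda>q. \<Phi> q b (z q))" for b
    by (rule smooth_on_linear_family[of S "\<lambda>q. \<Phi> q b", OF S l2 sm z])
  from smooth_on_linear_family[of S "\<lambda>q b. \<Phi> q b (z q)", OF S l1 this y] show ?thesis .
qed

lemma dd_bilinear_family:
  fixes \<Phi> :: "'a::euclidean_space \<Rightarrow> 'b::euclidean_space \<Rightarrow> 'c::euclidean_space \<Rightarrow> 'd::real_normed_vector"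
  assumes S: "open S" "x \<in> S" and l1: "\<And>q c. q \<in> S \<Longrightarrow> linear (\<lambda>b. \<Phi> q b c)" and l2: "\<And>q b. q \<in> S \<Longrightarrow> linear (\<lambda>c. \<Phi> q b c)"
    and sm: "\<And>b c. smooth_on S (\<lambda>q. \<Phi> q b c)" and y: "y differentiable (at x)" and z: "z differentiable (at x)"
  shows "dd (\<lambda>q. \<Phi> q (y q) (z q)) x w =
    dd (\<lambda>q. \<Phi> q (y x) (z x)) x w + \<Phi> x (dd y x w) (z x) + \<Phi> x (y x) (dd z x w)"
proof -
  note z' = z[unfolded frechet_derivative_works] and y' = y[unfolded frechet_derivative_works]
  have dz: "((\<lambda>q. \<Phi> q b (z q)) has_derivative (\<lambda>w. dd (\<lambda>q. \<Phi> q b (z x)) x w + \<Phi> x b (dd z x w))) (at x)" for b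
    by (rule has_derivative_linear_family[of S x "\<lambda>q. \<Phi> q b", OF S l2 smooth_on_differentiable[OF sm S(2)] z'])
  have "((\<lambda>q. \<Phi> q (y q) (z q)) has_derivative (\<lambda>w. dd (\<lambda>q. \<Phi> q (y x) (z q)) x w + \<Phi> x (dd y x w) (z x))) (at x)"
    by (rule has_derivative_linear_family[of S x "\<lambda>q b. \<Phi> q b (z q)", OF S l1 differentiableI[OF dz] y'])
  from dd_eqI[OF this] show ?thesis by (simp add: dd_eqI[OF dz] fun_eq_iff)
qed

lemma dd_partial_snd:
  fixes f :: "'a::euclidean_space \<times> 'b::euclidean_space \<Rightarrow> 'c::real_normed_vector"
  assumes "f differentiable (at (x, v))"
  shows "dd (\<lambda>v. f (x, v)) v u = dd f (x, v) (0, u)" "(\<lambda>v. f (x, v)) differentiable (at v)"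
proof -
  have "((\<lambda>v. (x, v)) has_derivative (\<lambda>u. (0, u))) (at v)"
    by (auto intro!: derivative_eq_intros)
  from has_derivative_compose[OF this assms[unfolded frechet_derivative_works]]
  have "((\<lambda>v. f (x, v)) has_derivative (\<lambda>u. dd f (x, v) (0, u))) (at v)" .
  then show "dd (\<lambda>v. f (x, v)) v u = dd f (x, v) (0, u)" "(\<lambda>v. f (x, v)) differentiable (at v)"
    by (simp_all add: dd_eqI differentiableI)
qed

text \<open>Vertical derivatives see a single fibre only. This is what allows identities known over one
  base point to be differentiated.\<close>

lemma dd_vertical_cong:
  fixes f :: "'a::euclidean_space \<times> 'b::euclidean_space \<Rightarrow> 'c::real_normed_vector"
  assumes Q: "open Q" "(x, v) \<in> Q" and d: "f differentiable (at (x, v))" "f' differentiable (at (x, v))"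
    and eq: "\<And>w. (x, w) \<in> Q \<Longrightarrow> f (x, w) = f' (x, w)"
  shows "dd f (x, v) (0, u) = dd f' (x, v) (0, u)"
proof -
  have "open {w. (x, w) \<in> Q}"
    using open_vimage[OF Q(1), of "\<lambda>w. (x, w)"] by (simp add: vimage_def continuous_on_Pair)
  from frechet_derivative_cong_open[OF this, of v "\<lambda>w. f (x, w)" "\<lambda>w. f' (x, w)"]
  have "dd (\<lambda>w. f (x, w)) v = dd (\<lambda>w. f' (x, w)) v" using Q(2) eq by blast
  then show ?thesis by (simp add: dd_partial_snd(1)[OF d(1), symmetric] dd_partial_snd(1)[OF d(2), symmetric])
qed

lemma dd_snd: "dd snd p \<xi> = snd \<xi>" and dd_fst: "dd fst p \<xi> = fst \<xi>"
  by (simp_all add: dd_eqI[OF bounded_linear.has_derivative[OF bounded_linear_snd has_derivative_ident]]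
    dd_eqI[OF bounded_linear.has_derivative[OF bounded_linear_fst has_derivative_ident]])

lemma smooth_snd: "smooth_on S snd" and smooth_fst: "smooth_on S fst" if "open S"
  using smooth_on_linear[OF bounded_linear_snd that] smooth_on_linear[OF bounded_linear_fst that] by auto

section \<open>The Cartan connection in a chart\<close>

text \<open>In a chart \<open>(x,v)\<close> of the slit tangent bundle a section \<open>Y\<close> of the pulled-back bundle is a
  function into the model space and the connection is \<open>dY(\<xi>) + om(\<xi>)Y\<close> with a connection form
  \<open>om\<close>. The axioms \<open>g_vert_sym\<close> and \<open>g_vert_v\<close> hold because \<open>g\<close> is half the fibre Hessian of a function
  that is homogeneous of degree two; \<open>metric\<close> is metricity, and \<open>tors_v\<close> the
  symmetry of the torsion on vertical vectors.\<close>

locale local_metric_connection =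
  fixes Q :: "('e::euclidean_space \<times> 'e) set"
    and om :: "'e \<times> 'e \<Rightarrow> 'e \<times> 'e \<Rightarrow> 'e \<Rightarrow> 'e"
    and g :: "'e \<times> 'e \<Rightarrow> 'e \<Rightarrow> 'e \<Rightarrow> real"
  assumes open_Q: "open Q"
    and om_lin1: "q \<in> Q \<Longrightarrow> linear (\<lambda>\<xi>. om q \<xi> w)"
    and om_lin2: "q \<in> Q \<Longrightarrow> linear (\<lambda>w. om q \<xi> w)"
    and om_smooth: "smooth_on Q (\<lambda>q. om q \<xi> w)"
    and g_lin2: "q \<in> Q \<Longrightarrow> linear (\<lambda>b. g q a b)"
    and g_sym: "q \<in> Q \<Longrightarrow> g q a b = g q b a"
    and g_pos: "q \<in> Q \<Longrightarrow> a \<noteq> 0 \<Longrightarrow> 0 < g q a a"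
    and g_smooth: "smooth_on Q (\<lambda>q. g q a b)"
    and g_vert_sym: "q \<in> Q \<Longrightarrow> dd (\<lambda>q. g q a b) q (0, c) = dd (\<lambda>q. g q a c) q (0, b)"
    and g_vert_v: "q \<in> Q \<Longrightarrow> dd (\<lambda>q. g q a b) q (0, snd q) = 0"
    and metric: "q \<in> Q \<Longrightarrow> dd (\<lambda>q. g q a b) q \<xi> = g q (om q \<xi> a) b + g q a (om q \<xi> b)"
    and tors_v: "q \<in> Q \<Longrightarrow> g q (om q (0, c) a) b = g q (om q (0, c) b) a"
begin

lemma g_lin1: assumes "q \<in> Q" shows "linear (\<lambda>a. g q a b)"
proof -
  have "(\<lambda>a. g q a b) = g q b" by (rule ext) (rule g_sym[OF assms])
  then show ?thesis using g_lin2[OF assms] by simp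
qed

lemma om_simps:
  assumes "q \<in> Q"
  shows "om q (\<xi> + \<zeta>) w = om q \<xi> w + om q \<zeta> w" "om q (\<xi> - \<zeta>) w = om q \<xi> w - om q \<zeta> w"
    "om q (- \<xi>) w = - om q \<xi> w" "om q (r *\<^sub>R \<xi>) w = r *\<^sub>R om q \<xi> w" "om q 0 w = 0"
    "om q \<xi> (a + b) = om q \<xi> a + om q \<xi> b" "om q \<xi> (a - b) = om q \<xi> a - om q \<xi> b"
    "om q \<xi> (- a) = - om q \<xi> a" "om q \<xi> (r *\<^sub>R a) = r *\<^sub>R om q \<xi> a" "om q \<xi> 0 = 0"
  by (rule linear_add[OF om_lin1[OF assms]] linear_diff[OF om_lin1[OF assms]] linear_neg[OF om_lin1[OF assms]]
      linear_cmul[OF om_lin1[OF assms]] linear_0[OF om_lin1[OF assms]]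
      linear_add[OF om_lin2[OF assms]] linear_diff[OF om_lin2[OF assms]] linear_neg[OF om_lin2[OF assms]]
      linear_cmul[OF om_lin2[OF assms]] linear_0[OF om_lin2[OF assms]])+

lemma g_simps:
  assumes "q \<in> Q"
  shows "g q (a + b) c = g q a c + g q b c" "g q (a - b) c = g q a c - g q b c"
    "g q (- a) c = - g q a c" "g q (r *\<^sub>R a) c = r * g q a c" "g q 0 c = 0"
    "g q c (a + b) = g q c a + g q c b" "g q c (a - b) = g q c a - g q c b"
    "g q c (- a) = - g q c a" "g q c (r *\<^sub>R a) = r * g q c a" "g q c 0 = 0"
  by (rule linear_add[OF g_lin1[OF assms]] linear_diff[OF g_lin1[OF assms]] linear_neg[OF g_lin1[OF assms]]
      linear_cmul[OF g_lin1[OF assms], unfolded real_scaleR_def] linear_0[OF g_lin1[OF assms]]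
      linear_add[OF g_lin2[OF assms]] linear_diff[OF g_lin2[OF assms]] linear_neg[OF g_lin2[OF assms]]
      linear_cmul[OF g_lin2[OF assms], unfolded real_scaleR_def] linear_0[OF g_lin2[OF assms]])+

lemma g_eqI:
  assumes "q \<in> Q" "\<And>z. g q a z = g q b z" shows "a = b"
proof (rule ccontr)
  assume "a \<noteq> b"
  then have "0 < g q (a - b) (a - b)" using g_pos[OF assms(1)] by simp
  then show False using assms(2)[of "a - b"] by (simp add: g_simps[OF assms(1)])
qed

lemma smooth_om: "smooth_on Q y \<Longrightarrow> smooth_on Q z \<Longrightarrow> smooth_on Q (\<lambda>q. om q (y q) (z q))"
  by (rule smooth_on_bilinear_family[OF open_Q om_lin1 om_lin2 om_smooth])

lemma smooth_g: "smooth_on Q y \<Longrightarrow> smooth_on Q z \<Longrightarrow> smooth_on Q (\<lambda>q. g q (y q) (z q))"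
  by (rule smooth_on_bilinear_family[OF open_Q g_lin1 g_lin2 g_smooth])

lemma dd_om:
  assumes "p \<in> Q" "y differentiable (at p)" "z differentiable (at p)"
  shows "dd (\<lambda>q. om q (y q) (z q)) p w =
    dd (\<lambda>q. om q (y p) (z p)) p w + om p (dd y p w) (z p) + om p (y p) (dd z p w)"
  by (rule dd_bilinear_family[OF open_Q assms(1) om_lin1 om_lin2 om_smooth assms(2,3)])

lemma dd_g:
  assumes "p \<in> Q" "y differentiable (at p)" "z differentiable (at p)"
  shows "dd (\<lambda>q. g q (y q) (z q)) p w =
    dd (\<lambda>q. g q (y p) (z p)) p w + g p (dd y p w) (z p) + g p (y p) (dd z p w)"
  by (rule dd_bilinear_family[OF open_Q assms(1) g_lin1 g_lin2 g_smooth assms(2,3)])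

definition d_om :: "'e \<times> 'e \<Rightarrow> 'e \<times> 'e \<Rightarrow> 'e \<times> 'e \<Rightarrow> 'e \<Rightarrow> 'e"
  where "d_om p \<xi> \<zeta> w = dd (\<lambda>q. om q \<zeta> w) p \<xi>"

lemma smooth_d_om: "smooth_on Q (\<lambda>q. d_om q \<xi> \<zeta> w)"
  unfolding d_om_def by (rule smooth_on_dd_const[OF open_Q om_smooth])

lemma d_om_linear:
  assumes "p \<in> Q"
  shows "linear (\<lambda>\<xi>. d_om p \<xi> \<zeta> w)" "linear (\<lambda>\<zeta>. d_om p \<xi> \<zeta> w)" "linear (\<lambda>w. d_om p \<xi> \<zeta> w)"
  unfolding d_om_def
  by (rule smooth_on_linear_dd[OF om_smooth assms]
      linear_family_dd[of Q p "\<lambda>q \<zeta>. om q \<zeta> w" \<xi>, OF open_Q assms om_lin1 om_smooth]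
      linear_family_dd[of Q p "\<lambda>q w. om q \<zeta> w" \<xi>, OF open_Q assms om_lin2 om_smooth]; assumption?)+

text \<open>On vertical vectors the connection form is the Cartan tensor \<open>C = 1/2 \<partial>g/\<partial>v\<close>: metricity
  determines its symmetric part and \<open>tors_v\<close> says that there is no other. The Cartan tensor is totally
  symmetric and vanishes in the direction of \<open>v\<close>.\<close>

lemma om_vert_g: "p \<in> Q \<Longrightarrow> 2 * g p (om p (0, c) a) b = dd (\<lambda>q. g q a b) p (0, c)"
  using metric[of p a b "(0, c)"] tors_v[of p c a b] g_sym[of p a] by simp

lemma cartan_tensor_sym:
  assumes "p \<in> Q"
  shows "g p (om p (0, c) a) b = g p (om p (0, c) b) a" "g p (om p (0, c) a) b = g p (om p (0, a) c) b"
proof -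
  show 1: "g p (om p (0, c) a) b = g p (om p (0, c) b) a" for a b c using tors_v[OF assms] .
  have 2: "g p (om p (0, c) a) b = g p (om p (0, b) a) c" for a b c
    using om_vert_g[OF assms, of c a b] om_vert_g[OF assms, of b a c] g_vert_sym[OF assms] by simp
  show "g p (om p (0, c) a) b = g p (om p (0, a) c) b" using 1 2 by metis
qed

lemma om_vert_sym: "p \<in> Q \<Longrightarrow> om p (0, c) a = om p (0, a) c"
  using g_eqI cartan_tensor_sym(2) by blast

lemma om_vert_v: assumes "p \<in> Q" shows "om p (0, c) (snd p) = 0" "om p (0, snd p) c = 0"
proof -
  show "om p (0, snd p) c = 0" for c
    by (rule g_eqI[OF assms])
      (use om_vert_g[OF assms, of "snd p" c] g_vert_v[OF assms] in \<open>simp add: g_simps[OF assms]\<close>)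
  then show "om p (0, c) (snd p) = 0" using om_vert_sym[OF assms] by simp
qed

text \<open>\<open>N\<close> is the nonlinear connection and \<open>H\<close> the horizontal lift: the covariant derivative of the
  canonical section \<open>v\<close> along \<open>(a,b)\<close> is \<open>b + N a\<close>.\<close>

definition N :: "'e \<times> 'e \<Rightarrow> 'e \<Rightarrow> 'e" where "N q a = om q (a, 0) (snd q)"

definition H :: "'e \<times> 'e \<Rightarrow> 'e \<Rightarrow> 'e \<times> 'e" where "H q a = (a, - N q a)"

definition Om :: "'e \<times> 'e \<Rightarrow> 'e \<times> 'e \<Rightarrow> 'e \<times> 'e \<Rightarrow> 'e \<Rightarrow> 'e"
  where "Om q \<xi> \<zeta> w = d_om q \<xi> \<zeta> w - d_om q \<zeta> \<xi> w + om q \<xi> (om q \<zeta> w) - om q \<zeta> (om q \<xi> w)"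

lemma om_v: assumes "q \<in> Q" shows "om q \<zeta> (snd q) = N q (fst \<zeta>)"
proof -
  have "om q \<zeta> (snd q) = om q ((fst \<zeta>, 0) + (0, snd \<zeta>)) (snd q)" by simp
  also have "\<dots> = N q (fst \<zeta>)" by (simp only: om_simps[OF assms] om_vert_v[OF assms] N_def add_0_right)
  finally show ?thesis .
qed

lemma smooth_N: "smooth_on Q (\<lambda>q. N q a)"
  unfolding N_def by (rule smooth_om[OF smooth_on_const smooth_snd[OF open_Q]])

lemma N_linear: assumes "q \<in> Q" shows "linear (N q)"
  unfolding N_def
proof (rule linearI)
  show "om q (a + b, 0) (snd q) = om q (a, 0) (snd q) + om q (b, 0) (snd q)" for a b
    using om_simps(1)[OF assms, of "(a, 0)" "(b, 0)" "snd q"] by simp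
  show "om q (r *\<^sub>R a, 0) (snd q) = r *\<^sub>R om q (a, 0) (snd q)" for r a
    using om_simps(4)[OF assms, of r "(a, 0)" "snd q"] by simp
qed

lemma H_linear: assumes "q \<in> Q" shows "linear (H q)"
  unfolding H_def using N_linear[OF assms]
  by (intro linearI) (simp_all add: linear_add linear_cmul)

lemma smooth_H: "smooth_on Q (\<lambda>q. H q a)"
  unfolding H_def by (intro smooth_on_Pair open_Q smooth_on_const smooth_on_uminus smooth_N)

definition dN :: "'e \<times> 'e \<Rightarrow> 'e \<times> 'e \<Rightarrow> 'e \<Rightarrow> 'e"
  where "dN p \<xi> a = dd (\<lambda>q. N q a) p \<xi>"

lemma smooth_dN: "smooth_on Q (\<lambda>q. dN q \<xi> a)"
  unfolding dN_def by (rule smooth_on_dd_const[OF open_Q smooth_N])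

lemma dN_linear: assumes "p \<in> Q" shows "linear (\<lambda>\<xi>. dN p \<xi> a)" "linear (\<lambda>a. dN p \<xi> a)"
  unfolding dN_def
  by (rule smooth_on_linear_dd[OF smooth_N assms] linear_family_dd[OF open_Q assms N_linear smooth_N])+

lemma dN_0: "p \<in> Q \<Longrightarrow> dN p \<xi> 0 = 0" using linear_0[OF dN_linear(2)] .

lemma dd_H: assumes "p \<in> Q" shows "dd (\<lambda>q. H q a) p \<xi> = (0, - dN p \<xi> a)"
proof -
  note d = smooth_on_differentiable[OF smooth_N assms]
  have "dd (\<lambda>q. - N q a) p \<xi> = - dN p \<xi> a"
    unfolding dN_def by (rule dd_bounded_linear[OF bounded_linear_minus[OF bounded_linear_ident] d])
  moreover have "(\<lambda>q. - N q a) differentiable (at p)" using d by simp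
  ultimately show ?thesis unfolding H_def by (subst dd_Pair) simp_all
qed

lemma Om_linear:
  assumes "q \<in> Q"
  shows "linear (\<lambda>\<xi>. Om q \<xi> \<zeta> w)" "linear (\<lambda>\<zeta>. Om q \<xi> \<zeta> w)" "linear (\<lambda>w. Om q \<xi> \<zeta> w)"
  using d_om_linear[OF assms]
  by (auto simp: linear_iff Om_def om_simps[OF assms] algebra_simps)

lemma Om_antisym: "Om q \<xi> \<zeta> w = - Om q \<zeta> \<xi> w" by (simp add: Om_def)

lemma smooth_Om: "smooth_on Q (\<lambda>q. Om q \<xi> \<zeta> w)"
  unfolding Om_def
  by (intro smooth_on_diff smooth_on_add open_Q smooth_d_om smooth_om smooth_on_const om_smooth)

lemma dN_formula: assumes "p \<in> Q" shows "dN p \<xi> (fst \<zeta>) = d_om p \<xi> \<zeta> (snd p) + om p \<zeta> (snd \<xi>)"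
proof -
  have "dd (\<lambda>q. om q \<zeta> (snd q)) p \<xi> = d_om p \<xi> \<zeta> (snd p) + om p (dd (\<lambda>q. \<zeta>) p \<xi>) (snd p) + om p \<zeta> (dd snd p \<xi>)"
    unfolding d_om_def by (rule dd_om[OF assms differentiable_const smooth_on_differentiable[OF smooth_snd[OF open_Q] assms]])
  moreover have "dd (\<lambda>q. om q \<zeta> (snd q)) p = dd (\<lambda>q. N q (fst \<zeta>)) p"
    by (rule frechet_derivative_cong_open[OF open_Q assms om_v])
  ultimately show ?thesis by (simp add: dN_def dd_snd om_simps[OF assms])
qed

lemma Om_v:
  assumes "p \<in> Q"
  shows "Om p \<xi> \<zeta> (snd p) = dN p \<xi> (fst \<zeta>) - dN p \<zeta> (fst \<xi>)
    + om p \<xi> (snd \<zeta> + N p (fst \<zeta>)) - om p \<zeta> (snd \<xi> + N p (fst \<xi>))"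
  by (simp add: Om_def om_v[OF assms] dN_formula[OF assms] om_simps[OF assms])

text \<open>Second derivatives of \<open>g\<close> commute; expressing them by metricity gives the skew symmetry of the
  curvature.\<close>

lemma Om_skew:
  assumes p: "p \<in> Q"
  shows "g p (Om p \<xi> \<zeta> a) b = - g p a (Om p \<xi> \<zeta> b)"
proof -
  have s: "dd (\<lambda>q. dd (\<lambda>q. g q a b) q \<zeta>) p \<xi> =
      g p (om p \<xi> (om p \<zeta> a)) b + g p (om p \<zeta> a) (om p \<xi> b) + g p (d_om p \<xi> \<zeta> a) b
    + (g p (om p \<xi> a) (om p \<zeta> b) + g p a (om p \<xi> (om p \<zeta> b)) + g p a (d_om p \<xi> \<zeta> b))" for \<xi> \<zeta>
  proof -
    note d = smooth_on_differentiable[OF om_smooth p]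
    have "dd (\<lambda>q. dd (\<lambda>q. g q a b) q \<zeta>) p \<xi> = dd (\<lambda>q. g q (om q \<zeta> a) b + g q a (om q \<zeta> b)) p \<xi>"
      by (rule fun_cong[OF frechet_derivative_cong_open[OF open_Q p metric]])
    also have "\<dots> = dd (\<lambda>q. g q (om q \<zeta> a) b) p \<xi> + dd (\<lambda>q. g q a (om q \<zeta> b)) p \<xi>"
      by (intro dd_add smooth_on_differentiable[OF smooth_g p] om_smooth smooth_on_const)
    also have "dd (\<lambda>q. g q (om q \<zeta> a) b) p \<xi> = g p (om p \<xi> (om p \<zeta> a)) b + g p (om p \<zeta> a) (om p \<xi> b) + g p (d_om p \<xi> \<zeta> a) b"
      by (simp add: dd_g[OF p d differentiable_const] metric[OF p] d_om_def g_simps[OF p])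
    also have "dd (\<lambda>q. g q a (om q \<zeta> b)) p \<xi> = g p (om p \<xi> a) (om p \<zeta> b) + g p a (om p \<xi> (om p \<zeta> b)) + g p a (d_om p \<xi> \<zeta> b)"
      by (simp add: dd_g[OF p differentiable_const d] metric[OF p] d_om_def g_simps[OF p])
    finally show ?thesis .
  qed
  have "dd (\<lambda>q. dd (\<lambda>q. g q a b) q \<zeta>) p \<xi> = dd (\<lambda>q. dd (\<lambda>q. g q a b) q \<xi>) p \<zeta>"
    by (rule dd_dd_commute[OF open_Q p g_smooth])
  then show ?thesis unfolding s by (simp add: Om_def g_simps[OF p])
qed

lemma Om_bianchi:
  assumes p: "p \<in> Q"
  shows "dd (\<lambda>q. Om q \<zeta> \<eta> w) p \<xi> + om p \<xi> (Om p \<zeta> \<eta> w) - Om p \<zeta> \<eta> (om p \<xi> w)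
    + (dd (\<lambda>q. Om q \<eta> \<xi> w) p \<zeta> + om p \<zeta> (Om p \<eta> \<xi> w) - Om p \<eta> \<xi> (om p \<zeta> w))
    + (dd (\<lambda>q. Om q \<xi> \<zeta> w) p \<eta> + om p \<eta> (Om p \<xi> \<zeta> w) - Om p \<xi> \<zeta> (om p \<eta> w)) = 0"
proof -
  note d = smooth_on_differentiable[OF om_smooth p]
  have e: "dd (\<lambda>q. Om q \<zeta> \<eta> w) p \<xi> = dd (\<lambda>q. d_om q \<zeta> \<eta> w) p \<xi> - dd (\<lambda>q. d_om q \<eta> \<zeta> w) p \<xi>
     + (d_om p \<xi> \<zeta> (om p \<eta> w) + om p \<zeta> (d_om p \<xi> \<eta> w)) - (d_om p \<xi> \<eta> (om p \<zeta> w) + om p \<eta> (d_om p \<xi> \<zeta> w))" for \<xi> \<zeta> \<eta>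
  proof -
    have oo: "dd (\<lambda>q. om q \<zeta> (om q \<eta> w)) p \<xi> = d_om p \<xi> \<zeta> (om p \<eta> w) + om p \<zeta> (d_om p \<xi> \<eta> w)" for \<zeta> \<eta>
      by (simp add: dd_om[OF p differentiable_const d] d_om_def om_simps[OF p])
    have s: "smooth_on Q (\<lambda>q. om q \<zeta> (om q \<eta> w))" for \<zeta> \<eta> by (intro smooth_om smooth_on_const om_smooth)
    have s2: "smooth_on Q (\<lambda>q. d_om q \<zeta> \<eta> w - d_om q \<eta> \<zeta> w)" by (intro smooth_on_diff open_Q smooth_d_om)
    note sd = smooth_on_differentiable[OF _ p]
    have "dd (\<lambda>q. Om q \<zeta> \<eta> w) p \<xi> = dd (\<lambda>q. d_om q \<zeta> \<eta> w - d_om q \<eta> \<zeta> w + om q \<zeta> (om q \<eta> w)) p \<xi> - dd (\<lambda>q. om q \<eta> (om q \<zeta> w)) p \<xi>"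
      unfolding Om_def by (rule dd_diff[OF sd[OF smooth_on_add[OF open_Q s2 s]] sd[OF s]])
    also have "dd (\<lambda>q. d_om q \<zeta> \<eta> w - d_om q \<eta> \<zeta> w + om q \<zeta> (om q \<eta> w)) p \<xi> = dd (\<lambda>q. d_om q \<zeta> \<eta> w - d_om q \<eta> \<zeta> w) p \<xi> + dd (\<lambda>q. om q \<zeta> (om q \<eta> w)) p \<xi>"
      by (rule dd_add[OF sd[OF s2] sd[OF s]])
    also have "dd (\<lambda>q. d_om q \<zeta> \<eta> w - d_om q \<eta> \<zeta> w) p \<xi> = dd (\<lambda>q. d_om q \<zeta> \<eta> w) p \<xi> - dd (\<lambda>q. d_om q \<eta> \<zeta> w) p \<xi>"
      by (rule dd_diff[OF sd[OF smooth_d_om] sd[OF smooth_d_om]])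
    finally show ?thesis unfolding oo .
  qed
  have c: "dd (\<lambda>q. d_om q \<zeta> \<eta> w) p \<xi> = dd (\<lambda>q. d_om q \<xi> \<eta> w) p \<zeta>" for \<xi> \<zeta> \<eta>
    unfolding d_om_def by (rule dd_dd_commute[OF open_Q p om_smooth])
  show ?thesis unfolding e
    using c[of \<zeta> \<eta> \<xi>] c[of \<eta> \<zeta> \<xi>] c[of \<zeta> \<xi> \<eta>]
    by (simp add: Om_def om_simps[OF p] algebra_simps)
qed

end

subsection \<open>Horizontal torsion and curvature\<close>

text \<open>Vanishing horizontal torsion means that the horizontal coefficients \<open>Gm\<close> are symmetric. The
  curvature splits into \<open>R\<close> on two horizontal vectors and \<open>P\<close> on a horizontal and a vertical one;
  \<open>Rv\<close> is the curvature of the nonlinear connection, equal to \<open>R(a,b)v\<close> by \<open>R_v\<close>.\<close>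

locale local_cartan = local_metric_connection +
  assumes tors_h: "q \<in> Q \<Longrightarrow> om q (H q a) b = om q (H q b) a"
begin

definition Gm :: "'a \<times> 'a \<Rightarrow> 'a \<Rightarrow> 'a \<Rightarrow> 'a" where "Gm q a b = om q (H q a) b"

definition R :: "'a \<times> 'a \<Rightarrow> 'a \<Rightarrow> 'a \<Rightarrow> 'a \<Rightarrow> 'a" where "R q a b w = Om q (H q a) (H q b) w"

definition P :: "'a \<times> 'a \<Rightarrow> 'a \<Rightarrow> 'a \<Rightarrow> 'a \<Rightarrow> 'a" where "P q a u w = Om q (H q a) (0, u) w"

definition Rv :: "'a \<times> 'a \<Rightarrow> 'a \<Rightarrow> 'a \<Rightarrow> 'a" where "Rv q a b = dN q (H q a) b - dN q (H q b) a"

lemma Gm_sym: "q \<in> Q \<Longrightarrow> Gm q a b = Gm q b a" unfolding Gm_def by (rule tors_h)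

lemma Gm_v: "q \<in> Q \<Longrightarrow> Gm q a (snd q) = N q a" by (simp add: Gm_def om_v H_def)

lemma Gm_linear: assumes "q \<in> Q" shows "linear (\<lambda>a. Gm q a b)" "linear (Gm q a)"
proof -
  show "linear (Gm q a)" for a unfolding Gm_def using om_lin2[OF assms] by simp
  from this[of b] show "linear (\<lambda>a. Gm q a b)" using Gm_sym[OF assms, of _ b] by simp
qed

lemma P_linear: assumes "q \<in> Q" shows "linear (\<lambda>a. P q a u w)" "linear (\<lambda>u. P q a u w)" "linear (P q a u)"
proof -
  show "linear (P q a u)" unfolding P_def[abs_def] by (rule Om_linear(3)[OF assms])
  show "linear (\<lambda>a. P q a u w)" unfolding P_def
    using linear_compose[OF H_linear[OF assms] Om_linear(1)[OF assms]] by (simp add: o_def)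
  have "linear (\<lambda>u. (0::'a, u::'a))" by (intro linearI) auto
  from linear_compose[OF this Om_linear(2)[OF assms]] show "linear (\<lambda>u. P q a u w)"
    by (simp add: P_def o_def)
qed

lemma R_linear: assumes "q \<in> Q" shows "linear (\<lambda>a. R q a b w)" "linear (\<lambda>b. R q a b w)" "linear (R q a b)"
proof -
  show "linear (R q a b)" unfolding R_def[abs_def] by (rule Om_linear(3)[OF assms])
  show "linear (\<lambda>a. R q a b w)" unfolding R_def
    using linear_compose[OF H_linear[OF assms] Om_linear(1)[OF assms]] by (simp add: o_def)
  show "linear (\<lambda>b. R q a b w)" unfolding R_def
    using linear_compose[OF H_linear[OF assms] Om_linear(2)[OF assms]] by (simp add: o_def)
qed

lemma R_antisym: "R q a b w = - R q b a w" unfolding R_def by (rule Om_antisym)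

lemma Rv_antisym: "Rv q a b = - Rv q b a" by (simp add: Rv_def)

lemma smooth_R: "smooth_on Q (\<lambda>q. R q a b w)"
  unfolding R_def
  by (rule smooth_on_bilinear_family[of Q "\<lambda>q \<xi> \<zeta>. Om q \<xi> \<zeta> w", OF open_Q Om_linear(1,2) smooth_Om smooth_H smooth_H])

lemma R_v: assumes "q \<in> Q" shows "R q a b (snd q) = Rv q a b"
  by (simp add: R_def Om_v[OF assms] Rv_def H_def om_simps[OF assms])

lemma P_v: assumes "q \<in> Q" shows "P q a u (snd q) = Gm q a u - dN q (0, u) a"
  by (simp add: P_def Om_v[OF assms] dN_0[OF assms] om_simps[OF assms] Gm_def)
    (simp add: H_def om_simps[OF assms] linear_0[OF N_linear[OF assms]])

lemma Rv_linear: assumes "q \<in> Q" shows "linear (\<lambda>a. Rv q a b)" "linear (Rv q a)"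
  using R_linear(1,2)[OF assms, of _ "snd q"] by (simp_all add: R_v[OF assms])

lemma smooth_Rv: "smooth_on Q (\<lambda>q. Rv q a b)"
proof (rule smooth_on_cong[OF open_Q R_v])
  show "smooth_on Q (\<lambda>q. R q a b (snd q))"
    by (rule smooth_on_linear_family[of Q "\<lambda>q. R q a b", OF open_Q R_linear(3) smooth_R smooth_snd[OF open_Q]])
qed

definition dGm :: "'a \<times> 'a \<Rightarrow> 'a \<times> 'a \<Rightarrow> 'a \<Rightarrow> 'a \<Rightarrow> 'a"
  where "dGm p \<xi> a b = dd (\<lambda>q. Gm q a b) p \<xi>"

lemma dGm_sym: assumes "p \<in> Q" shows "dGm p \<xi> a b = dGm p \<xi> b a"
  unfolding dGm_def by (rule fun_cong[OF frechet_derivative_cong_open[OF open_Q assms Gm_sym]])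

lemma d_om_H: assumes p: "p \<in> Q" shows "d_om p \<xi> (H p a) b = dGm p \<xi> a b + om p (0, dN p \<xi> a) b"
proof -
  have "dGm p \<xi> a b = d_om p \<xi> (H p a) b + om p (0, - dN p \<xi> a) b"
    unfolding dGm_def Gm_def
    by (simp add: dd_om[OF p smooth_on_differentiable[OF smooth_H p] differentiable_const] dd_H[OF p] d_om_def om_simps[OF p])
  moreover have "(0, - dN p \<xi> a) = - (0::'a, dN p \<xi> a)" by simp
  ultimately show ?thesis by (simp only: om_simps[OF p]) simp
qed

lemma om_pair: assumes "p \<in> Q" shows "om p (0, x + y) w = om p (0, x) w + om p (0, y) w"
    "om p (0, x - y) w = om p (0, x) w - om p (0, y) w" "om p (0, - x) w = - om p (0, x) w"
  using om_simps(1)[OF assms, of "(0, x)" "(0, y)" w] om_simps(2)[OF assms, of "(0, x)" "(0, y)" w]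
    om_simps(3)[OF assms, of "(0, x)" w] by simp_all

text \<open>The horizontal curvature is that of the symmetric coefficients \<open>Gm\<close>, corrected by the Cartan
  tensor because horizontal lifts do not commute. The first Bianchi identity is then the usual
  cancellation for symmetric coefficients.\<close>

lemma R_eq: assumes p: "p \<in> Q"
  shows "R p a b c = dGm p (H p a) b c - dGm p (H p b) a c + Gm p a (Gm p b c) - Gm p b (Gm p a c)
    + om p (0, Rv p a b) c"
  unfolding R_def Om_def d_om_H[OF p] Gm_def[symmetric]
  by (simp add: Rv_def om_pair[OF p])

lemma first_bianchi: assumes p: "p \<in> Q"
  shows "R p a b c + R p b c a + R p c a b
    = om p (0, Rv p a b) c + om p (0, Rv p b c) a + om p (0, Rv p c a) b"
  unfolding R_eq[OF p]
  using dGm_sym[OF p, of "H p a" b c] dGm_sym[OF p, of "H p b" a c] dGm_sym[OF p, of "H p c" a b]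
    Gm_sym[OF p, of b c] Gm_sym[OF p, of a c] Gm_sym[OF p, of a b]
  by (simp add: algebra_simps)

lemma R_skew: "p \<in> Q \<Longrightarrow> g p (R p a b c) d = - g p c (R p a b d)"
  and P_skew: "p \<in> Q \<Longrightarrow> g p (P p a b c) d = - g p c (P p a b d)"
  unfolding R_def P_def by (rule Om_skew; assumption)+

subsection \<open>Symmetry of the vertical derivative of the nonlinear connection\<close>

text \<open>\<open>nablaV\<close> is the horizontal covariant derivative of the Cartan tensor. Like the Cartan tensor it
  is totally symmetric and vanishes on \<open>v\<close>.\<close>

definition nablaV :: "'a \<times> 'a \<Rightarrow> 'a \<Rightarrow> 'a \<Rightarrow> 'a \<Rightarrow> 'a"
  where "nablaV p a u b = d_om p (H p a) (0, u) b + Gm p a (om p (0, u) b)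
    - om p (0, u) (Gm p a b) - om p (0, Gm p a u) b"

lemma P_eq: assumes p: "p \<in> Q"
  shows "P p a u b = nablaV p a u b + om p (0, P p a u (snd p)) b - dGm p (0, u) a b"
  unfolding P_v[OF p] om_pair[OF p]
  unfolding P_def Om_def d_om_H[OF p] Gm_def[symmetric] nablaV_def by simp

lemma nablaV_g: assumes p: "p \<in> Q"
  shows "g p (nablaV p a u b) c = dd (\<lambda>q. g q (om q (0, u) b) c) p (H p a)
    - g p (om p (0, u) b) (Gm p a c) - g p (om p (0, u) (Gm p a b)) c - g p (om p (0, Gm p a u) b) c"
proof -
  have "dd (\<lambda>q. g q (om q (0, u) b) c) p (H p a) =
      g p (Gm p a (om p (0, u) b)) c + g p (om p (0, u) b) (Gm p a c) + g p (d_om p (H p a) (0, u) b) c"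
    by (simp add: dd_g[OF p smooth_on_differentiable[OF om_smooth p] differentiable_const]
        metric[OF p] g_simps[OF p] d_om_def Gm_def)
  then show ?thesis by (simp add: nablaV_def g_simps[OF p])
qed

lemma nablaV_sym: assumes p: "p \<in> Q"
  shows "g p (nablaV p a u b) c = g p (nablaV p a u c) b" "nablaV p a u b = nablaV p a b u"
proof -
  have "dd (\<lambda>q. g q (om q (0, u) b) c) p = dd (\<lambda>q. g q (om q (0, u) c) b) p" for u b c
    by (rule frechet_derivative_cong_open[OF open_Q p cartan_tensor_sym(1)])
  then show "g p (nablaV p a u b) c = g p (nablaV p a u c) b"
    unfolding nablaV_g[OF p] using cartan_tensor_sym(1)[OF p] g_sym[OF p] by (simp add: algebra_simps)
  have *: "dd (\<lambda>q. g q (om q (0, u) b) c) p = dd (\<lambda>q. g q (om q (0, b) u) c) p" for c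
    by (rule frechet_derivative_cong_open[OF open_Q p cartan_tensor_sym(2)])
  show "nablaV p a u b = nablaV p a b u"
    by (rule g_eqI[OF p]) (simp add: nablaV_g[OF p] * om_vert_sym[OF p, of u] om_vert_sym[OF p, of "Gm p a u"])
qed

lemma nablaV_v: assumes p: "p \<in> Q" shows "nablaV p a u (snd p) = 0"
proof -
  have z: "dd (\<lambda>q. om q (0, u) (snd q)) p = dd (\<lambda>q. 0) p"
    by (rule frechet_derivative_cong_open[OF open_Q p om_vert_v(1)])
  have "dd (\<lambda>q. om q (0, u) (snd q)) p (H p a) = d_om p (H p a) (0, u) (snd p) + om p (0, u) (snd (H p a))"
    by (simp add: dd_om[OF p differentiable_const smooth_on_differentiable[OF smooth_snd[OF open_Q] p]]
        d_om_def dd_snd om_simps[OF p])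
  with z have "d_om p (H p a) (0, u) (snd p) = om p (0, u) (N p a)"
    by (simp add: H_def om_simps[OF p])
  then show ?thesis
    using om_simps(10)[OF p, of "H p a"] by (simp add: nablaV_def om_vert_v[OF p] Gm_v[OF p] Gm_def[symmetric])
qed

text \<open>\<open>P(a,u)v\<close> is the Landsberg tensor, that is, up to sign the derivative of the Cartan tensor along
  the spray. By \<open>P_eq\<close> and \<open>P_skew\<close>, \<open>g(P(a,u)v,z)\<close> is symmetric in \<open>a\<close> and \<open>z\<close>, which first gives
  \<open>P(v,u)v = 0\<close>. Then \<open>P(v,u)a - P(a,u)v\<close> is the derivative \<open>nablaV(v;u,a)\<close>; the first term is skew and
  the second symmetric in \<open>a\<close> and \<open>z\<close>, so the symmetric part of this relation determines \<open>P(a,u)v\<close>.\<close>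

lemma P_v_landsberg: assumes p: "p \<in> Q"
  shows "g p (P p a u (snd p)) z = - g p (nablaV p (snd p) u a) z"
proof -
  let ?v = "snd p"
  have "g p (om p (0, x) b) ?v = 0" for x b
    using cartan_tensor_sym(1)[OF p, of x b ?v] by (simp add: om_vert_v[OF p] g_simps[OF p])
  moreover have "g p (nablaV p a u b) ?v = 0" for a b
    using nablaV_sym(1)[OF p, of a u b ?v] by (simp add: nablaV_v[OF p] g_simps[OF p])
  ultimately have s: "g p (P p a u ?v) z = g p (dGm p (0, u) a z) ?v" for a z
    unfolding P_skew[OF p, of a u ?v] P_eq[OF p, of a u z] by (simp add: g_simps[OF p] g_sym[OF p, of ?v])
  have sym: "g p (P p a u ?v) z = g p (P p z u ?v) a" for a z
    unfolding s using dGm_sym[OF p, of "(0, u)" a z] by simp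
  have P1: "P p a u ?v = - dGm p (0, u) a ?v" for a
    by (rule trans[OF P_eq[OF p]]) (simp add: nablaV_v[OF p] om_vert_v[OF p])
  have "g p (P p ?v u ?v) z = 0" for z
    using sym[of ?v z] P_skew[OF p, of z u ?v ?v] g_sym[OF p, of ?v "P p z u ?v"] by linarith
  then have Pvv: "P p ?v u ?v = 0" by (intro g_eqI[OF p]) (simp add: g_simps[OF p])
  have P2: "P p ?v u a = nablaV p ?v u a + P p a u ?v" for a
    unfolding P_eq[OF p, of ?v u a] Pvv P1[of a] dGm_sym[OF p, of _ ?v a]
    using om_simps(5)[OF p, of a] by (simp add: zero_prod_def)
  have "g p (P p ?v u a) z = - g p (P p ?v u z) a"
    using P_skew[OF p, of ?v u a z] g_sym[OF p, of a "P p ?v u z"] by linarith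
  then show ?thesis unfolding P2 using sym[of a z] nablaV_sym(1)[OF p, of ?v u a z]
    by (simp add: g_simps[OF p])
qed

lemma P_v_sym: assumes p: "p \<in> Q" shows "P p a u (snd p) = P p u a (snd p)"
  by (rule g_eqI[OF p]) (simp add: P_v_landsberg[OF p] nablaV_sym(2)[OF p, of _ u a])

text \<open>The nonlinear connection comes from a spray: its vertical derivative is symmetric.\<close>

lemma dN_vert_sym: assumes p: "p \<in> Q" shows "dN p (0, u) a = dN p (0, a) u"
  using P_v_sym[OF p, of a u] Gm_sym[OF p, of a u] by (simp add: P_v[OF p])

definition dRv :: "'a \<times> 'a \<Rightarrow> 'a \<Rightarrow> 'a \<Rightarrow> 'a \<Rightarrow> 'a"
  where "dRv p u a b = dd (\<lambda>q. Rv q a b) p (0, u)"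

lemma dRv_eq: assumes p: "p \<in> Q"
  shows "dRv p u a b = dd (\<lambda>q. dN q (0, u) b) p (H p a) - dd (\<lambda>q. dN q (0, u) a) p (H p b)
    - dN p (0, dN p (0, u) a) b + dN p (0, dN p (0, u) b) a"
proof -
  have l: "linear (\<lambda>\<xi>. dN q \<xi> b)" if "q \<in> Q" for q b by (rule dN_linear(1)[OF that])
  have e: "dd (\<lambda>q. dN q (H q a) b) p (0, u) = dd (\<lambda>q. dN q (0, u) b) p (H p a) - dN p (0, dN p (0, u) a) b" for a b
  proof -
    have "dd (\<lambda>q. dN q (H q a) b) p (0, u) = dd (\<lambda>q. dN q (H p a) b) p (0, u) + dN p (dd (\<lambda>q. H q a) p (0, u)) b"
      by (rule dd_linear_family[of Q p "\<lambda>q \<xi>. dN q \<xi> b", OF open_Q p l smooth_dN smooth_on_differentiable[OF smooth_H p]])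
    also have "dd (\<lambda>q. dN q (H p a) b) p (0, u) = dd (\<lambda>q. dN q (0, u) b) p (H p a)"
      unfolding dN_def by (rule dd_dd_commute[OF open_Q p smooth_N])
    also have "dN p (dd (\<lambda>q. H q a) p (0, u)) b = dN p (- (0, dN p (0, u) a)) b" by (simp add: dd_H[OF p])
    also have "\<dots> = - dN p (0, dN p (0, u) a) b" by (rule linear_neg[OF l[OF p]])
    finally show ?thesis by simp
  qed
  have s: "smooth_on Q (\<lambda>q. dN q (H q a) b)" for a b
    by (rule smooth_on_linear_family[of Q "\<lambda>q \<xi>. dN q \<xi> b", OF open_Q l smooth_dN smooth_H])
  have "dRv p u a b = dd (\<lambda>q. dN q (H q a) b) p (0, u) - dd (\<lambda>q. dN q (H q b) a) p (0, u)"
    unfolding dRv_def Rv_def by (intro dd_diff smooth_on_differentiable[OF s p])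
  then show ?thesis unfolding e by simp
qed

lemma dRv_cyclic: assumes p: "p \<in> Q"
  shows "dRv p u a b + dRv p a b u + dRv p b u a = 0"
proof -
  have "dd (\<lambda>q. dN q (0, u) b) p = dd (\<lambda>q. dN q (0, b) u) p" for u b
    by (rule frechet_derivative_cong_open[OF open_Q p dN_vert_sym])
  then show ?thesis unfolding dRv_eq[OF p] dN_vert_sym[OF p, of a u] dN_vert_sym[OF p, of b u] dN_vert_sym[OF p, of b a]
    by (simp add: algebra_simps)
qed

subsection \<open>The second Bianchi identity\<close>

text \<open>\<open>Om_bianchi\<close> is about constant vectors of the chart. The horizontal lift of a constant vector
  varies with the point, by a vertical amount; this is where the terms in \<open>P\<close> come from.\<close>

lemma second_bianchi_aux: assumes p: "p \<in> Q"
  shows "dd (\<lambda>q. R q b c w) p (H p a) = dd (\<lambda>q. Om q (H p b) (H p c) w) p (H p a)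
    + P p c (dN p (H p a) b) w - P p b (dN p (H p a) c) w"
proof -
  note dH = smooth_on_differentiable[OF smooth_H p]
  have neg: "Om p (0, - x) \<zeta> w = Om p \<zeta> (0, x) w" "Om p \<zeta> (0, - x) w = - Om p \<zeta> (0, x) w" for x \<zeta>
    using linear_neg[OF Om_linear(1)[OF p, where \<zeta> = \<zeta> and w = w], of "(0, x)"]
      linear_neg[OF Om_linear(2)[OF p, where \<xi> = \<zeta> and w = w], of "(0, x)"]
      Om_antisym[of p "(0, x)" \<zeta> w] by simp_all
  show ?thesis unfolding R_def
    by (subst dd_bilinear_family[of Q p "\<lambda>q \<xi> \<zeta>. Om q \<xi> \<zeta> w", OF open_Q p Om_linear(1,2) smooth_Om dH dH])
      (simp_all add: dd_H[OF p] neg P_def)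
qed

lemma second_bianchi: assumes p: "p \<in> Q"
  shows "dd (\<lambda>q. R q b c w) p (H p a) + Gm p a (R p b c w) - R p b c (Gm p a w)
    + (dd (\<lambda>q. R q c a w) p (H p b) + Gm p b (R p c a w) - R p c a (Gm p b w))
    + (dd (\<lambda>q. R q a b w) p (H p c) + Gm p c (R p a b w) - R p a b (Gm p c w))
    = P p c (Rv p a b) w + P p a (Rv p b c) w + P p b (Rv p c a) w"
proof -
  have d: "P p c (x - y) w = P p c x w - P p c y w" for c x y by (rule linear_diff[OF P_linear(2)[OF p]])
  show ?thesis
    using Om_bianchi[OF p, of "H p b" "H p c" w "H p a"]
    unfolding second_bianchi_aux[OF p] Rv_def d
    unfolding Gm_def R_def by (simp add: algebra_simps)
qed

text \<open>The curvature tensor of constant curvature \<open>k\<close>. It is built from \<open>g\<close> and the identity, both of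
  which are parallel.\<close>

definition B :: "real \<Rightarrow> 'a \<times> 'a \<Rightarrow> 'a \<Rightarrow> 'a \<Rightarrow> 'a \<Rightarrow> 'a"
  where "B k q a b w = k *\<^sub>R (g q b w *\<^sub>R a - g q a w *\<^sub>R b)"

lemma smooth_B: "smooth_on Q (\<lambda>q. B k q a b w)"
  unfolding B_def by (intro smooth_on_scaleR smooth_on_diff open_Q smooth_on_const g_smooth)

lemma B_linear: assumes "q \<in> Q" shows "linear (\<lambda>a. B k q a b w)" "linear (\<lambda>b. B k q a b w)" "linear (B k q a b)"
  by (auto simp: linear_iff B_def g_simps[OF assms] algebra_simps)

lemma dd_B: assumes p: "p \<in> Q"
  shows "dd (\<lambda>q. B k q b c w) p (H p a) + Gm p a (B k p b c w) - B k p b c (Gm p a w)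
    = B k p (Gm p a b) c w + B k p b (Gm p a c) w"
proof -
  note dg = smooth_on_differentiable[OF g_smooth p]
  have dgs: "dd (\<lambda>q. g q x y *\<^sub>R z) p \<xi> = dd (\<lambda>q. g q x y) p \<xi> *\<^sub>R z" for x y z \<xi>
    by (rule dd_bounded_linear[OF bounded_linear_scaleR_left dg])
  have sg: "smooth_on Q (\<lambda>q. g q x y *\<^sub>R z)" for x y z
    by (intro smooth_on_scaleR open_Q smooth_on_const g_smooth)
  have "dd (\<lambda>q. B k q b c w) p (H p a) = k *\<^sub>R dd (\<lambda>q. g q c w *\<^sub>R b - g q b w *\<^sub>R c) p (H p a)"
    unfolding B_def by (rule dd_bounded_linear[OF bounded_linear_scaleR_right
        smooth_on_differentiable[OF smooth_on_diff[OF open_Q sg sg] p]])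
  also have "dd (\<lambda>q. g q c w *\<^sub>R b - g q b w *\<^sub>R c) p (H p a)
      = dd (\<lambda>q. g q c w *\<^sub>R b) p (H p a) - dd (\<lambda>q. g q b w *\<^sub>R c) p (H p a)"
    by (intro dd_diff smooth_on_differentiable[OF sg p])
  finally have e: "dd (\<lambda>q. B k q b c w) p (H p a) = k *\<^sub>R
      ((g p (Gm p a c) w + g p c (Gm p a w)) *\<^sub>R b - (g p (Gm p a b) w + g p b (Gm p a w)) *\<^sub>R c)"
    by (simp add: dgs metric[OF p] Gm_def)
  have gl: "Gm p a (k *\<^sub>R (x *\<^sub>R b - y *\<^sub>R c)) = k *\<^sub>R (x *\<^sub>R Gm p a b - y *\<^sub>R Gm p a c)" for x y
    by (simp add: linear_diff[OF Gm_linear(2)[OF p]] linear_cmul[OF Gm_linear(2)[OF p]])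
  show ?thesis unfolding e unfolding B_def gl by (simp add: algebra_simps)
qed

lemma B_bianchi: assumes p: "p \<in> Q"
  shows "dd (\<lambda>q. B k q b c w) p (H p a) + Gm p a (B k p b c w) - B k p b c (Gm p a w)
    + (dd (\<lambda>q. B k q c a w) p (H p b) + Gm p b (B k p c a w) - B k p c a (Gm p b w))
    + (dd (\<lambda>q. B k q a b w) p (H p c) + Gm p c (B k p a b w) - B k p a b (Gm p c w)) = 0"
  unfolding dd_B[OF p] Gm_sym[OF p, of b a] Gm_sym[OF p, of c a] Gm_sym[OF p, of c b]
  by (simp add: B_def algebra_simps)

definition Rb :: "real \<Rightarrow> 'a \<times> 'a \<Rightarrow> 'a \<Rightarrow> 'a \<Rightarrow> 'a \<Rightarrow> 'a"
  where "Rb k q a b w = R q a b w - B k q a b w"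

lemma Rb_antisym: "Rb k q a b w = - Rb k q b a w"
  using R_antisym[of q a b w] by (simp add: Rb_def B_def algebra_simps)

lemma smooth_Rb: "smooth_on Q (\<lambda>q. Rb k q a b w)"
  unfolding Rb_def by (intro smooth_on_diff open_Q smooth_R smooth_B)

lemma Rb_linear: assumes "q \<in> Q" shows "linear (\<lambda>a. Rb k q a b w)" "linear (\<lambda>b. Rb k q a b w)" "linear (Rb k q a b)"
  unfolding Rb_def[abs_def] using R_linear[OF assms] B_linear[OF assms]
  by (simp_all add: linear_compose_sub)

lemma Rb_bianchi: assumes p: "p \<in> Q"
  shows "dd (\<lambda>q. Rb k q b c w) p (H p a) + Gm p a (Rb k p b c w) - Rb k p b c (Gm p a w)
    + (dd (\<lambda>q. Rb k q c a w) p (H p b) + Gm p b (Rb k p c a w) - Rb k p c a (Gm p b w))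
    + (dd (\<lambda>q. Rb k q a b w) p (H p c) + Gm p c (Rb k p a b w) - Rb k p a b (Gm p c w))
    = P p c (Rv p a b) w + P p a (Rv p b c) w + P p b (Rv p c a) w"
proof -
  have d: "dd (\<lambda>q. Rb k q b c w) p \<xi> = dd (\<lambda>q. R q b c w) p \<xi> - dd (\<lambda>q. B k q b c w) p \<xi>" for b c \<xi>
    unfolding Rb_def by (intro dd_diff smooth_on_differentiable[OF smooth_R p] smooth_on_differentiable[OF smooth_B p])
  have l: "Gm p a (x - y) = Gm p a x - Gm p a y" for a x y by (rule linear_diff[OF Gm_linear(2)[OF p]])
  show ?thesis using second_bianchi[OF p, of b c w a] B_bianchi[OF p, of k b c w a]
    unfolding d unfolding Rb_def l by (simp add: algebra_simps)
qed

subsection \<open>Curvature in the direction of the canonical section\<close>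

text \<open>Exactly as the pair symmetry of a Riemannian curvature tensor follows from the first Bianchi
  identity, four instances of it express \<open>R(t,v)\<close> by the nonlinear curvature \<open>Rv\<close> and the
  Cartan tensor.\<close>

lemma R_canonical: assumes p: "p \<in> Q"
  shows "g p (R p t (snd p) z) w = g p (Rv p t z) w - g p (Rv p t w) z
    - g p (om p (0, Rv p z (snd p)) t) w + g p (om p (0, Rv p w (snd p)) t) z"
proof -
  let ?v = "snd p"
  have fb: "g p (R p a b c) d + g p (R p b c a) d + g p (R p c a b) d
    = g p (om p (0, Rv p a b) c) d + g p (om p (0, Rv p b c) a) d + g p (om p (0, Rv p c a) b) d" for a b c d
    using arg_cong[OF first_bianchi[OF p, of a b c], of "\<lambda>x. g p x d"] by (simp add: g_simps[OF p])
  have sk: "g p (R p a b c) d = - g p (R p a b d) c" for a b c d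
    using R_skew[OF p, of a b c d] g_sym[OF p, of c "R p a b d"] by linarith
  have as: "g p (R p a b c) d = - g p (R p b a c) d" for a b c d
    using R_antisym[of p a b c] by (simp add: g_simps[OF p])
  have cs: "g p (om p (0, a) b) c = g p (om p (0, a) c) b" for a b c by (rule cartan_tensor_sym(1)[OF p])
  have cv: "om p (0, a) ?v = 0" for a by (rule om_vert_v[OF p])
  have cv': "g p (om p (0, a) b) ?v = 0" for a b using cs[of a b ?v] by (simp add: cv g_simps[OF p])
  have neg: "g p (om p (0, Rv p a b) c) d = - g p (om p (0, Rv p b a) c) d" for a b c d
    using Rv_antisym[of p a b] by (simp add: om_pair[OF p] g_simps[OF p])
  have rv: "g p (R p a b ?v) d = g p (Rv p a b) d" "g p (R p a b d) ?v = - g p (Rv p a b) d" for a b d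
  proof -
    show "g p (R p a b ?v) d = g p (Rv p a b) d" by (simp only: R_v[OF p])
    then show "g p (R p a b d) ?v = - g p (Rv p a b) d" using sk[of a b d ?v] by linarith
  qed
  have rn: "g p (Rv p a b) d = - g p (Rv p b a) d" for a b d
    using Rv_antisym[of p a b] by (simp add: g_simps[OF p])
  have c0: "g p (om p (0, a) ?v) d = 0" for a d by (simp add: cv g_simps[OF p])
  show ?thesis
    using fb[of t ?v z w] fb[of t ?v w z] fb[of z w ?v t] fb[of z w t ?v]
      sk[of t ?v z w] sk[of ?v z t w] sk[of ?v w t z] as[of ?v w z t]
      rv(1)[of z t w] rv(1)[of w t z] rv(1)[of z w t] rv(2)[of z w t] rv(2)[of w t z] rv(2)[of t z w]
      rn[of z t w] rn[of w t z] neg[of ?v z t w] neg[of ?v w t z]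
      cs[of "Rv p t ?v" z w] cs[of "Rv p w ?v" z t] cs[of "Rv p ?v z" w t]
      c0[of "Rv p z t" w] c0[of "Rv p w t" z] c0[of "Rv p z w" t]
      cv'[of "Rv p z w" t] cv'[of "Rv p w t" z] cv'[of "Rv p t z" w]
    by linarith
qed

text \<open>The hypothesis says that \<open>Rv(t,z) = B(t,z)u\<close> in all directions \<open>u\<close> over \<open>x\<close>, so it may be
  differentiated along the fibre. In \<open>R_canonical\<close> the terms in \<open>Rv(t,\<cdot>)\<close> then are those of \<open>B(t,v)\<close>, and
  the two terms in the Cartan tensor must cancel: \<open>z \<mapsto> Rv(z,v)\<close> has to commute with \<open>C(t,\<cdot>)\<close>. This
  is the derivative in the direction \<open>t\<close> of the symmetry of \<open>g(Rv(z,v),w)\<close> in \<open>z\<close> and \<open>w\<close>; the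
  derivative of \<open>Rv(z,v)\<close> is known by the cyclic identity \<open>dRv_cyclic\<close>.\<close>

lemma Rb_canonical:
  assumes p: "(x, v) \<in> Q"
    and t: "\<And>u z. (x, u) \<in> Q \<Longrightarrow> Rb k (x, u) t z u = 0"
  shows "Rb k (x, v) t v w = 0"
proof -
  let ?p = "(x, v)"
  have rt: "Rv q t z = k *\<^sub>R (g q z (snd q) *\<^sub>R t - g q t (snd q) *\<^sub>R z)" if "q \<in> Q" "fst q = x" for q z
    using t[of "snd q" z] that R_v[OF that(1), of t z] by (cases q) (simp add: Rb_def B_def)
  note dsnd = smooth_on_differentiable[OF smooth_snd[OF open_Q] p]
  have dgv: "dd (\<lambda>q. g q z (snd q)) ?p (0, u) = g ?p z u" for z u
    using om_vert_g[OF p, of u z v] cartan_tensor_sym(1)[OF p, of u z v] om_vert_v(1)[OF p, of u]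
    by (simp add: dd_g[OF p differentiable_const dsnd] dd_snd g_simps[OF p])
  have sgv: "smooth_on Q (\<lambda>q. g q z (snd q))" for z
    by (intro smooth_g smooth_on_const smooth_snd open_Q)
  have drt: "dRv ?p u t z = k *\<^sub>R (g ?p z u *\<^sub>R t - g ?p t u *\<^sub>R z)" for u z
  proof -
    have s1: "smooth_on Q (\<lambda>q. g q z (snd q) *\<^sub>R y)" for z y
      by (intro smooth_on_scaleR open_Q smooth_on_const sgv)
    have s2: "smooth_on Q (\<lambda>q. g q z (snd q) *\<^sub>R t - g q t (snd q) *\<^sub>R z)"
      by (intro smooth_on_diff open_Q s1)
    have s: "smooth_on Q (\<lambda>q. k *\<^sub>R (g q z (snd q) *\<^sub>R t - g q t (snd q) *\<^sub>R z))"
      by (intro smooth_on_scaleR open_Q smooth_on_const s2)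
    have "dRv ?p u t z = dd (\<lambda>q. k *\<^sub>R (g q z (snd q) *\<^sub>R t - g q t (snd q) *\<^sub>R z)) ?p (0, u)"
      unfolding dRv_def
      by (rule dd_vertical_cong[OF open_Q p smooth_on_differentiable[OF smooth_Rv p] smooth_on_differentiable[OF s p] rt]) auto
    also have "\<dots> = k *\<^sub>R dd (\<lambda>q. g q z (snd q) *\<^sub>R t - g q t (snd q) *\<^sub>R z) ?p (0, u)"
      by (rule dd_bounded_linear[OF bounded_linear_scaleR_right smooth_on_differentiable[OF s2 p]])
    also have "dd (\<lambda>q. g q z (snd q) *\<^sub>R t - g q t (snd q) *\<^sub>R z) ?p (0, u)
        = dd (\<lambda>q. g q z (snd q) *\<^sub>R t) ?p (0, u) - dd (\<lambda>q. g q t (snd q) *\<^sub>R z) ?p (0, u)"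
      by (intro dd_diff smooth_on_differentiable[OF s1 p])
    also have "\<dots> = dd (\<lambda>q. g q z (snd q)) ?p (0, u) *\<^sub>R t - dd (\<lambda>q. g q t (snd q)) ?p (0, u) *\<^sub>R z"
      by (simp add: dd_bounded_linear[OF bounded_linear_scaleR_left smooth_on_differentiable[OF sgv p]])
    finally show ?thesis by (simp add: dgv)
  qed
  have anti: "dRv ?p u a b = - dRv ?p u b a" for u a b
  proof -
    have "dRv ?p u a b = dd (\<lambda>q. - Rv q b a) ?p (0, u)" unfolding dRv_def
      by (rule fun_cong[OF arg_cong[where f = "\<lambda>f. dd f ?p"]]) (rule ext, rule Rv_antisym)
    also have "\<dots> = - dRv ?p u b a" unfolding dRv_def
      by (rule dd_bounded_linear[OF bounded_linear_minus[OF bounded_linear_ident] smooth_on_differentiable[OF smooth_Rv p]])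
    finally show ?thesis .
  qed
  \<comment> \<open>the cyclic identity applied to \<open>t\<close>, \<open>z\<close> and \<open>v\<close>; the two known terms follow from \<open>drt\<close>\<close>
  have dtz: "dRv ?p t z v = k *\<^sub>R (2 *\<^sub>R (0::'a) + (g ?p v z *\<^sub>R t - g ?p t z *\<^sub>R v) - (g ?p z v *\<^sub>R t - g ?p t v *\<^sub>R z))" for z
    using dRv_cyclic[OF p, of t z v] anti[of z v t] drt[of z v] drt[of v z]
    by (simp add: algebra_simps eq_neg_iff_add_eq_0 add_eq_0_iff)
  define j where "j = (\<lambda>z w q. g q (Rv q z (snd q)) w)"
  have sr: "smooth_on Q (\<lambda>q. Rv q z (snd q))" for z
    by (rule smooth_on_linear_family[of Q "\<lambda>q. Rv q z", OF open_Q Rv_linear(2) smooth_Rv smooth_snd[OF open_Q]])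
  have jd: "dd (j z w) ?p (0, t) = 2 * g ?p (om ?p (0, t) (Rv ?p z v)) w + g ?p (dRv ?p t z v + Rv ?p z t) w" for z w
  proof -
    have "dd (\<lambda>q. Rv q z (snd q)) ?p (0, t) = dRv ?p t z v + Rv ?p z t"
      using dd_linear_family[of Q ?p "\<lambda>q. Rv q z", OF open_Q p Rv_linear(2) smooth_Rv dsnd, of "(0, t)"]
      by (simp add: dd_snd dRv_def)
    then show ?thesis unfolding j_def
      by (simp add: dd_g[OF p smooth_on_differentiable[OF sr p] differentiable_const] om_vert_g[OF p] g_simps[OF p])
  qed
  have "j z w q = j w z q" if q: "q \<in> Q" for z w q
  proof -
    have fb: "g q (R q z w (snd q)) (snd q) + g q (R q w (snd q) z) (snd q) + g q (R q (snd q) z w) (snd q) = 0"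
      using arg_cong[OF first_bianchi[OF q, of z w "snd q"], of "\<lambda>x. g q x (snd q)"]
        cartan_tensor_sym(1)[OF q, of _ _ "snd q"] om_vert_v(1)[OF q] by (simp add: g_simps[OF q])
    have sk: "g q (R q a b c) (snd q) = - g q (Rv q a b) c" for a b c
    proof -
      have "g q c (R q a b (snd q)) = g q (Rv q a b) c" by (subst R_v[OF q]) (rule g_sym[OF q])
      then show ?thesis using R_skew[OF q, of a b c "snd q"] by linarith
    qed
    have "g q (Rv q z w) (snd q) = 0"
      using sk[of z w "snd q"] unfolding R_v[OF q] by linarith
    then have "g q (Rv q w (snd q)) z + g q (Rv q (snd q) z) w = 0"
      using fb unfolding sk by simp
    then show ?thesis using Rv_antisym[of q "snd q" z] by (simp add: j_def g_simps[OF q])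
  qed
  then have "dd (j z w) ?p (0, t) = dd (j w z) ?p (0, t)" for z w
    using fun_cong[OF frechet_derivative_cong_open[OF open_Q p, of "j z w" "j w z"]] by blast
  then have C: "2 * g ?p (om ?p (0, t) (Rv ?p z v)) w + g ?p (dRv ?p t z v + Rv ?p z t) w
      = 2 * g ?p (om ?p (0, t) (Rv ?p w v)) z + g ?p (dRv ?p t w v + Rv ?p w t) z" for z w
    by (simp add: jd)
  have rt': "Rv ?p t z = k *\<^sub>R (g ?p z v *\<^sub>R t - g ?p t v *\<^sub>R z)" for z using rt[OF p] by simp
  have rz: "Rv ?p z t = - (k *\<^sub>R (g ?p z v *\<^sub>R t - g ?p t v *\<^sub>R z))" for z
    using Rv_antisym[of ?p z t] rt' by simp
  show ?thesis
  proof (rule g_eqI[OF p])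
    fix z
    have "g ?p (om ?p (0, t) (Rv ?p w v)) z = g ?p (om ?p (0, t) (Rv ?p z v)) w"
      using C[of w z] g_sym[OF p, of z w] g_sym[OF p, of v w] g_sym[OF p, of v z] g_sym[OF p, of t w] g_sym[OF p, of t z]
      unfolding dtz rz by (simp add: g_simps[OF p] algebra_simps)
    then have "g ?p (R ?p t v w) z = g ?p (Rv ?p t w) z - g ?p (Rv ?p t z) w"
      using R_canonical[OF p, of t w z] om_vert_sym[OF p, of _ t] by simp
    then show "g ?p (Rb k ?p t v w) z = g ?p 0 z"
      unfolding rt' using g_sym[OF p, of z w] g_sym[OF p, of v w] g_sym[OF p, of v z]
      by (simp add: Rb_def B_def g_simps[OF p] algebra_simps)
  qed
qed

subsection \<open>Brackets of nullity fields\<close>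

lemma dd_comp_fst:
  assumes "X differentiable (at (fst p))"
  shows "dd (\<lambda>q. X (fst q)) p \<xi> = dd X (fst p) (fst \<xi>)" "(\<lambda>q. X (fst q)) differentiable (at p)"
proof -
  have "((\<lambda>q. X (fst q)) has_derivative (\<lambda>\<xi>. dd X (fst p) (fst \<xi>))) (at p)"
    by (rule has_derivative_compose[OF bounded_linear.has_derivative[OF bounded_linear_fst has_derivative_ident]
        assms[unfolded frechet_derivative_works]])
  then show "dd (\<lambda>q. X (fst q)) p \<xi> = dd X (fst p) (fst \<xi>)" "(\<lambda>q. X (fst q)) differentiable (at p)"
    by (simp_all add: dd_eqI differentiableI)
qed

text \<open>Differentiating \<open>Rb(X,b) = 0\<close> horizontally, with \<open>b\<close> constant, moves the derivative from \<open>X\<close> to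
  \<open>Rb\<close>, so that the Bianchi identity can be applied to the bracket of two such fields.\<close>

lemma nullity_derivative:
  assumes p: "p \<in> Q" and X: "X differentiable (at (fst p))"
    and null: "\<And>q b w. q \<in> Q \<Longrightarrow> Rb k q (X (fst q)) b w = 0"
  shows "Rb k p (dd X (fst p) c) b w = - dd (\<lambda>q. Rb k q (X (fst p)) b w) p (H p c)"
proof -
  have "dd (\<lambda>q. Rb k q (X (fst q)) b w) p = dd (\<lambda>q. 0) p"
    by (rule frechet_derivative_cong_open[OF open_Q p null])
  moreover have "dd (\<lambda>q. Rb k q (X (fst q)) b w) p (H p c)
      = dd (\<lambda>q. Rb k q (X (fst p)) b w) p (H p c) + Rb k p (dd (\<lambda>q. X (fst q)) p (H p c)) b w"
    by (rule dd_linear_family[of Q p "\<lambda>q a. Rb k q a b w", OF open_Q p Rb_linear(1) smooth_Rb dd_comp_fst(2)[OF X]])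
  ultimately show ?thesis by (simp add: dd_comp_fst(1)[OF X] H_def add_eq_0_iff)
qed

lemma nullity_bracket:
  assumes p: "p \<in> Q" and X: "X differentiable (at (fst p))" and Y: "Y differentiable (at (fst p))"
    and nX: "\<And>q b w. q \<in> Q \<Longrightarrow> Rb k q (X (fst q)) b w = 0"
    and nY: "\<And>q b w. q \<in> Q \<Longrightarrow> Rb k q (Y (fst q)) b w = 0"
  defines "X0 \<equiv> X (fst p)" and "Y0 \<equiv> Y (fst p)"
  shows "Rb k p (dd Y (fst p) X0 - dd X (fst p) Y0) z w
    = - (P p z (Rv p X0 Y0) w + P p X0 (Rv p Y0 z) w + P p Y0 (Rv p z X0) w)"
proof -
  have n: "Rb k p X0 b w = 0" "Rb k p Y0 b w = 0" "Rb k p b X0 w = 0" "Rb k p b Y0 w = 0" for b w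
    using nX[OF p] nY[OF p] Rb_antisym[of k p b X0 w] Rb_antisym[of k p b Y0 w] by (simp_all add: X0_def Y0_def)
  have dX: "Rb k p (dd X (fst p) c) b w = - dd (\<lambda>q. Rb k q X0 b w) p (H p c)"
   and dY: "Rb k p (dd Y (fst p) c) b w = - dd (\<lambda>q. Rb k q Y0 b w) p (H p c)" for c b
    unfolding X0_def Y0_def by (rule nullity_derivative[OF p X nX] nullity_derivative[OF p Y nY]; assumption)+
  have G0: "Gm p a 0 = 0" for a using linear_0[OF Gm_linear(2)[OF p]] .
  have sw: "dd (\<lambda>q. Rb k q z X0 w) p \<xi> = - dd (\<lambda>q. Rb k q X0 z w) p \<xi>" for \<xi>
  proof -
    have "dd (\<lambda>q. Rb k q z X0 w) p \<xi> = dd (\<lambda>q. - Rb k q X0 z w) p \<xi>"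
      by (rule fun_cong[OF arg_cong[where f = "\<lambda>f. dd f p"]]) (rule ext, rule Rb_antisym)
    also have "\<dots> = - dd (\<lambda>q. Rb k q X0 z w) p \<xi>"
      by (rule dd_bounded_linear[OF bounded_linear_minus[OF bounded_linear_ident] smooth_on_differentiable[OF smooth_Rb p]])
    finally show ?thesis .
  qed
  have "dd (\<lambda>q. Rb k q X0 Y0 w) p (H p z) = 0" using dX[of z Y0] n by simp
  then have "dd (\<lambda>q. Rb k q Y0 z w) p (H p X0) - dd (\<lambda>q. Rb k q X0 z w) p (H p Y0)
     = P p z (Rv p X0 Y0) w + P p X0 (Rv p Y0 z) w + P p Y0 (Rv p z X0) w"
    using Rb_bianchi[OF p, of k Y0 z w X0] by (simp add: n G0 sw)
  moreover have "Rb k p (dd Y (fst p) X0 - dd X (fst p) Y0) z w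
      = Rb k p (dd Y (fst p) X0) z w - Rb k p (dd X (fst p) Y0) z w"
    by (rule linear_diff[OF Rb_linear(1)[OF p]])
  ultimately show ?thesis by (simp add: dX dY algebra_simps)
qed

text \<open>The hypotheses make \<open>v\<close> orthogonal to \<open>X x\<close> and \<open>Y x\<close>, so that the cyclic sum equal to
  \<open>Rb(T,b)\<close> reduces to \<open>g(b,v)\<close> times a factor independent of \<open>b\<close>. The factor is zero because
  \<open>Rb(T,v) = 0\<close> by \<open>Rb_canonical\<close>.\<close>

lemma nullity_involutive:
  assumes p: "(x, v) \<in> Q" and X: "X differentiable (at x)" and Y: "Y differentiable (at x)"
    and nX: "\<And>q b w. q \<in> Q \<Longrightarrow> Rb k q (X (fst q)) b w = 0"
    and nY: "\<And>q b w. q \<in> Q \<Longrightarrow> Rb k q (Y (fst q)) b w = 0"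
    and v: "v \<noteq> 0" "g (x, v) (X x) v = 0" "g (x, v) (Y x) v = 0"
  shows "Rb k (x, v) (dd Y x (X x) - dd X x (Y x)) z w = 0"
proof -
  define T where "T = dd Y x (X x) - dd X x (Y x)"
  have rX: "Rv q (X (fst q)) b = k *\<^sub>R (g q b (snd q) *\<^sub>R X (fst q) - g q (X (fst q)) (snd q) *\<^sub>R b)"
   and rY: "Rv q (Y (fst q)) b = k *\<^sub>R (g q b (snd q) *\<^sub>R Y (fst q) - g q (Y (fst q)) (snd q) *\<^sub>R b)" if "q \<in> Q" for q b
    using nX[OF that, of b "snd q"] nY[OF that, of b "snd q"] R_v[OF that] by (simp_all add: Rb_def B_def)
  have T: "Rb k q T b w = - (P q b (Rv q (X x) (Y x)) w + P q (X x) (Rv q (Y x) b) w + P q (Y x) (Rv q b (X x)) w)"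
    if "q \<in> Q" "fst q = x" for q b w
    using nullity_bracket[OF that(1), of X Y k b w] X Y nX nY that(2) unfolding T_def by simp
  have Plin: "P q a (r *\<^sub>R (s *\<^sub>R b - t *\<^sub>R c)) w = r *\<^sub>R (s *\<^sub>R P q a b w - t *\<^sub>R P q a c w)" if "q \<in> Q" for q a b c r s t w
    by (simp add: linear_cmul[OF P_linear(2)[OF that]] linear_diff[OF P_linear(2)[OF that]])
  have T': "Rb k q T b w = - (k *\<^sub>R (
        g q (Y x) (snd q) *\<^sub>R (P q b (X x) w - P q (X x) b w)
      + g q (X x) (snd q) *\<^sub>R (P q (Y x) b w - P q b (Y x) w)
      + g q b (snd q) *\<^sub>R (P q (X x) (Y x) w - P q (Y x) (X x) w)))"
    if q: "q \<in> Q" "fst q = x" for q b w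
  proof -
    have a: "Rv q b (X x) = k *\<^sub>R (g q (X x) (snd q) *\<^sub>R b - g q b (snd q) *\<^sub>R X x)"
      using rX[OF q(1), of b] Rv_antisym[of q b "X x"] q(2) by (simp add: algebra_simps)
    have b: "Rv q (X x) (Y x) = k *\<^sub>R (g q (Y x) (snd q) *\<^sub>R X x - g q (X x) (snd q) *\<^sub>R Y x)"
      "Rv q (Y x) b = k *\<^sub>R (g q b (snd q) *\<^sub>R Y x - g q (Y x) (snd q) *\<^sub>R b)"
      using rX[OF q(1), of "Y x"] rY[OF q(1), of b] q(2) by simp_all
    show ?thesis unfolding T[OF q] a b Plin[OF q(1)] by (simp add: algebra_simps)
  qed
  have "Rb k (x, u) T b u = 0" if "(x, u) \<in> Q" for u b
    using T'[OF that, of b u] P_v_sym[OF that] by simp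
  from Rb_canonical[OF p this] have "Rb k (x, v) T v w = 0" .
  with T'[OF p, of v w] v have "k *\<^sub>R (g (x, v) v v *\<^sub>R (P (x, v) (X x) (Y x) w - P (x, v) (Y x) (X x) w)) = 0"
    by simp
  moreover have "g (x, v) v v \<noteq> 0" using g_pos[OF p v(1)] by simp
  ultimately have "k *\<^sub>R (P (x, v) (X x) (Y x) w - P (x, v) (Y x) (X x) w) = 0" by auto
  then have "k *\<^sub>R (g (x, v) z v *\<^sub>R (P (x, v) (X x) (Y x) w - P (x, v) (Y x) (X x) w)) = 0" by auto
  then show ?thesis using T'[OF p, of z w] v by (simp add: T_def[symmetric])
qed

end

section \<open>Smooth atlases\<close>

locale smooth_atlas =
  fixes A :: "('m, 'e::euclidean_space) chart set"
  assumes chart_inj: "c \<in> A \<Longrightarrow> inj_on (snd c) (fst c)"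
    and open_overlap: "c \<in> A \<Longrightarrow> c' \<in> A \<Longrightarrow> open (snd c ` (fst c \<inter> fst c'))"
    and smooth_transition: "c \<in> A \<Longrightarrow> c' \<in> A \<Longrightarrow> smooth_on (snd c ` (fst c \<inter> fst c')) (transition c c')"
begin

lemma open_chart: "c \<in> A \<Longrightarrow> open (snd c ` fst c)"
  using open_overlap[of c c] by simp

lemma chart_inv_coord: "c \<in> A \<Longrightarrow> x \<in> fst c \<Longrightarrow> chart_inv c (snd c x) = x"
  unfolding chart_inv_def by (simp add: chart_inj)

lemma chart_inv_mem: "c \<in> A \<Longrightarrow> u \<in> snd c ` fst c \<Longrightarrow> chart_inv c u \<in> fst c"
  and coord_chart_inv: "c \<in> A \<Longrightarrow> u \<in> snd c ` fst c \<Longrightarrow> snd c (chart_inv c u) = u"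
  by (auto simp: chart_inv_coord)

lemma image_chart_inv: assumes "c \<in> A" "P \<subseteq> snd c ` fst c" shows "snd c ` chart_inv c ` P = P"
proof -
  have "snd c (chart_inv c u) = u" if "u \<in> P" for u
    using coord_chart_inv[OF assms(1)] assms(2) that by blast
  then show ?thesis by (simp add: image_image cong: image_cong)
qed

lemma transition_coord: "c \<in> A \<Longrightarrow> x \<in> fst c \<Longrightarrow> transition c c' (snd c x) = snd c' x"
  by (simp add: transition_def chart_inv_coord)

lemma transition_overlap:
  assumes "c \<in> A" "c' \<in> A" "u \<in> snd c ` (fst c \<inter> fst c')"
  shows "transition c c' u \<in> snd c' ` (fst c' \<inter> fst c)" "chart_inv c' (transition c c' u) = chart_inv c u"
    "transition c' c (transition c c' u) = u" "chart_inv c u \<in> fst c \<inter> fst c'"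
    "transition c c' u \<in> snd c' ` fst c'"
  using assms by (auto simp: transition_coord chart_inv_coord)

lemma carrier_charts: "x \<in> carrier_of A \<longleftrightarrow> charts_at A x \<noteq> {}"
  unfolding carrier_of_def charts_at_def by blast

lemma some_chart: "c \<in> charts_at A x \<Longrightarrow> some_chart A x \<in> charts_at A x"
  unfolding some_chart_def by (rule someI)

lemma charts_atD: "c \<in> charts_at A x \<Longrightarrow> c \<in> A" "c \<in> charts_at A x \<Longrightarrow> x \<in> fst c"
  by (auto simp: charts_at_def)

lemma transition_differentiable:
  "c \<in> charts_at A x \<Longrightarrow> c' \<in> charts_at A x \<Longrightarrow> transition c c' differentiable (at (snd c x))"
  by (rule smooth_on_differentiable[OF smooth_transition]) (auto simp: charts_at_def)

abbreviation jac :: "('m, 'e) chart \<Rightarrow> ('m, 'e) chart \<Rightarrow> 'm \<Rightarrow> 'e \<Rightarrow> 'e"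
  where "jac c c' x \<equiv> dd (transition c c') (snd c x)"

lemma jac_linear: "c \<in> charts_at A x \<Longrightarrow> c' \<in> charts_at A x \<Longrightarrow> linear (jac c c' x)"
  by (rule linear_frechet_derivative[OF transition_differentiable])

lemma jac_refl: assumes "c \<in> charts_at A x" shows "jac c c x w = w"
proof -
  note c = charts_atD[OF assms]
  have "dd (transition c c) (snd c x) = dd (\<lambda>u. u) (snd c x)"
    by (rule frechet_derivative_cong_open[OF open_chart[OF c(1)]]) (use c in \<open>auto simp: transition_coord\<close>)
  then show ?thesis by simp
qed

lemma overlap3: assumes "c \<in> A" "c' \<in> A" "c'' \<in> A" shows "open (snd c ` (fst c \<inter> fst c' \<inter> fst c''))"
proof -
  have "snd c ` (fst c \<inter> fst c' \<inter> fst c'') = snd c ` (fst c \<inter> fst c') \<inter> snd c ` (fst c \<inter> fst c'')"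
    using chart_inj[OF assms(1)] by (auto simp: inj_on_def)
  then show ?thesis using open_overlap assms by (metis open_Int)
qed

lemma jac_comp:
  assumes "c \<in> charts_at A x" "c' \<in> charts_at A x" "c'' \<in> charts_at A x"
  shows "jac c' c'' x (jac c c' x w) = jac c c'' x w"
proof -
  note c = charts_atD[OF assms(1)] and c' = charts_atD[OF assms(2)] and c'' = charts_atD[OF assms(3)]
  have e: "dd (transition c c'') (snd c x) = dd (\<lambda>u. transition c' c'' (transition c c' u)) (snd c x)"
    by (rule frechet_derivative_cong_open[OF overlap3[OF c(1) c'(1) c''(1)]])
      (use c c' c'' in \<open>auto simp: transition_coord\<close>)
  have "dd (\<lambda>u. transition c' c'' (transition c c' u)) (snd c x) w
      = dd (transition c' c'') (transition c c' (snd c x)) (jac c c' x w)"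
    by (rule dd_compose[OF transition_differentiable[OF assms(1,2)]])
      (use transition_differentiable[OF assms(2,3)] c in \<open>simp add: transition_coord\<close>)
  then show ?thesis using c by (simp add: transition_coord e)
qed

subsection \<open>Tangent vectors\<close>

definition push :: "('m, 'e) chart \<Rightarrow> 'm \<Rightarrow> 'e \<Rightarrow> ('m, 'e) tvec"
  where "push c x w = (\<lambda>c'. if c' \<in> charts_at A x then jac c c' x w else 0)"

lemma push_tangent: "c \<in> charts_at A x \<Longrightarrow> push c x w \<in> tangent_space A x"
  unfolding tangent_space_def push_def by (auto simp: jac_comp)

lemma push_coord: "c \<in> charts_at A x \<Longrightarrow> push c x w c = w"
  by (simp add: push_def jac_refl)

lemma tangent_coord:
  "v \<in> tangent_space A x \<Longrightarrow> c \<in> charts_at A x \<Longrightarrow> c' \<in> charts_at A x \<Longrightarrow> v c' = jac c c' x (v c)"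
  unfolding tangent_space_def by blast

lemma tangent_outside: "v \<in> tangent_space A x \<Longrightarrow> c \<notin> charts_at A x \<Longrightarrow> v c = 0"
  unfolding tangent_space_def by blast

lemma tangent_eqI:
  assumes "v \<in> tangent_space A x" "v' \<in> tangent_space A x" "c \<in> charts_at A x" "v c = v' c"
  shows "v = v'"
proof
  fix c'
  show "v c' = v' c'"
  proof (cases "c' \<in> charts_at A x")
    case True
    show ?thesis
      unfolding tangent_coord[OF assms(1,3) True] tangent_coord[OF assms(2,3) True] assms(4) ..
  next
    case False
    then show ?thesis using tangent_outside[OF assms(1)] tangent_outside[OF assms(2)] by simp
  qed
qed

lemma push_coords: "v \<in> tangent_space A x \<Longrightarrow> c \<in> charts_at A x \<Longrightarrow> push c x (v c) = v"
  by (rule tangent_eqI) (auto simp: push_tangent push_coord)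

lemma tangent_subspace: "subspace (tangent_space A x)"
proof (rule subspaceI)
  show "0 \<in> tangent_space A x"
    using linear_0[OF jac_linear] by (auto simp: tangent_space_def)
  fix v w assume v: "v \<in> tangent_space A x" and w: "w \<in> tangent_space A x"
  show "v + w \<in> tangent_space A x"
    unfolding tangent_space_def
  proof (intro CollectI conjI allI ballI impI)
    show "(v + w) c = 0" if "c \<notin> charts_at A x" for c
      using tangent_outside[OF v that] tangent_outside[OF w that] by simp
    show "(v + w) c' = jac c c' x ((v + w) c)" if "c \<in> charts_at A x" "c' \<in> charts_at A x" for c c'
      unfolding plus_fun_apply tangent_coord[OF v that] tangent_coord[OF w that]
      by (rule linear_add[OF jac_linear[OF that], symmetric])
  qed
next
  fix v r assume v: "v \<in> tangent_space A x"
  show "r *\<^sub>R v \<in> tangent_space A x"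
    unfolding tangent_space_def
  proof (intro CollectI conjI allI ballI impI)
    show "(r *\<^sub>R v) c = 0" if "c \<notin> charts_at A x" for c
      using tangent_outside[OF v that] by (simp add: scaleR_fun_def)
    show "(r *\<^sub>R v) c' = jac c c' x ((r *\<^sub>R v) c)" if "c \<in> charts_at A x" "c' \<in> charts_at A x" for c c'
      unfolding scaleR_fun_def tangent_coord[OF v that]
      by (rule linear_cmul[OF jac_linear[OF that], symmetric])
  qed
qed

lemma push_linear: assumes "c \<in> charts_at A x" shows "linear (push c x)"
proof (rule linearI)
  show "push c x (a + b) = push c x a + push c x b" for a b
    using linear_add[OF jac_linear[OF assms]] by (auto simp: push_def fun_eq_iff)
  show "push c x (r *\<^sub>R a) = r *\<^sub>R push c x a" for r a
    using linear_cmul[OF jac_linear[OF assms]] by (auto simp: push_def fun_eq_iff scaleR_fun_def)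
qed

subsection \<open>Coordinate expressions\<close>

lemma dd_change_chart:
  fixes f :: "'m \<Rightarrow> 'b::real_normed_vector"
  assumes c: "c \<in> charts_at A x" and c': "c' \<in> charts_at A x"
    and d: "(\<lambda>u. f (chart_inv c u)) differentiable (at (snd c x))"
  shows "dd (\<lambda>u. f (chart_inv c' u)) (snd c' x) w = dd (\<lambda>u. f (chart_inv c u)) (snd c x) (jac c' c x w)"
proof -
  note m = charts_atD[OF c] and m' = charts_atD[OF c']
  have e: "dd (\<lambda>u. f (chart_inv c' u)) (snd c' x) = dd (\<lambda>u. f (chart_inv c (transition c' c u))) (snd c' x)"
    by (rule frechet_derivative_cong_open[OF open_overlap[OF m'(1) m(1)]])
      (use m m' transition_overlap(2)[OF m'(1) m(1)] in auto)
  have "dd (\<lambda>u. f (chart_inv c (transition c' c u))) (snd c' x) w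
      = dd (\<lambda>u. f (chart_inv c u)) (transition c' c (snd c' x)) (jac c' c x w)"
    by (rule dd_compose[OF transition_differentiable[OF c' c]]) (use d m' in \<open>simp add: transition_coord\<close>)
  then show ?thesis using m' by (simp add: transition_coord e)
qed

lemma deriv_along_coord:
  assumes c: "c \<in> charts_at A x" and \<xi>: "\<xi> \<in> tangent_space A x"
    and d: "(\<lambda>u. f (chart_inv c u)) differentiable (at (snd c x))"
  shows "deriv_along A x \<xi> f = dd (\<lambda>u. f (chart_inv c u)) (snd c x) (\<xi> c)"
  unfolding deriv_along_def Let_def o_def
  using dd_change_chart[OF c some_chart[OF c] d] tangent_coord[OF \<xi> some_chart[OF c] c] by simp

definition open_subset :: "'m set \<Rightarrow> bool"
  where "open_subset V \<longleftrightarrow> (\<forall>c\<in>A. open (snd c ` (fst c \<inter> V)))"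

lemma open_subset_carrier: "open_subset (carrier_of A)"
  unfolding open_subset_def
proof
  fix c assume c: "c \<in> A"
  then have "fst c \<inter> carrier_of A = fst c" by (auto simp: carrier_of_def)
  then show "open (snd c ` (fst c \<inter> carrier_of A))" using open_chart[OF c] by simp
qed

lemma open_overlap_subset:
  assumes "c \<in> A" "c' \<in> A" "open_subset V" shows "open (snd c ` (fst c \<inter> fst c' \<inter> V))"
proof -
  have "snd c ` (fst c \<inter> fst c' \<inter> V) = snd c ` (fst c \<inter> fst c') \<inter> snd c ` (fst c \<inter> V)"
    using chart_inj[OF assms(1)] by (auto simp: inj_on_def)
  then show ?thesis using open_overlap assms by (metis open_Int open_subset_def)
qed

lemma field_smooth: "vector_field_on A V X \<Longrightarrow> c \<in> A \<Longrightarrow> smooth_on (snd c ` (fst c \<inter> V)) (\<lambda>u. X (chart_inv c u) c)"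
  by (simp add: vector_field_on_def)

text \<open>In \<open>d(J X)(J w)\<close> the derivative of the Jacobian \<open>J\<close> contributes a term that is symmetric in \<open>X\<close> and
  \<open>w\<close>. It cancels in a Lie bracket, which therefore is a tangent vector.\<close>

lemma dd_field_transform:
  assumes V: "open_subset V" "x \<in> V" and X: "vector_field_on A V X"
    and c: "c \<in> charts_at A x" and c': "c' \<in> charts_at A x"
  shows "dd (\<lambda>u. X (chart_inv c' u) c') (snd c' x) (jac c c' x w)
    = dd (\<lambda>u. dd (transition c c') u (X x c)) (snd c x) w + jac c c' x (dd (\<lambda>u. X (chart_inv c u) c) (snd c x) w)"
proof -
  note m = charts_atD[OF c] and m' = charts_atD[OF c']
  let ?O = "snd c ` (fst c \<inter> fst c' \<inter> V)"
  have O: "open ?O" "snd c x \<in> ?O" using open_overlap_subset[OF m(1) m'(1) V(1)] m m' V by auto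
  have sub: "?O \<subseteq> snd c ` (fst c \<inter> fst c')" "?O \<subseteq> snd c ` (fst c \<inter> V)" by auto
  note st = smooth_on_subset[OF smooth_transition[OF m(1) m'(1)] sub(1)]
  have dX: "(\<lambda>u. X (chart_inv c u) c) differentiable (at (snd c x))"
    by (rule smooth_on_differentiable[OF smooth_on_subset[OF field_smooth[OF X m(1)] sub(2)] O(2)])
  have dX': "(\<lambda>u. X (chart_inv c' u) c') differentiable (at (transition c c' (snd c x)))"
    by (rule smooth_on_differentiable[OF field_smooth[OF X m'(1)]]) (use m m' V in \<open>auto simp: transition_coord\<close>)
  have "dd (\<lambda>u. X (chart_inv c' (transition c c' u)) c') (snd c x) = dd (\<lambda>u. dd (transition c c') u (X (chart_inv c u) c)) (snd c x)"
  proof (rule frechet_derivative_cong_open[OF O])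
    fix u assume "u \<in> ?O"
    then obtain y where y: "y \<in> fst c" "y \<in> fst c'" "y \<in> V" "u = snd c y" by auto
    then have "X y \<in> tangent_space A y" using X by (auto simp: vector_field_on_def)
    from tangent_coord[OF this, of c c'] y m m'
    show "X (chart_inv c' (transition c c' u)) c' = dd (transition c c') u (X (chart_inv c u) c)"
      by (simp add: transition_coord chart_inv_coord charts_at_def)
  qed
  moreover have "dd (\<lambda>u. X (chart_inv c' (transition c c' u)) c') (snd c x) w
      = dd (\<lambda>u. X (chart_inv c' u) c') (transition c c' (snd c x)) (jac c c' x w)"
    by (rule dd_compose[OF transition_differentiable[OF c c'] dX'])
  moreover have "dd (\<lambda>u. dd (transition c c') u (X (chart_inv c u) c)) (snd c x) w
      = dd (\<lambda>u. dd (transition c c') u (X (chart_inv c (snd c x)) c)) (snd c x) w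
        + dd (transition c c') (snd c x) (dd (\<lambda>u. X (chart_inv c u) c) (snd c x) w)"
    by (rule dd_linear_family[of ?O "snd c x" "\<lambda>u. dd (transition c c') u", OF O smooth_on_linear_dd[OF st]
          smooth_on_dd_const[OF O(1) st] dX])
  ultimately show ?thesis using m by (simp add: transition_coord chart_inv_coord)
qed

lemma lie_bracket_tangent:
  assumes V: "open_subset V" "x \<in> V" and X: "vector_field_on A V X" and Y: "vector_field_on A V Y"
  shows "lie_bracket A X Y x \<in> tangent_space A x"
  unfolding tangent_space_def
proof (intro CollectI conjI allI ballI impI)
  show "lie_bracket A X Y x c = 0" if "c \<notin> charts_at A x" for c using that by (simp add: lie_bracket_def)
  fix c c' assume c: "c \<in> charts_at A x" and c': "c' \<in> charts_at A x"
  note m = charts_atD[OF c] and m' = charts_atD[OF c']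
  have tX: "X x c' = jac c c' x (X x c)" and tY: "Y x c' = jac c c' x (Y x c)"
    using X Y V(2) tangent_coord[OF _ c c'] unfolding vector_field_on_def by blast+
  have com: "dd (\<lambda>u. dd (transition c c') u a) (snd c x) b = dd (\<lambda>u. dd (transition c c') u b) (snd c x) a" for a b
    by (rule dd_dd_commute[OF open_overlap[OF m(1) m'(1)] _ smooth_transition[OF m(1) m'(1)]]) (use m m' in auto)
  show "lie_bracket A X Y x c' = jac c c' x (lie_bracket A X Y x c)"
    using com[of "X x c" "Y x c"] c c'
    by (simp add: lie_bracket_def tX tY dd_field_transform[OF V X c c'] dd_field_transform[OF V Y c c']
        linear_diff[OF jac_linear[OF c c']])
qed

text \<open>It suffices to know a field near each point in one chart: the other charts are reached by smooth
  transition maps and Jacobians.\<close>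

lemma vector_field_localI:
  assumes T: "\<And>x. x \<in> V \<Longrightarrow> X x \<in> tangent_space A x" "\<And>x. x \<notin> V \<Longrightarrow> X x = 0"
    and loc: "\<And>x. x \<in> V \<Longrightarrow> \<exists>c\<in>charts_at A x. \<exists>W. open W \<and> snd c x \<in> W \<and> W \<subseteq> snd c ` (fst c \<inter> V) \<and>
        smooth_on W (\<lambda>u. X (chart_inv c u) c)"
  shows "vector_field_on A V X"
  unfolding vector_field_on_def
proof (intro conjI ballI allI impI)
  fix c' assume c': "c' \<in> A"
  show "smooth_on (snd c' ` (fst c' \<inter> V)) (\<lambda>u. X (chart_inv c' u) c')"
  proof (rule smooth_on_local)
    fix u assume "u \<in> snd c' ` (fst c' \<inter> V)"
    then obtain x where x: "x \<in> fst c'" "x \<in> V" "u = snd c' x" by auto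
    obtain c W where c: "c \<in> charts_at A x" and W: "open W" "snd c x \<in> W" "W \<subseteq> snd c ` (fst c \<inter> V)"
      "smooth_on W (\<lambda>u. X (chart_inv c u) c)"
      using loc[OF x(2)] by blast
    note m = charts_atD[OF c]
    let ?D = "snd c' ` (fst c' \<inter> fst c)"
    let ?E = "snd c ` (fst c \<inter> fst c')"
    define T where "T = ?D \<inter> transition c' c -` (W \<inter> ?E)"
    have oD: "open ?D" and oE: "open ?E" by (rule open_overlap[OF c' m(1)] open_overlap[OF m(1) c'])+
    have "continuous_on ?D (transition c' c)"
      by (rule smooth_on_imp_continuous[OF smooth_transition[OF c' m(1)]])
    then have oT: "open T" unfolding T_def
      by (rule continuous_open_preimage[OF _ oD open_Int[OF W(1) oE]])
    have uT: "u \<in> T" using x m W(2) c' by (auto simp: T_def transition_coord)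
    have TD: "T \<subseteq> ?D" by (auto simp: T_def)
    have sd: "smooth_on (W \<inter> ?E) (\<lambda>y. dd (transition c c') y (X (chart_inv c y) c))"
      by (rule smooth_on_linear_family[of "W \<inter> ?E" "\<lambda>y. dd (transition c c') y", OF open_Int[OF W(1) oE] _ _
            smooth_on_subset[OF W(4)]])
        (auto intro!: smooth_on_linear_dd[OF smooth_transition[OF m(1) c']]
          smooth_on_subset[OF smooth_on_dd_const[OF oE smooth_transition[OF m(1) c']]])
    have "smooth_on T (\<lambda>u. dd (transition c c') (transition c' c u) (X (chart_inv c (transition c' c u)) c))"
      by (rule smooth_on_compose[OF oT open_Int[OF W(1) oE] _ smooth_on_subset[OF smooth_transition[OF c' m(1)] TD] sd])
        (auto simp: T_def)
    then have "smooth_on T (\<lambda>u. X (chart_inv c' u) c')"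
    proof (rule smooth_on_cong[OF oT, rotated])
      fix u assume "u \<in> T"
      then obtain y where y: "y \<in> fst c'" "y \<in> fst c" "u = snd c' y" "snd c y \<in> W"
        using c' by (auto simp: T_def transition_coord)
      then have "y \<in> V" using W(3) chart_inj[OF m(1)] by (auto simp: inj_on_def)
      from tangent_coord[OF T(1)[OF this], of c c'] y c' m
      show "dd (transition c c') (transition c' c u) (X (chart_inv c (transition c' c u)) c) = X (chart_inv c' u) c'"
        by (simp add: transition_coord chart_inv_coord charts_at_def)
    qed
    then show "\<exists>T. open T \<and> u \<in> T \<and> smooth_on T (\<lambda>u. X (chart_inv c' u) c')" using oT uT by blast
  qed
qed (use T in auto)

subsection \<open>Cutoff functions\<close>

text \<open>The last condition says that the zero extension of \<open>h\<close> is smooth in every other chart. It is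
  stated in charts, without a topology, so that it makes sense for the slit tangent bundle as well.\<close>

definition cutoff :: "('m, 'e) chart \<Rightarrow> ('m \<Rightarrow> real) \<Rightarrow> bool"
  where "cutoff c h \<longleftrightarrow> c \<in> A \<and> (\<forall>x. x \<notin> fst c \<longrightarrow> h x = 0) \<and> smooth_on (snd c ` fst c) (\<lambda>u. h (chart_inv c u)) \<and>
    (\<forall>c'\<in>A. \<forall>x\<in>fst c'. x \<notin> fst c \<longrightarrow>
      (\<exists>W. open W \<and> snd c' x \<in> W \<and> W \<subseteq> snd c' ` fst c' \<and> (\<forall>u\<in>W. h (chart_inv c' u) = 0)))"

lemma cutoff_patch:
  assumes h: "cutoff c h" and c': "c' \<in> A"
    and G: "smooth_on (snd c' ` (fst c' \<inter> fst c)) G"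
    and G0: "\<And>u. u \<in> snd c' ` fst c' \<Longrightarrow> h (chart_inv c' u) = 0 \<Longrightarrow> G u = 0"
  shows "smooth_on (snd c' ` fst c') G"
proof (rule smooth_on_local)
  have cA: "c \<in> A" using h by (simp add: cutoff_def)
  fix u assume "u \<in> snd c' ` fst c'"
  then obtain x where x: "x \<in> fst c'" "u = snd c' x" by auto
  show "\<exists>T. open T \<and> u \<in> T \<and> smooth_on T G"
  proof (cases "x \<in> fst c")
    case True
    with x open_overlap[OF c' cA] G show ?thesis by blast
  next
    case False
    then obtain W where W: "open W" "snd c' x \<in> W" "W \<subseteq> snd c' ` fst c'" "\<forall>u\<in>W. h (chart_inv c' u) = 0"
      using h c' x(1) unfolding cutoff_def by blast
    have "0 = G u" if "u \<in> W" for u using that W(3,4) G0 by force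
    then have "smooth_on W G" by (rule smooth_on_cong[OF W(1) _ smooth_on_const])
    then show ?thesis using W x by blast
  qed
qed

lemma cutoff_smooth_pullback:
  assumes h: "cutoff c h" and c': "c' \<in> A"
  shows "smooth_on (snd c' ` (fst c' \<inter> fst c)) (\<lambda>u. h (chart_inv c' u))"
proof -
  have cA: "c \<in> A" and s: "smooth_on (snd c ` fst c) (\<lambda>u. h (chart_inv c u))" using h by (auto simp: cutoff_def)
  have "smooth_on (snd c' ` (fst c' \<inter> fst c)) (\<lambda>u. h (chart_inv c (transition c' c u)))"
    by (rule smooth_on_compose[OF open_overlap[OF c' cA] open_chart[OF cA] _ smooth_transition[OF c' cA] s])
      (use transition_overlap(5)[OF c' cA] in blast)
  then show ?thesis
    by (rule smooth_on_cong[OF open_overlap[OF c' cA], rotated]) (simp only: transition_overlap(2)[OF c' cA])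
qed

lemma cutoff_function:
  assumes h: "cutoff c h" and f: "smooth_on (snd c ` fst c) f"
  shows "smooth_function A (\<lambda>x. h x * f (snd c x))"
  unfolding smooth_function_def o_def
proof
  fix c' assume c': "c' \<in> A"
  have cA: "c \<in> A" using h by (simp add: cutoff_def)
  note o = open_overlap[OF c' cA]
  have "smooth_on (snd c' ` (fst c' \<inter> fst c)) (\<lambda>u. f (transition c' c u))"
    by (rule smooth_on_compose[OF o open_chart[OF cA] _ smooth_transition[OF c' cA] f])
      (use transition_overlap(5)[OF c' cA] in blast)
  then have "smooth_on (snd c' ` (fst c' \<inter> fst c)) (\<lambda>u. f (snd c (chart_inv c' u)))"
    by (simp add: transition_def)
  from smooth_on_mult[OF o cutoff_smooth_pullback[OF h c'] this]
  show "smooth_on (snd c' ` fst c') (\<lambda>u. h (chart_inv c' u) * f (snd c (chart_inv c' u)))"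
    by (rule cutoff_patch[OF h c']) simp
qed

lemma cutoff_field:
  assumes h: "cutoff c h" and w: "smooth_on (snd c ` fst c) w"
  shows "vector_field A (\<lambda>x. h x *\<^sub>R push c x (w (snd c x)))"
  unfolding vector_field_on_def
proof (intro conjI ballI allI impI)
  have cA: "c \<in> A" and h0: "\<And>x. x \<notin> fst c \<Longrightarrow> h x = 0" using h by (auto simp: cutoff_def)
  show "h x *\<^sub>R push c x (w (snd c x)) \<in> tangent_space A x" for x
  proof (cases "x \<in> fst c")
    case True
    then show ?thesis using cA by (intro subspace_scale[OF tangent_subspace] push_tangent) (simp add: charts_at_def)
  next
    case False
    then show ?thesis using subspace_0[OF tangent_subspace] by (simp add: h0)
  qed
  show "h x *\<^sub>R push c x (w (snd c x)) = 0" if "x \<notin> carrier_of A" for x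
    using that cA h0 by (auto simp: carrier_of_def)
  fix c' assume c': "c' \<in> A"
  note o = open_overlap[OF c' cA] and o' = open_overlap[OF cA c']
  have "smooth_on (snd c ` (fst c \<inter> fst c')) (\<lambda>y. dd (transition c c') y (w y))"
    by (rule smooth_on_dd[OF o' smooth_transition[OF cA c'] smooth_on_subset[OF w]]) auto
  then have "smooth_on (snd c' ` (fst c' \<inter> fst c)) (\<lambda>u. dd (transition c c') (transition c' c u) (w (transition c' c u)))"
    by (rule smooth_on_compose[OF o o' _ smooth_transition[OF c' cA], rotated])
      (use transition_overlap(1)[OF c' cA] in blast)
  then have s: "smooth_on (snd c' ` (fst c' \<inter> fst c)) (\<lambda>u. push c (chart_inv c' u) (w (snd c (chart_inv c' u))) c')"
    by (rule smooth_on_cong[OF o, rotated])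
      (use transition_overlap(4)[OF c' cA] c' in \<open>auto simp: push_def charts_at_def transition_def\<close>)
  have "smooth_on (snd c' ` fst c') (\<lambda>u. h (chart_inv c' u) *\<^sub>R push c (chart_inv c' u) (w (snd c (chart_inv c' u))) c')"
    by (rule cutoff_patch[OF h c' smooth_on_scaleR[OF o cutoff_smooth_pullback[OF h c'] s]]) simp
  moreover have "fst c' \<inter> carrier_of A = fst c'" using c' by (auto simp: carrier_of_def)
  ultimately show "smooth_on (snd c' ` (fst c' \<inter> carrier_of A)) (\<lambda>u. (h (chart_inv c' u) *\<^sub>R push c (chart_inv c' u) (w (snd c (chart_inv c' u)))) c')"
    by (simp add: scaleR_fun_def)
qed

end

subsection \<open>Manifolds\<close>

lemma manifold_chart_open:
  assumes M: "smooth_manifold M A" and c: "c \<in> A" and V: "openin M V"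
  shows "open (snd c ` (fst c \<inter> V))"
proof -
  have o: "openin M (fst c)" "open (snd c ` fst c)"
    and h: "homeomorphic_map (subtopology M (fst c)) (top_of_set (snd c ` fst c)) (snd c)"
    using M c by (auto simp: smooth_manifold_def)
  have t: "topspace (subtopology M (fst c)) = fst c"
    using openin_subset[OF o(1)] by (auto simp: topspace_subtopology)
  have "openin (subtopology M (fst c)) (fst c \<inter> V)" using V by (rule openin_subtopology_Int2)
  then have "openin (top_of_set (snd c ` fst c)) (snd c ` (fst c \<inter> V))"
    using homeomorphic_map_openness[OF h, of "fst c \<inter> V"] t by blast
  then show ?thesis using o(2) openin_open_trans by blast
qed

lemma manifold_smooth_atlas:
  assumes M: "smooth_manifold M A" shows "smooth_atlas A"
proof
  fix c c' assume c: "c \<in> A" and c': "c' \<in> A"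
  have o: "openin M (fst c')" using M c' by (auto simp: smooth_manifold_def)
  show "open (snd c ` (fst c \<inter> fst c'))" by (rule manifold_chart_open[OF M c o])
  show "smooth_on (snd c ` (fst c \<inter> fst c')) (transition c c')" using M c c' by (auto simp: smooth_manifold_def)
next
  fix c assume c: "c \<in> A"
  have o: "openin M (fst c)"
    and h: "homeomorphic_map (subtopology M (fst c)) (top_of_set (snd c ` fst c)) (snd c)"
    using M c by (auto simp: smooth_manifold_def)
  have "topspace (subtopology M (fst c)) = fst c"
    using openin_subset[OF o] by (auto simp: topspace_subtopology)
  then show "inj_on (snd c) (fst c)" using homeomorphic_imp_injective_map[OF h] by simp
qed

lemma manifold_chart_inv_open:
  assumes M: "smooth_manifold M A" and c: "c \<in> A" and P: "open P" "P \<subseteq> snd c ` fst c"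
  shows "openin M (chart_inv c ` P)"
proof -
  interpret smooth_atlas A by (rule manifold_smooth_atlas[OF M])
  have o: "openin M (fst c)"
    and h: "homeomorphic_map (subtopology M (fst c)) (top_of_set (snd c ` fst c)) (snd c)"
    using M c by (auto simp: smooth_manifold_def)
  have t: "topspace (subtopology M (fst c)) = fst c"
    using openin_subset[OF o] by (auto simp: topspace_subtopology)
  have sub: "chart_inv c ` P \<subseteq> fst c" using P(2) chart_inv_mem[OF c] by auto
  have "snd c ` chart_inv c ` P = P" by (rule image_chart_inv[OF c P(2)])
  then have "openin (top_of_set (snd c ` fst c)) (snd c ` chart_inv c ` P)"
    using open_subset[OF P(2) P(1)] by simp
  then have "openin (subtopology M (fst c)) (chart_inv c ` P)"
    using homeomorphic_map_openness[OF h, of "chart_inv c ` P"] t sub by blast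
  then show ?thesis using o openin_trans_full by blast
qed

text \<open>The support of the bump function is compact in the chart, hence compact and, by the Hausdorff
  property, closed in the manifold. This is where the Hausdorff property enters.\<close>

lemma cutoff_exists:
  assumes M: "smooth_manifold M A" and c: "c \<in> A" and x: "x \<in> fst c"
  shows "\<exists>h P. smooth_atlas.cutoff A c h \<and> open P \<and> snd c x \<in> P \<and> P \<subseteq> snd c ` fst c \<and> (\<forall>u\<in>P. h (chart_inv c u) = 1)"
proof -
  interpret smooth_atlas A by (rule manifold_smooth_atlas[OF M])
  have o: "openin M (fst c)" "open (snd c ` fst c)" and Haus: "Hausdorff_space M"
    and hm: "homeomorphic_map (subtopology M (fst c)) (top_of_set (snd c ` fst c)) (snd c)"
    using M c by (auto simp: smooth_manifold_def)
  have t: "topspace (subtopology M (fst c)) = fst c"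
    using openin_subset[OF o(1)] by (auto simp: topspace_subtopology)
  obtain e where e: "0 < e" "cball (snd c x) e \<subseteq> snd c ` fst c"
    using o(2) x open_contains_cball by blast
  obtain b :: "'b \<Rightarrow> real" where b: "smooth_on UNIV b" "\<And>u. u \<in> ball (snd c x) (e / 2) \<Longrightarrow> b u = 1"
    "\<And>u. u \<notin> cball (snd c x) (2 * (e / 2)) \<Longrightarrow> b u = 0"
    using bump_function[of "e / 2" "snd c x"] e(1) by (metis half_gt_zero)
  define h where "h = (\<lambda>y. if y \<in> fst c then b (snd c y) else 0)"
  define K where "K = chart_inv c ` cball (snd c x) e"
  have Ksub: "K \<subseteq> fst c" using e(2) chart_inv_mem[OF c] by (auto simp: K_def)
  have "snd c ` K = cball (snd c x) e" unfolding K_def by (rule image_chart_inv[OF c e(2)])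
  moreover have "compactin (top_of_set (snd c ` fst c)) (cball (snd c x) e)"
    using e(2) by (simp add: compactin_subtopology)
  ultimately have "compactin (top_of_set (snd c ` fst c)) (snd c ` K)" by simp
  then have "compactin (subtopology M (fst c)) K"
    using homeomorphic_map_compactness[OF hm, of K] t Ksub by blast
  then have "compactin M K" using compactin_subtopology by blast
  then have clK: "closedin M K" by (rule compactin_imp_closedin[OF Haus])
  have h0: "h y = 0" if "y \<notin> K" for y
  proof (cases "y \<in> fst c")
    case True
    then have "snd c y \<notin> cball (snd c x) e"
      using that chart_inv_coord[OF c True] unfolding K_def by (metis imageI)
    then show ?thesis using b(3)[of "snd c y"] by (simp add: h_def)
  qed (simp add: h_def)
  have "cutoff c h"
    unfolding cutoff_def
  proof (intro conjI allI impI ballI c)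
    show "h y = 0" if "y \<notin> fst c" for y using that by (simp add: h_def)
    show "smooth_on (snd c ` fst c) (\<lambda>u. h (chart_inv c u))"
      by (rule smooth_on_cong[OF o(2) _ smooth_on_subset[OF b(1)]])
        (auto simp: h_def chart_inv_coord[OF c])
    fix c' y assume c': "c' \<in> A" and y: "y \<in> fst c'" "y \<notin> fst c"
    have "openin M (topspace M - K)" using clK by (simp add: openin_diff)
    from manifold_chart_open[OF M c' this] have "open (snd c' ` (fst c' \<inter> (topspace M - K)))" .
    moreover have "openin M (fst c')" using M c' by (auto simp: smooth_manifold_def)
    then have "y \<in> topspace M" using y openin_subset by blast
    ultimately show "\<exists>W. open W \<and> snd c' y \<in> W \<and> W \<subseteq> snd c' ` fst c' \<and> (\<forall>u\<in>W. h (chart_inv c' u) = 0)"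
      using y Ksub by (intro exI[of _ "snd c' ` (fst c' \<inter> (topspace M - K))"]) (auto simp: chart_inv_coord[OF c'] h0)
  qed
  moreover have "h (chart_inv c u) = 1" if "u \<in> ball (snd c x) (e / 2)" for u
  proof -
    have "u \<in> snd c ` fst c" using that e by (auto simp: subset_iff)
    then show ?thesis using b(2)[OF that] chart_inv_mem[OF c] coord_chart_inv[OF c] by (simp add: h_def)
  qed
  moreover have "ball (snd c x) (e / 2) \<subseteq> snd c ` fst c"
  proof -
    have "ball (snd c x) (e / 2) \<subseteq> cball (snd c x) e" using e(1) by auto
    then show ?thesis using e(2) by blast
  qed
  ultimately show ?thesis using e(1)
    by (intro exI[of _ h] exI[of _ "ball (snd c x) (e / 2)"]) auto
qed

section \<open>The slit tangent bundle\<close>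

lemma slit_chart_simps:
  "fst (slit_chart A c) = {z \<in> TM0 A. fst z \<in> fst c}" "snd (slit_chart A c) z = (snd c (fst z), snd z c)"
  by (simp_all add: slit_chart_def)

lemma open_slit: "open W \<Longrightarrow> open (W \<times> (- {0::'e::euclidean_space}))"
  by (intro open_Times open_Compl closed_singleton)

context smooth_atlas
begin

abbreviation S :: "('m, 'e) chart \<Rightarrow> (('m, 'e) tpoint, 'e \<times> 'e) chart" where "S c \<equiv> slit_chart A c"

lemma TM0_iff: "(x, v) \<in> TM0 A \<longleftrightarrow> x \<in> carrier_of A \<and> v \<in> tangent_space A x \<and> v \<noteq> 0"
  by (simp add: TM0_def)

lemma TM0D: assumes "z \<in> TM0 A" shows "snd z \<in> tangent_space A (fst z)" "snd z \<noteq> 0" "fst z \<in> carrier_of A"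
  using assms TM0_iff[of "fst z" "snd z"] by auto

lemma tangent_zero: "0 \<in> tangent_space A x" by (rule subspace_0[OF tangent_subspace])

lemma TM0_coord_nonzero: assumes "z \<in> TM0 A" "c \<in> charts_at A (fst z)" shows "snd z c \<noteq> 0"
  using tangent_eqI[OF TM0D(1)[OF assms(1)] tangent_zero assms(2)] TM0D(2)[OF assms(1)] by auto

lemma push_nonzero: assumes "c \<in> charts_at A x" "v \<noteq> 0" shows "(x, push c x v) \<in> TM0 A"
proof -
  have "push c x v \<noteq> 0" using push_coord[OF assms(1), of v] assms(2) by auto
  then show ?thesis using push_tangent[OF assms(1)] assms(1) carrier_charts by (auto simp: TM0_iff)
qed

lemma slit_image:
  assumes c: "c \<in> A" and c': "c' \<in> A"
  shows "snd (S c) ` (fst (S c) \<inter> fst (S c')) = (snd c ` (fst c \<inter> fst c')) \<times> (- {0::'e})"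
proof (intro set_eqI iffI)
  fix p assume "p \<in> snd (S c) ` (fst (S c) \<inter> fst (S c'))"
  then obtain z where z: "z \<in> TM0 A" "fst z \<in> fst c" "fst z \<in> fst c'" "p = (snd c (fst z), snd z c)"
    by (auto simp: slit_chart_simps)
  then have "snd z c \<noteq> 0" using TM0_coord_nonzero[OF z(1), of c] c by (simp add: charts_at_def)
  then show "p \<in> (snd c ` (fst c \<inter> fst c')) \<times> (- {0})" using z by auto
next
  fix p :: "'e \<times> 'e" assume "p \<in> (snd c ` (fst c \<inter> fst c')) \<times> (- {0})"
  then have "fst p \<in> snd c ` (fst c \<inter> fst c')" "snd p \<noteq> 0" by auto
  then obtain x where x: "x \<in> fst c" "x \<in> fst c'" "fst p = snd c x" "snd p \<noteq> 0" by blast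
  then have cx: "c \<in> charts_at A x" using c by (simp add: charts_at_def)
  let ?z = "(x, push c x (snd p))"
  have "?z \<in> fst (S c) \<inter> fst (S c')" using push_nonzero[OF cx x(4)] x by (simp add: slit_chart_simps)
  moreover have "p = snd (S c) ?z" using x push_coord[OF cx] by (simp add: slit_chart_simps prod_eq_iff)
  ultimately show "p \<in> snd (S c) ` (fst (S c) \<inter> fst (S c'))" by blast
qed

lemma slit_image_self: "c \<in> A \<Longrightarrow> snd (S c) ` fst (S c) = (snd c ` fst c) \<times> (- {0})"
  using slit_image[of c c] by simp

lemma slit_inj: assumes c: "c \<in> A" shows "inj_on (snd (S c)) (fst (S c))"
proof (rule inj_onI)
  fix z w assume z: "z \<in> fst (S c)" and w: "w \<in> fst (S c)" and e: "snd (S c) z = snd (S c) w"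
  have f: "fst z = fst w" using chart_inj[OF c] z w e by (auto simp: slit_chart_simps inj_on_def)
  have cz: "c \<in> charts_at A (fst z)" using z c by (simp add: slit_chart_simps charts_at_def)
  have "snd z = snd w"
    by (rule tangent_eqI[OF TM0D(1) _ cz]) (use z w e f TM0D(1)[of w] in \<open>auto simp: slit_chart_simps\<close>)
  with f show "z = w" by (rule prod_eqI)
qed

lemma slit_chart_inv:
  assumes c: "c \<in> A" and u: "u \<in> snd c ` fst c" "v \<noteq> 0"
  shows "chart_inv (S c) (u, v) = (chart_inv c u, push c (chart_inv c u) v)"
proof -
  obtain x where x: "x \<in> fst c" "u = snd c x" using u by auto
  then have cx: "c \<in> charts_at A x" using c by (simp add: charts_at_def)
  let ?z = "(x, push c x v)"
  have "?z \<in> fst (S c)" using push_nonzero[OF cx u(2)] x by (simp add: slit_chart_simps)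
  moreover have "snd (S c) ?z = (u, v)" using x push_coord[OF cx] by (simp add: slit_chart_simps)
  ultimately have "chart_inv (S c) (u, v) = ?z"
    unfolding chart_inv_def using inv_into_f_f[OF slit_inj[OF c], of ?z] by simp
  then show ?thesis using x chart_inv_coord[OF c] by simp
qed

lemma slit_transition:
  assumes c: "c \<in> A" and c': "c' \<in> A" and q: "q \<in> (snd c ` (fst c \<inter> fst c')) \<times> (- {0})"
  shows "transition (S c) (S c') q = (transition c c' (fst q), dd (transition c c') (fst q) (snd q))"
proof -
  have "fst q \<in> snd c ` (fst c \<inter> fst c')" "snd q \<noteq> 0" using q by auto
  then obtain x where x: "x \<in> fst c" "x \<in> fst c'" "fst q = snd c x" "snd q \<noteq> 0" by blast
  have "chart_inv (S c) (snd c x, snd q) = (x, push c x (snd q))"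
    using slit_chart_inv[OF c, of "snd c x" "snd q"] x chart_inv_coord[OF c x(1)] by simp
  moreover have "(snd c x, snd q) = q" using x(3) by (simp add: prod_eq_iff)
  ultimately have "chart_inv (S c) q = (x, push c x (snd q))" by simp
  then show ?thesis using x c c'
    by (simp add: transition_def[of "S c"] slit_chart_simps transition_coord push_def charts_at_def)
qed

lemma smooth_slit_transition:
  assumes c: "c \<in> A" and c': "c' \<in> A"
  shows "smooth_on ((snd c ` (fst c \<inter> fst c')) \<times> (- {0})) (transition (S c) (S c'))"
proof -
  let ?O = "snd c ` (fst c \<inter> fst c')" and ?t = "transition c c'"
  let ?Q = "?O \<times> (- {0::'e})"
  have O: "open ?O" by (rule open_overlap[OF c c'])
  have Q: "open ?Q" using O by (simp add: open_slit)
  note st = smooth_transition[OF c c']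
  have f: "smooth_on ?Q (\<lambda>q. k (fst q))" if "smooth_on ?O k" for k :: "'e \<Rightarrow> 'e"
    by (rule smooth_on_compose[OF Q O _ smooth_fst[OF Q] that]) auto
  have "smooth_on ?Q (\<lambda>q. dd ?t (fst q) (snd q))"
    by (rule smooth_on_linear_family[of ?Q "\<lambda>q. dd ?t (fst q)", OF Q _ f[OF smooth_on_dd_const[OF O st]] smooth_snd[OF Q]])
      (rule smooth_on_linear_dd[OF st], auto)
  from smooth_on_Pair[OF Q f[OF st] this]
  show ?thesis by (rule smooth_on_cong[OF Q, rotated]) (rule slit_transition[OF c c', symmetric])
qed

lemma slit_smooth_atlas: "smooth_atlas (slit_atlas A)"
proof
  fix C C' assume "C \<in> slit_atlas A" "C' \<in> slit_atlas A"
  then obtain c c' where c: "c \<in> A" "C = S c" "c' \<in> A" "C' = S c'" by (auto simp: slit_atlas_def)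
  show "open (snd C ` (fst C \<inter> fst C'))"
    unfolding c slit_image[OF c(1,3)] by (simp add: open_slit open_overlap[OF c(1,3)])
  show "smooth_on (snd C ` (fst C \<inter> fst C')) (transition C C')"
    unfolding c slit_image[OF c(1,3)] by (rule smooth_slit_transition[OF c(1,3)])
next
  fix C assume "C \<in> slit_atlas A"
  then show "inj_on (snd C) (fst C)" using slit_inj by (auto simp: slit_atlas_def)
qed

end

text \<open>A locale of its own, because interpreting \<open>smooth_atlas\<close> within itself for the slit bundle would
  generate the infinite tower of iterated slit tangent bundles.\<close>

locale slit_bundle = smooth_atlas A for A :: "('m, 'e::euclidean_space) chart set"
begin

sublocale slit: smooth_atlas "slit_atlas A" by (rule slit_smooth_atlas)

lemma slit_chart_in: "c \<in> A \<Longrightarrow> S c \<in> slit_atlas A" by (simp add: slit_atlas_def)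

lemma slit_chartE: assumes "C \<in> slit_atlas A" obtains c where "c \<in> A" "C = S c"
  using assms by (auto simp: slit_atlas_def)

lemma slit_carrier: "carrier_of (slit_atlas A) = TM0 A"
proof (intro set_eqI iffI)
  show "z \<in> carrier_of (slit_atlas A)" if "z \<in> TM0 A" for z
    using TM0D(3)[OF that] that unfolding carrier_of_def slit_atlas_def by (auto simp: slit_chart_simps)
qed (auto simp: carrier_of_def slit_atlas_def slit_chart_simps)

lemma slit_charts_at: assumes "z \<in> TM0 A" shows "charts_at (slit_atlas A) z = S ` charts_at A (fst z)"
  using assms by (auto simp: charts_at_def slit_atlas_def slit_chart_simps)

lemma slit_charts_atI: "z \<in> TM0 A \<Longrightarrow> c \<in> charts_at A (fst z) \<Longrightarrow> S c \<in> charts_at (slit_atlas A) z"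
  by (simp add: slit_charts_at)

text \<open>The derivative of \<open>(x,v) \<mapsto> (\<phi> x, D\<phi>\<^sub>x v)\<close> is \<open>(a,b) \<mapsto> (D\<phi>\<^sub>x a, D\<^sup>2\<phi>\<^sub>x(a,v) + D\<phi>\<^sub>x b)\<close>. Its
  first component and its values on vertical vectors involve only the first derivative of \<open>\<phi>\<close>.\<close>

lemma dd_slit_transition_fst:
  assumes z: "z \<in> TM0 A" and c: "c \<in> charts_at A (fst z)" and c': "c' \<in> charts_at A (fst z)"
  shows "fst (slit.jac (S c) (S c') z \<xi>) = jac c c' (fst z) (fst \<xi>)"
    "slit.jac (S c) (S c') z (0, b) = (0, jac c c' (fst z) b)"
proof -
  note m = charts_atD[OF c] and m' = charts_atD[OF c']
  let ?Q = "(snd c ` (fst c \<inter> fst c')) \<times> (- {0::'e})" and ?p = "(snd c (fst z), snd z c)"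
  have Q: "open ?Q" by (simp add: open_slit open_overlap[OF m(1) m'(1)])
  have p: "?p \<in> ?Q" using m m' TM0_coord_nonzero[OF z c] by auto
  have "linear (\<lambda>\<xi>. slit.jac (S c) (S c') z \<xi>)" by (rule slit.jac_linear[OF slit_charts_atI[OF z c] slit_charts_atI[OF z c']])
  note sd = smooth_on_differentiable[OF smooth_slit_transition[OF m(1) m'(1)] p]
  note td = transition_differentiable[OF c c']
  have e1: "fst (dd (transition (S c) (S c')) ?p \<xi>) = dd (\<lambda>q. fst (transition (S c) (S c') q)) ?p \<xi>" for \<xi>
    by (rule dd_bounded_linear[OF bounded_linear_fst sd, symmetric])
  have e2: "dd (\<lambda>q. fst (transition (S c) (S c') q)) ?p = dd (\<lambda>q. transition c c' (fst q)) ?p"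
    by (rule frechet_derivative_cong_open[OF Q p]) (simp add: slit_transition[OF m(1) m'(1)])
  have e3: "dd (\<lambda>q. transition c c' (fst q)) ?p \<xi> = jac c c' (fst z) (fst \<xi>)" for \<xi>
  proof -
    have "(transition c c' has_derivative jac c c' (fst z)) (at (fst ?p))"
      using td[unfolded frechet_derivative_works] by simp
    from dd_eqI[OF has_derivative_compose[OF bounded_linear_imp_has_derivative[OF bounded_linear_fst] this]]
    show ?thesis by simp
  qed
  show "fst (slit.jac (S c) (S c') z \<xi>) = jac c c' (fst z) (fst \<xi>)"
    by (simp only: slit_chart_simps e1 e2 e3)
  have "dd (transition (S c) (S c')) ?p (0, b) = dd (\<lambda>v. transition (S c) (S c') (snd c (fst z), v)) (snd z c) b"
    by (rule dd_partial_snd(1)[OF sd, symmetric])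
  also have "dd (\<lambda>v. transition (S c) (S c') (snd c (fst z), v)) (snd z c)
      = dd (\<lambda>v. (transition c c' (snd c (fst z)), jac c c' (fst z) v)) (snd z c)"
    by (rule frechet_derivative_cong_open[of "- {0}"]) (use p in \<open>auto simp: slit_transition[OF m(1) m'(1)]\<close>)
  also have "\<dots> b = (0, jac c c' (fst z) b)"
  proof -
    have "((\<lambda>v. (transition c c' (snd c (fst z)), jac c c' (fst z) v)) has_derivative (\<lambda>b. (0, jac c c' (fst z) b))) (at (snd z c))"
      by (intro has_derivative_Pair has_derivative_const linear_imp_has_derivative jac_linear[OF c c'])
    from dd_eqI[OF this] show ?thesis by simp
  qed
  finally show "slit.jac (S c) (S c') z (0, b) = (0, jac c c' (fst z) b)" by (simp add: slit_chart_simps)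
qed

lemma rho_at_coord:
  assumes z: "z \<in> TM0 A" and c: "c \<in> charts_at A (fst z)" and \<xi>: "\<xi> \<in> tangent_space (slit_atlas A) z"
  shows "rho_at A z \<xi> = push c (fst z) (fst (\<xi> (S c)))"
proof -
  obtain c0 where c0: "c0 \<in> charts_at A (fst z)" "some_chart (slit_atlas A) z = S c0"
    using slit.some_chart[OF slit_charts_atI[OF z c]] slit_charts_at[OF z] by auto
  have e: "dd (snd c' \<circ> fst \<circ> chart_inv (S c0)) (snd (S c0) z) \<xi> = jac c0 c' (fst z) (fst \<xi>)"
    if c': "c' \<in> charts_at A (fst z)" for c' \<xi>
  proof -
    note m = charts_atD[OF c0(1)] and m' = charts_atD[OF c']
    let ?Q = "(snd c0 ` (fst c0 \<inter> fst c')) \<times> (- {0::'e})" and ?p = "(snd c0 (fst z), snd z c0)"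
    have Q: "open ?Q" by (simp add: open_slit open_overlap[OF m(1) m'(1)])
    have p: "?p \<in> ?Q" using m m' TM0_coord_nonzero[OF z c0(1)] by auto
    have "dd (snd c' \<circ> fst \<circ> chart_inv (S c0)) ?p = dd (\<lambda>q. fst (transition (S c0) (S c') q)) ?p"
      by (rule frechet_derivative_cong_open[OF Q p]) (simp add: transition_def slit_chart_simps)
    moreover have "dd (\<lambda>q. fst (transition (S c0) (S c') q)) ?p \<xi> = fst (dd (transition (S c0) (S c')) ?p \<xi>)"
      by (rule dd_bounded_linear[OF bounded_linear_fst smooth_on_differentiable[OF smooth_slit_transition[OF m(1) m'(1)] p]])
    ultimately show ?thesis using dd_slit_transition_fst(1)[OF z c0(1) c', of \<xi>] by (simp add: slit_chart_simps)
  qed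
  have "rho_at A z \<xi> = push c0 (fst z) (fst (\<xi> (S c0)))"
    unfolding rho_at_def differential_def Let_def c0(2) push_def by (rule ext) (simp add: e)
  moreover have "fst (\<xi> (S c)) = jac c0 c (fst z) (fst (\<xi> (S c0)))"
    using slit.tangent_coord[OF \<xi> slit_charts_atI[OF z c0(1)] slit_charts_atI[OF z c]]
      dd_slit_transition_fst(1)[OF z c0(1) c] by simp
  moreover have "push c (fst z) (jac c0 c (fst z) w) = push c0 (fst z) w" for w
    by (rule tangent_eqI[OF push_tangent[OF c] push_tangent[OF c0(1)] c])
      (simp add: push_coord[OF c] push_def c jac_refl[OF c])
  ultimately show ?thesis by simp
qed

text \<open>Cutting off in the base is enough, since a chart of the slit tangent bundle contains whole
  fibres.\<close>

lemma cutoff_slit: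
  assumes h: "cutoff c h"
  shows "slit.cutoff (S c) (\<lambda>z. if z \<in> TM0 A then h (fst z) else 0)" (is "slit.cutoff _ ?h")
proof -
  have c: "c \<in> A" and h0: "\<And>x. x \<notin> fst c \<Longrightarrow> h x = 0" and hs: "smooth_on (snd c ` fst c) (\<lambda>u. h (chart_inv c u))"
    and hl: "\<And>c' x. c' \<in> A \<Longrightarrow> x \<in> fst c' \<Longrightarrow> x \<notin> fst c \<Longrightarrow>
      \<exists>W. open W \<and> snd c' x \<in> W \<and> W \<subseteq> snd c' ` fst c' \<and> (\<forall>u\<in>W. h (chart_inv c' u) = 0)"
    using h by (auto simp: cutoff_def)
  have hinv: "?h (chart_inv (S c') q) = h (chart_inv c' (fst q))" if "c' \<in> A" "q \<in> (snd c' ` fst c') \<times> (- {0})" for c' q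
  proof -
    have q: "fst q \<in> snd c' ` fst c'" "snd q \<noteq> 0" using that by auto
    have "c' \<in> charts_at A (chart_inv c' (fst q))" using that(1) chart_inv_mem[OF that(1) q(1)] by (simp add: charts_at_def)
    from push_nonzero[OF this q(2)] slit_chart_inv[OF that(1) q] show ?thesis by simp
  qed
  show ?thesis unfolding slit.cutoff_def
  proof (intro conjI allI impI ballI)
    show "S c \<in> slit_atlas A" by (rule slit_chart_in[OF c])
    show "?h z = 0" if "z \<notin> fst (S c)" for z using that h0 by (auto simp: slit_chart_simps)
    show "smooth_on (snd (S c) ` fst (S c)) (\<lambda>q. ?h (chart_inv (S c) q))"
    proof -
      let ?Q = "(snd c ` fst c) \<times> (- {0::'e})"
      have Q: "open ?Q" by (simp add: open_slit open_chart[OF c])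
      have "smooth_on ?Q (\<lambda>q. h (chart_inv c (fst q)))"
        by (rule smooth_on_compose[OF Q open_chart[OF c] _ smooth_fst[OF Q] hs]) auto
      then show ?thesis unfolding slit_image_self[OF c]
        by (rule smooth_on_cong[OF Q, rotated]) (rule hinv[OF c, symmetric])
    qed
    fix C' z assume "C' \<in> slit_atlas A" and z: "z \<in> fst C'" "z \<notin> fst (S c)"
    then obtain c' where c': "c' \<in> A" "C' = S c'" by (auto elim: slit_chartE)
    have zz: "z \<in> TM0 A" "fst z \<in> fst c'" "fst z \<notin> fst c" using z c' by (auto simp: slit_chart_simps)
    then obtain W where W: "open W" "snd c' (fst z) \<in> W" "W \<subseteq> snd c' ` fst c'" "\<forall>u\<in>W. h (chart_inv c' u) = 0"
      using hl[OF c'(1)] by blast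
    have "snd z c' \<noteq> 0" using TM0_coord_nonzero[OF zz(1)] zz c' by (simp add: charts_at_def)
    then show "\<exists>W. open W \<and> snd C' z \<in> W \<and> W \<subseteq> snd C' ` fst C' \<and> (\<forall>q\<in>W. ?h (chart_inv C' q) = 0)"
      unfolding c'(2) slit_image_self[OF c'(1)]
    proof (intro exI[of _ "W \<times> (- {0})"] conjI ballI)
      fix q assume q: "q \<in> W \<times> (- {0::'e})"
      then have "q \<in> (snd c' ` fst c') \<times> (- {0})" using W(3) by auto
      then show "?h (chart_inv (S c') q) = 0" using hinv[OF c'(1)] W(4) q by auto
    qed (use W in \<open>auto simp: open_slit slit_chart_simps\<close>)
  qed
qed

subsection \<open>Sections of the pulled-back bundle\<close>

definition cut_section :: "('m, 'e) chart \<Rightarrow> ('m \<Rightarrow> real) \<Rightarrow> ('e \<times> 'e \<Rightarrow> 'e) \<Rightarrow> ('m, 'e) psection"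
  where "cut_section c h w = (\<lambda>z. if z \<in> TM0 A then h (fst z) *\<^sub>R push c (fst z) (w (snd (S c) z)) else 0)"

lemma cut_section:
  assumes h: "cutoff c h" and w: "smooth_on ((snd c ` fst c) \<times> (- {0})) w"
  shows "pullback_section A (cut_section c h w)"
  unfolding pullback_section_def
proof (intro conjI ballI allI impI)
  have c: "c \<in> A" and h0: "\<And>x. x \<notin> fst c \<Longrightarrow> h x = 0" using h by (auto simp: cutoff_def)
  show "cut_section c h w z = 0" if "z \<notin> TM0 A" for z using that by (simp add: cut_section_def)
  show "cut_section c h w z \<in> tangent_space A (fst z)" if "z \<in> TM0 A" for z
  proof (cases "fst z \<in> fst c")
    case True
    then show ?thesis using c that unfolding cut_section_def
      by (auto intro!: subspace_scale[OF tangent_subspace] push_tangent simp: charts_at_def)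
  next
    case False
    then show ?thesis using tangent_zero by (simp add: cut_section_def h0)
  qed
  fix c' assume c': "c' \<in> A"
  let ?D = "(snd c' ` (fst c' \<inter> fst c)) \<times> (- {0::'e})" and ?E = "(snd c ` (fst c \<inter> fst c')) \<times> (- {0::'e})"
  let ?t = "transition (S c') (S c)"
  have D: "open ?D" "open ?E" by (simp_all add: open_slit open_overlap[OF c' c] open_overlap[OF c c'])
  have O: "open (snd c ` (fst c \<inter> fst c'))" by (rule open_overlap[OF c c'])
  note st = smooth_transition[OF c c']
  have sE: "smooth_on ?E (\<lambda>q. dd (transition c c') (fst q) (w q))"
  proof (rule smooth_on_linear_family[of ?E "\<lambda>q. dd (transition c c') (fst q)", OF D(2) _ _ smooth_on_subset[OF w]])
    show "linear (dd (transition c c') (fst q))" if "q \<in> ?E" for q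
      by (rule smooth_on_linear_dd[OF st]) (use that in auto)
    show "smooth_on ?E (\<lambda>q. dd (transition c c') (fst q) b)" for b
      by (rule smooth_on_compose[OF D(2) O _ smooth_fst[OF D(2)] smooth_on_dd_const[OF O st]]) auto
  qed auto
  have s: "smooth_on ?D (\<lambda>q. dd (transition c c') (fst (?t q)) (w (?t q)))"
  proof (rule smooth_on_compose[OF D _ smooth_slit_transition[OF c' c] sE])
    show "?t ` ?D \<subseteq> ?E"
      using slit.transition_overlap(1)[OF slit_chart_in[OF c'] slit_chart_in[OF c]]
      unfolding slit_image[OF c c'] slit_image[OF c' c] by blast
  qed
  have hs: "smooth_on ?D (\<lambda>q. (if chart_inv (S c') q \<in> TM0 A then h (fst (chart_inv (S c') q)) else 0))"
    using slit.cutoff_smooth_pullback[OF cutoff_slit[OF h] slit_chart_in[OF c']] unfolding slit_image[OF c' c] .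
  have "smooth_on ?D (\<lambda>q. cut_section c h w (chart_inv (S c') q) c')"
  proof (rule smooth_on_cong[OF D(1) _ smooth_on_scaleR[OF D(1) hs s]])
    fix q assume q: "q \<in> ?D"
    then have "q \<in> snd (S c') ` (fst (S c') \<inter> fst (S c))" by (simp only: slit_image[OF c' c])
    then obtain z where z: "z \<in> fst (S c')" "z \<in> fst (S c)" "q = snd (S c') z" by auto
    then show "(if chart_inv (S c') q \<in> TM0 A then h (fst (chart_inv (S c') q)) else 0) *\<^sub>R
        dd (transition c c') (fst (?t q)) (w (?t q)) = cut_section c h w (chart_inv (S c') q) c'"
      using c c' by (simp add: cut_section_def slit.chart_inv_coord slit_chart_in slit.transition_coord push_def scaleR_fun_def)
        (simp add: slit_chart_simps charts_at_def)
  qed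
  then have "smooth_on (snd (S c') ` (fst (S c') \<inter> fst (S c))) (\<lambda>q. cut_section c h w (chart_inv (S c') q) c')"
    by (simp only: slit_image[OF c' c])
  then show "smooth_on (snd (S c') ` fst (S c')) (\<lambda>q. cut_section c h w (chart_inv (S c') q) c')"
    by (rule slit.cutoff_patch[OF cutoff_slit[OF h] slit_chart_in[OF c']])
      (auto simp: cut_section_def scaleR_fun_def split: if_splits)
qed

lemma section_tangent: "pullback_section A Y \<Longrightarrow> z \<in> TM0 A \<Longrightarrow> Y z \<in> tangent_space A (fst z)"
  and section_outside: "pullback_section A Y \<Longrightarrow> z \<notin> TM0 A \<Longrightarrow> Y z = 0"
  unfolding pullback_section_def by blast+

lemma section_smooth: "pullback_section A Y \<Longrightarrow> c \<in> A \<Longrightarrow> smooth_on ((snd c ` fst c) \<times> (- {0})) (\<lambda>p. Y (chart_inv (S c) p) c)"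
  unfolding pullback_section_def using slit_image_self by metis

lemma canonical_section_coord: assumes "c \<in> A" "q \<in> (snd c ` fst c) \<times> (- {0})"
  shows "canonical_section A (chart_inv (S c) q) c = snd q"
proof -
  have q: "fst q \<in> snd c ` fst c" "snd q \<noteq> 0" using assms(2) by auto
  have cx: "c \<in> charts_at A (chart_inv c (fst q))" using assms(1) chart_inv_mem[OF assms(1) q(1)] by (simp add: charts_at_def)
  from slit_chart_inv[OF assms(1) q] have "chart_inv (S c) q = (chart_inv c (fst q), push c (chart_inv c (fst q)) (snd q))" by simp
  then show ?thesis using push_nonzero[OF cx q(2)] push_coord[OF cx] by (simp add: canonical_section_def extend_by_zero_def)
qed

lemma canonical_section_pullback: "pullback_section A (canonical_section A)"
  unfolding pullback_section_def
proof (intro conjI ballI allI impI)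
  show "canonical_section A z \<in> tangent_space A (fst z)" if "z \<in> TM0 A" for z
    using TM0D(1)[OF that] that by (simp add: canonical_section_def extend_by_zero_def)
  show "canonical_section A z = 0" if "z \<notin> TM0 A" for z
    using that by (simp add: canonical_section_def extend_by_zero_def)
  fix c assume c: "c \<in> A"
  have Q: "open ((snd c ` fst c) \<times> (- {0::'e}))" by (simp add: open_slit open_chart[OF c])
  show "smooth_on (snd (S c) ` fst (S c)) (\<lambda>p. canonical_section A (chart_inv (S c) p) c)"
    unfolding slit_image_self[OF c]
    by (rule smooth_on_cong[OF Q _ smooth_snd[OF Q]]) (rule canonical_section_coord[OF c, symmetric])
qed

lemma slit_field_smooth: "vector_field (slit_atlas A) X \<Longrightarrow> c \<in> A \<Longrightarrow> smooth_on ((snd c ` fst c) \<times> (- {0})) (\<lambda>p. X (chart_inv (S c) p) (S c))"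
  and slit_field_tangent: "vector_field (slit_atlas A) X \<Longrightarrow> z \<in> TM0 A \<Longrightarrow> X z \<in> tangent_space (slit_atlas A) z"
proof -
  assume X: "vector_field (slit_atlas A) X"
  show "X z \<in> tangent_space (slit_atlas A) z" if "z \<in> TM0 A" using X that by (simp add: vector_field_on_def slit_carrier)
  assume c: "c \<in> A"
  have "fst (S c) \<inter> carrier_of (slit_atlas A) = fst (S c)" by (auto simp: slit_carrier slit_chart_simps)
  then show "smooth_on ((snd c ` fst c) \<times> (- {0})) (\<lambda>p. X (chart_inv (S c) p) (S c))"
    using slit.field_smooth[OF X slit_chart_in[OF c]] by (simp add: slit_image_self[OF c])
qed

lemma rho_section: assumes X: "vector_field (slit_atlas A) X" shows "pullback_section A (rho A X)"
  unfolding pullback_section_def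
proof (intro conjI ballI allI impI)
  show "rho A X z = 0" if "z \<notin> TM0 A" for z using that by (simp add: rho_def extend_by_zero_def)
  have r: "rho A X z = push c (fst z) (fst (X z (S c)))" if "z \<in> TM0 A" "c \<in> charts_at A (fst z)" for z c
    using rho_at_coord[OF that slit_field_tangent[OF X that(1)]] that by (simp add: rho_def extend_by_zero_def)
  show "rho A X z \<in> tangent_space A (fst z)" if z: "z \<in> TM0 A" for z
  proof -
    obtain c where "c \<in> charts_at A (fst z)" using TM0D(3)[OF z] carrier_charts by blast
    then show ?thesis using r[OF z] push_tangent by simp
  qed
  fix c assume c: "c \<in> A"
  have Q: "open ((snd c ` fst c) \<times> (- {0::'e}))" by (simp add: open_slit open_chart[OF c])
  show "smooth_on (snd (S c) ` fst (S c)) (\<lambda>p. rho A X (chart_inv (S c) p) c)"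
    unfolding slit_image_self[OF c]
  proof (rule smooth_on_cong[OF Q _ smooth_on_fst[OF Q slit_field_smooth[OF X c]]])
    fix q assume "q \<in> (snd c ` fst c) \<times> (- {0::'e})"
    then have "q \<in> snd (S c) ` fst (S c)" by (simp only: slit_image_self[OF c])
    then have z: "chart_inv (S c) q \<in> TM0 A" "c \<in> charts_at A (fst (chart_inv (S c) q))"
      using slit.chart_inv_mem[OF slit_chart_in[OF c]] c by (auto simp: slit_chart_simps charts_at_def)
    show "fst (X (chart_inv (S c) q) (S c)) = rho A X (chart_inv (S c) q) c"
      by (simp add: r[OF z] push_coord[OF z(2)])
  qed
qed

end

section \<open>The Cartan connection of a Finsler manifold in charts\<close>

subsection \<open>Homogeneous functions on fibres\<close>

lemma homogeneous_dd:
  fixes f :: "'a::euclidean_space \<times> 'b::euclidean_space \<Rightarrow> real"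
  assumes d: "\<And>w. w \<noteq> 0 \<Longrightarrow> f differentiable (at (u, w))"
    and hom: "\<And>t w. 0 < t \<Longrightarrow> w \<noteq> 0 \<Longrightarrow> f (u, t *\<^sub>R w) = t ^ Suc k * f (u, w)"
    and t: "0 < t" and v: "v \<noteq> 0"
  shows "dd f (u, t *\<^sub>R v) (0, b) = t ^ k * dd f (u, v) (0, b)"
proof -
  have tv: "t *\<^sub>R v \<noteq> 0" using t v by simp
  have "((\<lambda>w. (u, t *\<^sub>R w)) has_derivative (\<lambda>b. (0, t *\<^sub>R b))) (at v)"
    by (auto intro!: derivative_eq_intros)
  from has_derivative_compose[OF this d[OF tv, unfolded frechet_derivative_works]]
  have "((\<lambda>w. f (u, t *\<^sub>R w)) has_derivative (\<lambda>b. dd f (u, t *\<^sub>R v) (0, t *\<^sub>R b))) (at v)" .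
  moreover have "((\<lambda>w. t ^ Suc k * f (u, w)) has_derivative (\<lambda>b. t ^ Suc k * dd f (u, v) (0, b))) (at v)"
  proof (rule has_derivative_mult_right)
    have "((\<lambda>w. (u, w)) has_derivative (\<lambda>b. (0, b))) (at v)"
      by (auto intro!: derivative_eq_intros)
    from has_derivative_compose[OF this d[OF v, unfolded frechet_derivative_works]]
    show "((\<lambda>w. f (u, w)) has_derivative (\<lambda>b. dd f (u, v) (0, b))) (at v)" .
  qed
  then have "((\<lambda>w. f (u, t *\<^sub>R w)) has_derivative (\<lambda>b. t ^ Suc k * dd f (u, v) (0, b))) (at v)"
    by (rule has_derivative_transform_within_open[of _ _ _ _ "- {0}"]) (use v hom[OF t] in auto)
  ultimately have "dd f (u, t *\<^sub>R v) (0, t *\<^sub>R b) = t ^ Suc k * dd f (u, v) (0, b)"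
    by (rule fun_cong[OF has_derivative_unique])
  moreover have "dd f (u, t *\<^sub>R v) (t *\<^sub>R (0, b)) = t *\<^sub>R dd f (u, t *\<^sub>R v) (0, b)"
    by (rule linear_cmul[OF linear_frechet_derivative[OF d[OF tv]]])
  ultimately show ?thesis using t by simp
qed

lemma homogeneous_euler:
  fixes f :: "'a::euclidean_space \<times> 'b::euclidean_space \<Rightarrow> real"
  assumes d: "f differentiable (at (u, v))"
    and hom: "\<And>t. 0 < t \<Longrightarrow> f (u, t *\<^sub>R v) = t ^ k * f (u, v)"
  shows "dd f (u, v) (0, v) = real k * f (u, v)"
proof -
  have "((\<lambda>t. (u, t *\<^sub>R v)) has_derivative (\<lambda>s. (0, s *\<^sub>R v))) (at 1)"
    by (auto intro!: derivative_eq_intros)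
  moreover have "(f has_derivative dd f (u, v)) (at ((\<lambda>t. (u, t *\<^sub>R v)) 1))"
    using d[unfolded frechet_derivative_works] by simp
  ultimately have "((\<lambda>t. f (u, t *\<^sub>R v)) has_derivative (\<lambda>s. dd f (u, v) (0, s *\<^sub>R v))) (at 1)"
    by (rule has_derivative_compose)
  moreover have "((\<lambda>t::real. t ^ k * f (u, v)) has_derivative (\<lambda>s. real k * s * f (u, v))) (at 1)"
    by (auto intro!: derivative_eq_intros)
  then have "((\<lambda>t. f (u, t *\<^sub>R v)) has_derivative (\<lambda>s. real k * s * f (u, v))) (at 1)"
    by (rule has_derivative_transform_within_open[of _ _ _ _ "{0<..}"]) (use hom in auto)
  ultimately have "(\<lambda>s. dd f (u, v) (0, s *\<^sub>R v)) = (\<lambda>s. real k * s * f (u, v))"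
    by (rule has_derivative_unique)
  from fun_cong[OF this, of 1] show ?thesis by simp
qed

subsection \<open>Rules for the connection\<close>

lemma linear_eval: "linear (\<lambda>v::'a \<Rightarrow> 'b::real_vector. v c)"
  by (intro linearI) (simp_all add: scaleR_fun_def)

lemma scaleR_fun_apply: "(r *\<^sub>R f) c = r *\<^sub>R f c" by (simp add: scaleR_fun_def)

locale finsler_cartan = slit_bundle A for A :: "('m, 'e::euclidean_space) chart set" +
  fixes M :: "'m topology" and F :: "('m, 'e) tpoint \<Rightarrow> real" and D :: "('m, 'e) conn"
  assumes manifold: "smooth_manifold M A" and finsler: "finsler_structure A F"
    and cartan: "cartan_connection A F D"
begin

lemma connection: "linear_connection A D" and regular: "regular_connection A D"
  using cartan by (auto simp: cartan_connection_def regular_connection_def)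

lemmas F_pos = finsler[unfolded finsler_structure_def, THEN conjunct1]
  and F_smooth = finsler[unfolded finsler_structure_def, THEN conjunct2, THEN conjunct1]
  and F_hom = finsler[unfolded finsler_structure_def, THEN conjunct2, THEN conjunct2, THEN conjunct1]
  and metric_pos = finsler[unfolded finsler_structure_def, THEN conjunct2, THEN conjunct2, THEN conjunct2]

abbreviation T where "T z \<equiv> tangent_space (slit_atlas A) z"

lemma D_tangent: "z \<in> TM0 A \<Longrightarrow> pullback_section A Y \<Longrightarrow> \<xi> \<in> T z \<Longrightarrow> D z \<xi> Y \<in> tangent_space A (fst z)"
  and D_linear: "z \<in> TM0 A \<Longrightarrow> pullback_section A Y \<Longrightarrow> \<xi> \<in> T z \<Longrightarrow> \<zeta> \<in> T z \<Longrightarrow>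
    D z (s *\<^sub>R \<xi> + t *\<^sub>R \<zeta>) Y = s *\<^sub>R D z \<xi> Y + t *\<^sub>R D z \<zeta> Y"
  and D_plus: "z \<in> TM0 A \<Longrightarrow> \<xi> \<in> T z \<Longrightarrow> pullback_section A Y \<Longrightarrow> pullback_section A Y' \<Longrightarrow>
    D z \<xi> (Y + Y') = D z \<xi> Y + D z \<xi> Y'"
  and D_leibniz: "z \<in> TM0 A \<Longrightarrow> \<xi> \<in> T z \<Longrightarrow> smooth_function (slit_atlas A) f \<Longrightarrow> pullback_section A Y \<Longrightarrow>
    D z \<xi> (\<lambda>w. f w *\<^sub>R Y w) = deriv_along (slit_atlas A) z \<xi> f *\<^sub>R Y z + f z *\<^sub>R D z \<xi> Y"
  and covd_section: "vector_field (slit_atlas A) X \<Longrightarrow> pullback_section A Y \<Longrightarrow> pullback_section A (covd A D X Y)"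
  using connection unfolding linear_connection_def by blast+

lemma D_add: "z \<in> TM0 A \<Longrightarrow> pullback_section A Y \<Longrightarrow> \<xi> \<in> T z \<Longrightarrow> \<zeta> \<in> T z \<Longrightarrow> D z (\<xi> + \<zeta>) Y = D z \<xi> Y + D z \<zeta> Y"
  using D_linear[of z Y \<xi> \<zeta> 1 1] by simp

lemma D_scale: "z \<in> TM0 A \<Longrightarrow> pullback_section A Y \<Longrightarrow> \<xi> \<in> T z \<Longrightarrow> D z (r *\<^sub>R \<xi>) Y = r *\<^sub>R D z \<xi> Y"
  using D_linear[of z Y \<xi> \<xi> r 0] by simp

lemma D_const: assumes "z \<in> TM0 A" "\<xi> \<in> T z" "pullback_section A Y" shows "D z \<xi> (\<lambda>w. r *\<^sub>R Y w) = r *\<^sub>R D z \<xi> Y"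
proof -
  have "smooth_function (slit_atlas A) (\<lambda>w. r)" by (simp add: smooth_function_def o_def)
  moreover have "deriv_along (slit_atlas A) z \<xi> (\<lambda>w. r) = 0" by (simp add: deriv_along_def o_def)
  ultimately show ?thesis using D_leibniz[OF assms(1,2), of "\<lambda>w. r" Y] assms(3) by simp
qed

lemma section_plus: assumes "pullback_section A Y" "pullback_section A Y'" shows "pullback_section A (Y + Y')"
  unfolding pullback_section_def
proof (intro conjI ballI allI impI)
  show "(Y + Y') z \<in> tangent_space A (fst z)" if "z \<in> TM0 A" for z
    using subspace_add[OF tangent_subspace section_tangent[OF assms(1) that] section_tangent[OF assms(2) that]] by simp
  show "(Y + Y') z = 0" if "z \<notin> TM0 A" for z
    using section_outside[OF assms(1) that] section_outside[OF assms(2) that] by simp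
  fix c assume c: "c \<in> A"
  show "smooth_on (snd (S c) ` fst (S c)) (\<lambda>p. (Y + Y') (chart_inv (S c) p) c)"
    using smooth_on_add[OF open_slit[OF open_chart[OF c]] section_smooth[OF assms(1) c] section_smooth[OF assms(2) c]]
    by (simp add: slit_image_self[OF c])
qed

lemma section_scale: assumes f: "smooth_function (slit_atlas A) f" and Y: "pullback_section A Y"
  shows "pullback_section A (\<lambda>w. f w *\<^sub>R Y w)"
  unfolding pullback_section_def
proof (intro conjI ballI allI impI)
  show "f z *\<^sub>R Y z \<in> tangent_space A (fst z)" if "z \<in> TM0 A" for z
    by (rule subspace_scale[OF tangent_subspace section_tangent[OF Y that]])
  show "f z *\<^sub>R Y z = 0" if "z \<notin> TM0 A" for z using section_outside[OF Y that] by simp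
  fix c assume c: "c \<in> A"
  have "smooth_on (snd (S c) ` fst (S c)) (\<lambda>p. f (chart_inv (S c) p))"
    using f slit_chart_in[OF c] by (simp add: smooth_function_def o_def)
  from smooth_on_scaleR[OF slit.open_chart[OF slit_chart_in[OF c]] this section_smooth[OF Y c, folded slit_image_self[OF c]]]
  show "smooth_on (snd (S c) ` fst (S c)) (\<lambda>p. (f (chart_inv (S c) p) *\<^sub>R Y (chart_inv (S c) p)) c)"
    by (simp add: scaleR_fun_apply)
qed

lemma D_sum:
  assumes z: "z \<in> TM0 A" "\<xi> \<in> T z" and I: "finite I" and Y: "\<And>i. i \<in> I \<Longrightarrow> pullback_section A (Y i)"
  shows "D z \<xi> (\<lambda>w. \<Sum>i\<in>I. Y i w) = (\<Sum>i\<in>I. D z \<xi> (Y i)) \<and> pullback_section A (\<lambda>w. \<Sum>i\<in>I. Y i w)"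
  using I Y
proof (induction I rule: finite_induct)
  case empty
  have s: "pullback_section A (canonical_section A)" by (rule canonical_section_pullback)
  have sm: "smooth_function (slit_atlas A) (\<lambda>w. 0)" by (simp add: smooth_function_def o_def)
  have e: "(\<lambda>w. \<Sum>i\<in>{}. Y i w) = (\<lambda>w. 0 *\<^sub>R canonical_section A w)"
    by (simp only: sum.empty scaleR_zero_left)
  show ?case unfolding e
  proof (rule conjI)
    show "D z \<xi> (\<lambda>w. 0 *\<^sub>R canonical_section A w) = (\<Sum>i\<in>{}. D z \<xi> (Y i))"
      unfolding D_const[OF z s] sum.empty by (rule scaleR_zero_left)
  qed (rule section_scale[OF sm s])
next
  case (insert i I)
  have e: "(\<lambda>w. \<Sum>i\<in>insert i I. Y i w) = Y i + (\<lambda>w. \<Sum>i\<in>I. Y i w)"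
    using insert.hyps by (simp add: fun_eq_iff)
  have IH: "D z \<xi> (\<lambda>w. \<Sum>i\<in>I. Y i w) = (\<Sum>i\<in>I. D z \<xi> (Y i))" "pullback_section A (\<lambda>w. \<Sum>i\<in>I. Y i w)"
    using insert.IH insert.prems by auto
  have Yi: "pullback_section A (Y i)" using insert.prems by simp
  show ?case unfolding e using D_plus[OF z Yi IH(2)] section_plus[OF Yi IH(2)] IH(1) insert.hyps by simp
qed

lemma rho_at_linear:
  assumes z: "z \<in> TM0 A" and \<xi>: "\<xi> \<in> T z" and \<zeta>: "\<zeta> \<in> T z"
  shows "rho_at A z (\<xi> - \<zeta>) = rho_at A z \<xi> - rho_at A z \<zeta>"
proof -
  obtain c where c: "c \<in> charts_at A (fst z)" using TM0D(3)[OF z] carrier_charts by blast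
  have "\<xi> - \<zeta> \<in> T z" by (rule subspace_diff[OF slit.tangent_subspace \<xi> \<zeta>])
  then show ?thesis
    using linear_diff[OF push_linear[OF c]] by (simp add: rho_at_coord[OF z c] \<xi> \<zeta>)
qed

lemma mu_at_linear:
  assumes "z \<in> TM0 A" "\<xi> \<in> T z" "\<zeta> \<in> T z"
  shows "mu_at A D z (\<xi> - \<zeta>) = mu_at A D z \<xi> - mu_at A D z \<zeta>"
  using D_linear[OF assms(1) canonical_section_pullback assms(2,3), of 1 "- 1"]
  unfolding mu_at_def scaleR_one scaleR_minus1_left add_uminus_conv_diff .

lemma mu_at_0: assumes "z \<in> TM0 A" shows "mu_at A D z 0 = 0"
  using mu_at_linear[OF assms slit.tangent_zero slit.tangent_zero] by simp

lemma mu_bij: "z \<in> TM0 A \<Longrightarrow> bij_betw (mu_at A D z) (vertical_space A z) (tangent_space A (fst z))"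
  using regular by (auto simp: regular_connection_def)

lemma vertical_horizontal:
  assumes z: "z \<in> TM0 A" and v: "\<xi> \<in> vertical_space A z" and h: "\<xi> \<in> horizontal_space A D z"
  shows "\<xi> = 0"
proof -
  obtain c where c: "c \<in> charts_at A (fst z)" using TM0D(3)[OF z] carrier_charts by blast
  have "0 \<in> vertical_space A z"
    using rho_at_coord[OF z c slit.tangent_zero] linear_0[OF push_linear[OF c]]
    by (simp add: vertical_space_def slit.tangent_zero)
  then show ?thesis
    using bij_betw_imp_inj_on[OF mu_bij[OF z]] v h mu_at_0[OF z]
    by (auto simp: horizontal_space_def inj_on_def)
qed

lemma hpart_unique:
  assumes z: "z \<in> TM0 A" and X: "X z \<in> T z" and \<xi>: "\<xi> \<in> horizontal_space A D z" "X z - \<xi> \<in> vertical_space A z"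
  shows "hpart A D X z = \<xi>"
proof -
  have "(THE \<xi>. \<xi> \<in> horizontal_space A D z \<and> X z - \<xi> \<in> vertical_space A z) = \<xi>"
  proof (rule the_equality)
    fix \<zeta> assume \<zeta>: "\<zeta> \<in> horizontal_space A D z \<and> X z - \<zeta> \<in> vertical_space A z"
    then have t: "\<zeta> \<in> T z" "\<xi> \<in> T z" "\<zeta> - \<xi> \<in> T z"
      using \<xi> subspace_diff[OF slit.tangent_subspace] by (auto simp: horizontal_space_def)
    have "rho_at A z (\<zeta> - \<xi>) = 0"
      using \<zeta> \<xi> rho_at_linear[OF z X t(1)] rho_at_linear[OF z X t(2)] rho_at_linear[OF z t(1,2)]
      by (simp add: vertical_space_def)
    moreover have "mu_at A D z (\<zeta> - \<xi>) = 0"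
      using \<zeta> \<xi> mu_at_linear[OF z t(1,2)] by (simp add: horizontal_space_def)
    ultimately have "\<zeta> - \<xi> = 0"
      using t(3) by (intro vertical_horizontal[OF z]) (simp_all add: vertical_space_def horizontal_space_def)
    then show "\<zeta> = \<xi>" by simp
  qed (use \<xi> in simp)
  then show ?thesis using z by (simp add: hpart_def extend_by_zero_def)
qed

lemma rho_hpart: assumes X: "vector_field (slit_atlas A) X" shows "rho A (hpart A D X) = rho A X"
proof
  fix z
  show "rho A (hpart A D X) z = rho A X z"
  proof (cases "z \<in> TM0 A")
    case z: True
    have Xz: "X z \<in> T z" by (rule slit_field_tangent[OF X z])
    have "mu_at A D z (X z) \<in> tangent_space A (fst z)"
      unfolding mu_at_def by (rule D_tangent[OF z canonical_section_pullback Xz])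
    then obtain \<eta> where \<eta>: "\<eta> \<in> vertical_space A z" "mu_at A D z \<eta> = mu_at A D z (X z)"
      using bij_betw_imp_surj_on[OF mu_bij[OF z]] by (metis imageE)
    have \<eta>T: "\<eta> \<in> T z" "rho_at A z \<eta> = 0" using \<eta> by (auto simp: vertical_space_def)
    have "X z - \<eta> \<in> horizontal_space A D z"
      using mu_at_linear[OF z Xz \<eta>T(1)] \<eta> subspace_diff[OF slit.tangent_subspace Xz \<eta>T(1)]
      by (simp add: horizontal_space_def)
    from hpart_unique[of z X, OF z Xz this] \<eta> have "hpart A D X z = X z - \<eta>" by simp
    then show ?thesis using z rho_at_linear[OF z Xz \<eta>T(1)] \<eta>T by (simp add: rho_def extend_by_zero_def)
  qed (simp add: rho_def extend_by_zero_def)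
qed

subsection \<open>The fundamental tensor\<close>

text \<open>\<open>E\<close> is \<open>F\<^sup>2\<close> in a chart and \<open>G\<close> its halved fibre Hessian, the fundamental tensor; \<open>W\<close> is the
  coordinate domain of the induced chart of the slit tangent bundle.\<close>

definition E where "E c = (\<lambda>z. (F z)\<^sup>2) \<circ> chart_inv (S c)"

definition G :: "('m, 'e) chart \<Rightarrow> 'e \<times> 'e \<Rightarrow> 'e \<Rightarrow> 'e \<Rightarrow> real"
  where "G c q a b = 1/2 * dd (\<lambda>p. dd (E c) p (0, b)) q (0, a)"

abbreviation W where "W c \<equiv> (snd c ` fst c) \<times> (- {0::'e})"

lemma open_W: "c \<in> A \<Longrightarrow> open (W c)" by (rule open_slit[OF open_chart])

lemma smooth_E: assumes "c \<in> A" shows "smooth_on (W c) (E c)"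
proof -
  have "smooth_on (W c) (\<lambda>p. F (chart_inv (S c) p))"
    using F_smooth slit_chart_in[OF assms] unfolding smooth_function_def o_def
    by (simp add: slit_image_self[OF assms, symmetric])
  from smooth_on_mult[OF open_W[OF assms] this this] show ?thesis by (simp add: E_def o_def power2_eq_square)
qed

lemma smooth_dE: assumes "c \<in> A" shows "smooth_on (W c) (\<lambda>p. dd (E c) p \<xi>)"
  by (rule smooth_on_dd_const[OF open_W[OF assms] smooth_E[OF assms]])

lemma smooth_G: assumes "c \<in> A" shows "smooth_on (W c) (\<lambda>q. G c q a b)"
  unfolding G_def
  by (intro smooth_on_mult[OF open_W[OF assms] smooth_on_const] smooth_on_dd_const[OF open_W[OF assms] smooth_dE[OF assms]])

lemma G_linear: assumes "c \<in> A" "q \<in> W c" shows "linear (\<lambda>a. G c q a b)" "linear (\<lambda>b. G c q a b)"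
proof -
  have p: "linear (\<lambda>a. (0::'e, a::'e))" by (intro linearI) auto
  have h: "linear (\<lambda>x::real. 1/2 * x)" by (intro linearI) (auto simp: algebra_simps)
  have "linear (\<lambda>a. dd (\<lambda>p. dd (E c) p (0, b)) q (0, a))"
    using linear_compose[OF p smooth_on_linear_dd[OF smooth_dE[OF assms(1)] assms(2)]] by (simp add: o_def)
  from linear_compose[OF this h] show "linear (\<lambda>a. G c q a b)" by (simp add: G_def o_def)
  have "linear (\<lambda>\<xi>. dd (\<lambda>p. dd (E c) p \<xi>) q (0, a))"
    by (rule linear_family_dd[of "W c" q "\<lambda>p \<xi>. dd (E c) p \<xi>", OF open_W[OF assms(1)] assms(2)
          smooth_on_linear_dd[OF smooth_E[OF assms(1)]] smooth_dE[OF assms(1)]])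
  from linear_compose[OF linear_compose[OF p this] h] show "linear (\<lambda>b. G c q a b)" by (simp add: G_def o_def)
qed

lemma G_sym: assumes "c \<in> A" "q \<in> W c" shows "G c q a b = G c q b a"
  unfolding G_def using dd_dd_commute[OF open_W[OF assms(1)] assms(2) smooth_E[OF assms(1)], of "(0, b)" "(0, a)"] by simp

lemma G_vert_sym: assumes c: "c \<in> A" and q: "q \<in> W c"
  shows "dd (\<lambda>q. G c q a b) q (0, d) = dd (\<lambda>q. G c q a d) q (0, b)"
proof -
  note o = open_W[OF c]
  have com: "dd (\<lambda>q. dd (\<lambda>p. dd (E c) p \<xi>) q \<zeta>) q \<eta> = dd (\<lambda>q. dd (\<lambda>p. dd (E c) p \<xi>) q \<eta>) q \<zeta>" for \<xi> \<zeta> \<eta>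
    by (rule dd_dd_commute[OF o q smooth_dE[OF c]])
  have inn: "dd (\<lambda>q. dd (\<lambda>p. dd (E c) p \<xi>) q \<zeta>) q = dd (\<lambda>q. dd (\<lambda>p. dd (E c) p \<zeta>) q \<xi>) q" for \<xi> \<zeta>
    by (rule frechet_derivative_cong_open[OF o q]) (rule dd_dd_commute[OF o _ smooth_E[OF c]])
  have h: "dd (\<lambda>q. G c q a b) q \<eta> = 1/2 * dd (\<lambda>q. dd (\<lambda>p. dd (E c) p (0, b)) q (0, a)) q \<eta>" for a b \<eta>
    unfolding G_def
    by (rule dd_bounded_linear[OF bounded_linear_mult_right smooth_on_differentiable[OF smooth_on_dd_const[OF o smooth_dE[OF c]] q]])
  show ?thesis unfolding h com[of "(0, b)" "(0, a)" "(0, d)"] inn[of "(0, b)" "(0, d)"] com[of "(0, d)" "(0, b)" "(0, a)"] ..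
qed

lemma chart_inv_slit:
  assumes c: "c \<in> A" and q: "q \<in> W c"
  shows "chart_inv (S c) q \<in> TM0 A" "c \<in> charts_at A (fst (chart_inv (S c) q))" "snd (S c) (chart_inv (S c) q) = q"
    "fst (chart_inv (S c) q) = chart_inv c (fst q)" "snd (chart_inv (S c) q) = push c (chart_inv c (fst q)) (snd q)"
proof -
  have q': "q \<in> snd (S c) ` fst (S c)" using q by (simp only: slit_image_self[OF c])
  show "chart_inv (S c) q \<in> TM0 A" "c \<in> charts_at A (fst (chart_inv (S c) q))"
    using slit.chart_inv_mem[OF slit_chart_in[OF c] q'] c by (auto simp: slit_chart_simps charts_at_def)
  show "snd (S c) (chart_inv (S c) q) = q" by (rule slit.coord_chart_inv[OF slit_chart_in[OF c] q'])
  have "fst q \<in> snd c ` fst c" "snd q \<noteq> 0" using q by auto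
  from slit_chart_inv[OF c this]
  show "fst (chart_inv (S c) q) = chart_inv c (fst q)" "snd (chart_inv (S c) q) = push c (chart_inv c (fst q)) (snd q)"
    by simp_all
qed

lemma E_pos: assumes "c \<in> A" "q \<in> W c" shows "0 < E c q"
proof -
  have "0 < F (chart_inv (S c) q)" by (rule bspec[OF F_pos chart_inv_slit(1)[OF assms]])
  then show ?thesis by (simp add: E_def)
qed

lemma E_homogeneous:
  assumes c: "c \<in> A" and u: "u \<in> snd c ` fst c" and t: "0 < t" and v: "v \<noteq> 0"
  shows "E c (u, t *\<^sub>R v) = t ^ Suc (Suc 0) * E c (u, v)"
proof -
  have w: "(u, v) \<in> W c" "(u, t *\<^sub>R v) \<in> W c" using u v t by auto
  have cx: "c \<in> charts_at A (chart_inv c u)" using chart_inv_slit(2,4)[OF c w(1)] by simp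
  have "chart_inv (S c) (u, t *\<^sub>R v) = (fst (chart_inv (S c) (u, v)), t *\<^sub>R snd (chart_inv (S c) (u, v)))"
    using chart_inv_slit(4,5)[OF c w(1)] chart_inv_slit(4,5)[OF c w(2)] linear_cmul[OF push_linear[OF cx]]
    by (simp add: prod_eq_iff)
  moreover have "F (x, t *\<^sub>R y) = t * F (x, y)" if "(x, y) \<in> TM0 A" for x y
    using bspec[OF F_hom that] t by simp
  ultimately have "F (chart_inv (S c) (u, t *\<^sub>R v)) = t * F (chart_inv (S c) (u, v))"
    using chart_inv_slit(1)[OF c w(1)] by (metis prod.collapse)
  then show ?thesis by (simp add: E_def power_mult_distrib power2_eq_square)
qed

lemma dE_homogeneous:
  assumes c: "c \<in> A" and u: "u \<in> snd c ` fst c" and t: "0 < t" and v: "v \<noteq> 0"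
  shows "dd (E c) (u, t *\<^sub>R v) (0, b) = t ^ Suc 0 * dd (E c) (u, v) (0, b)"
  by (rule homogeneous_dd[OF smooth_on_differentiable[OF smooth_E[OF c]] E_homogeneous[OF c u] t v])
    (use u in auto)

lemma G_homogeneous:
  assumes c: "c \<in> A" and u: "u \<in> snd c ` fst c" and t: "0 < t" and v: "v \<noteq> 0"
  shows "G c (u, t *\<^sub>R v) a b = t ^ 0 * G c (u, v) a b"
proof -
  have "dd (\<lambda>p. dd (E c) p (0, b)) (u, t *\<^sub>R v) (0, a) = t ^ 0 * dd (\<lambda>p. dd (E c) p (0, b)) (u, v) (0, a)"
    by (rule homogeneous_dd[OF smooth_on_differentiable[OF smooth_dE[OF c]] dE_homogeneous[OF c u] t v]) (use u in auto)
  then show ?thesis by (simp add: G_def)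
qed

lemma G_vert_v: assumes c: "c \<in> A" and q: "q \<in> W c" shows "dd (\<lambda>q. G c q a b) q (0, snd q) = 0"
proof -
  obtain u v where uv: "q = (u, v)" "u \<in> snd c ` fst c" "v \<noteq> 0" using q by auto
  have "dd (\<lambda>q. G c q a b) (u, v) (0, v) = real 0 * G c (u, v) a b"
    by (rule homogeneous_euler[OF smooth_on_differentiable[OF smooth_G[OF c]] G_homogeneous[OF c uv(2) _ uv(3)]])
      (use q uv in auto)
  then show ?thesis by (simp add: uv)
qed

lemma G_v: assumes c: "c \<in> A" and q: "q \<in> W c" shows "2 * G c q (snd q) b = dd (E c) q (0, b)"
proof -
  obtain u v where uv: "q = (u, v)" "u \<in> snd c ` fst c" "v \<noteq> 0" using q by auto
  have "dd (\<lambda>p. dd (E c) p (0, b)) (u, v) (0, v) = real (Suc 0) * dd (E c) (u, v) (0, b)"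
    by (rule homogeneous_euler[OF smooth_on_differentiable[OF smooth_dE[OF c]] dE_homogeneous[OF c uv(2) _ uv(3)]])
      (use q uv in auto)
  then show ?thesis by (simp add: uv G_def)
qed

text \<open>Transition maps are linear on fibres, so fibre Hessians transform as tensors. Consequently the
  metric, defined by an arbitrary chart at the point, may be computed in any other one.\<close>

lemma G_change_chart:
  assumes z: "z \<in> TM0 A" and c: "c \<in> charts_at A (fst z)" and c0: "c0 \<in> charts_at A (fst z)"
  shows "G c0 (snd (S c0) z) a b = G c (snd (S c) z) (jac c0 c (fst z) a) (jac c0 c (fst z) b)"
proof -
  note m = charts_atD[OF c] and m0 = charts_atD[OF c0]
  let ?J = "jac c0 c (fst z)" and ?u = "snd c0 (fst z)" and ?\<Psi> = "transition (S c0) (S c)"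
  let ?Q = "(snd c0 ` (fst c0 \<inter> fst c)) \<times> (- {0::'e})"
  have Q: "open ?Q" by (rule open_slit[OF open_overlap[OF m0(1) m(1)]])
  have Qim: "?Q = snd (S c0) ` (fst (S c0) \<inter> fst (S c))" by (rule slit_image[OF m0(1) m(1), symmetric])
  have QW: "?Q \<subseteq> W c0" by auto
  have uQ: "(?u, w) \<in> ?Q" if "w \<noteq> 0" for w using m m0 that by auto
  have st: "smooth_on ?Q ?\<Psi>" by (rule smooth_slit_transition[OF m0(1) m(1)])
  have \<Psi>W: "?\<Psi> q \<in> W c" if "q \<in> ?Q" for q
    using slit.transition_overlap(5)[OF slit_chart_in[OF m0(1)] slit_chart_in[OF m(1)]] that
    by (simp only: Qim slit_image_self[OF m(1)])
  have E0: "E c0 q = E c (?\<Psi> q)" if "q \<in> ?Q" for q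
    using slit.transition_overlap(2)[OF slit_chart_in[OF m0(1)] slit_chart_in[OF m(1)]] that
    by (simp only: Qim E_def o_def)
  have vert: "dd ?\<Psi> (?u, w) (0, b) = (0, ?J b)" if "w \<noteq> 0" for w b
  proof -
    let ?y = "(fst z, push c0 (fst z) w)"
    have y: "?y \<in> TM0 A" by (rule push_nonzero[OF c0 that])
    have "slit.jac (S c0) (S c) ?y (0, b) = (0, ?J b)"
      using dd_slit_transition_fst(2)[OF y, of c0 c b] c c0 by simp
    then show ?thesis by (simp add: slit_chart_simps push_coord[OF c0])
  qed
  have ch: "dd f' (?u, w) (0, b) = dd f (?\<Psi> (?u, w)) (0, ?J b)"
    if f: "smooth_on (W c) f" and f': "smooth_on ?Q f'" and e: "\<And>w. w \<noteq> 0 \<Longrightarrow> f' (?u, w) = f (?\<Psi> (?u, w))" and w: "w \<noteq> 0"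
    for f f' :: "'e \<times> 'e \<Rightarrow> real" and w b
  proof -
    have fd: "f differentiable (at (?\<Psi> (?u, w)))" by (rule smooth_on_differentiable[OF f \<Psi>W[OF uQ[OF w]]])
    have sc: "smooth_on ?Q (\<lambda>q. f (?\<Psi> q))"
      by (rule smooth_on_compose[OF Q open_W[OF m(1)] _ st f]) (use \<Psi>W in blast)
    have "dd f' (?u, w) (0, b) = dd (\<lambda>q. f (?\<Psi> q)) (?u, w) (0, b)"
      by (rule dd_vertical_cong[OF Q uQ[OF w] smooth_on_differentiable[OF f' uQ[OF w]] smooth_on_differentiable[OF sc uQ[OF w]] e]) auto
    also have "\<dots> = dd f (?\<Psi> (?u, w)) (dd ?\<Psi> (?u, w) (0, b))"
      by (rule dd_compose[OF smooth_on_differentiable[OF st uQ[OF w]] fd])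
    finally show ?thesis by (simp only: vert[OF w])
  qed
  have dE: "dd (E c0) (?u, w) (0, b) = dd (E c) (?\<Psi> (?u, w)) (0, ?J b)" if "w \<noteq> 0" for w b
    by (rule ch[OF smooth_E[OF m(1)] smooth_on_subset[OF smooth_E[OF m0(1)] QW] E0[OF uQ] that])
  have zw: "snd z c0 \<noteq> 0" by (rule TM0_coord_nonzero[OF z c0])
  have "dd (\<lambda>p. dd (E c0) p (0, b)) (?u, snd z c0) (0, a) = dd (\<lambda>p. dd (E c) p (0, ?J b)) (?\<Psi> (?u, snd z c0)) (0, ?J a)"
    by (rule ch[OF smooth_dE[OF m(1)] smooth_on_subset[OF smooth_dE[OF m0(1)] QW] dE zw])
  moreover have "?\<Psi> (?u, snd z c0) = snd (S c) z"
    using slit.transition_coord[OF slit_chart_in[OF m0(1)], of z "S c"] z m0 by (simp add: slit_chart_simps)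
  ultimately show ?thesis by (simp add: G_def slit_chart_simps)
qed

lemma finsler_metric_coord:
  assumes z: "z \<in> TM0 A" and c: "c \<in> charts_at A (fst z)"
    and a: "a \<in> tangent_space A (fst z)" and b: "b \<in> tangent_space A (fst z)"
  shows "finsler_metric A F z a b = G c (snd (S c) z) (a c) (b c)"
proof -
  define c0 where "c0 = some_chart A (fst z)"
  have c0: "c0 \<in> charts_at A (fst z)" unfolding c0_def by (rule some_chart[OF c])
  note m0 = charts_atD[OF c0]
  let ?q = "snd (S c0) z"
  have q: "?q \<in> W c0" using m0 TM0_coord_nonzero[OF z c0] by (auto simp: slit_chart_simps)
  have mc: "metric_coeff A F c0 z i j = G c0 ?q i j" for i j
    by (simp add: metric_coeff_def Let_def G_def E_def)
  have "finsler_metric A F z a b = (\<Sum>i\<in>Basis. \<Sum>j\<in>Basis. G c0 ?q i j * (a c0 \<bullet> i) * (b c0 \<bullet> j))"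
    by (simp add: finsler_metric_def Let_def c0_def[symmetric] mc)
  also have "\<dots> = (\<Sum>i\<in>Basis. (a c0 \<bullet> i) *\<^sub>R (\<Sum>j\<in>Basis. (b c0 \<bullet> j) *\<^sub>R G c0 ?q i j))"
    by (simp add: sum_distrib_left mult_ac)
  also have "\<dots> = G c0 ?q (a c0) (b c0)"
    unfolding linear_family_expand[OF G_linear(2)[OF m0(1) q], symmetric]
      linear_family_expand[OF G_linear(1)[OF m0(1) q], symmetric] ..
  finally show ?thesis
    unfolding G_change_chart[OF z c c0] tangent_coord[OF a c0 c] tangent_coord[OF b c0 c] .
qed

lemma G_pos: assumes c: "c \<in> A" and q: "q \<in> W c" and a: "a \<noteq> 0" shows "0 < G c q a a"
proof -
  let ?z = "chart_inv (S c) q"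
  note z = chart_inv_slit[OF c q]
  have t: "push c (fst ?z) a \<in> tangent_space A (fst ?z)" by (rule push_tangent[OF z(2)])
  have "push c (fst ?z) a \<noteq> 0" using push_coord[OF z(2), of a] a by auto
  then have "0 < finsler_metric A F ?z (push c (fst ?z) a) (push c (fst ?z) a)"
    using bspec[OF bspec[OF metric_pos z(1)] t] by simp
  then show ?thesis using finsler_metric_coord[OF z(1,2) t t] z(3) by (simp add: push_coord[OF z(2)])
qed

end

subsection \<open>The connection form of a chart\<close>

text \<open>The set \<open>P\<close> is where the cutoff function \<open>h\<close> is \<open>1\<close>; over \<open>P\<close> the cut-off coordinate fields
  \<open>ext\<close> and \<open>sec\<close> are the coordinate fields. Points over \<open>P\<close> are written \<open>pt q\<close> with their coordinates
  \<open>q\<close>.\<close>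

locale finsler_chart = finsler_cartan A M F D
  for A :: "('m, 'e::euclidean_space) chart set" and M and F :: "('m, 'e) tpoint \<Rightarrow> real" and D :: "('m, 'e) conn" +
  fixes c :: "('m, 'e) chart" and h :: "'m \<Rightarrow> real" and P :: "'e set"
  assumes cutoff: "cutoff c h" and open_P: "open P" and P_sub: "P \<subseteq> snd c ` fst c"
    and h_one: "u \<in> P \<Longrightarrow> h (chart_inv c u) = 1"
begin

lemma cA: "c \<in> A" using cutoff by (simp add: cutoff_def)

definition Q where "Q = P \<times> (- {0::'e})"

abbreviation pt where "pt q \<equiv> chart_inv (S c) q"

abbreviation hh where "hh \<equiv> (\<lambda>z. if z \<in> TM0 A then h (fst z) else 0)"

lemma open_QQ: "open Q" unfolding Q_def by (rule open_slit[OF open_P])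

lemma Q_W: "q \<in> Q \<Longrightarrow> q \<in> W c" using P_sub by (auto simp: Q_def)

lemma Q_sub: "Q \<subseteq> W c" using Q_W by blast

lemmas pt_TM0 = chart_inv_slit(1)[OF cA Q_W]
  and pt_chart = chart_inv_slit(2)[OF cA Q_W]
  and pt_coord = chart_inv_slit(3)[OF cA Q_W]
  and pt_base = chart_inv_slit(4)[OF cA Q_W]

lemma pt_slit: "q \<in> Q \<Longrightarrow> S c \<in> charts_at (slit_atlas A) (pt q)"
  by (rule slit_charts_atI[OF pt_TM0 pt_chart])

lemma hh_one: "q \<in> Q \<Longrightarrow> hh (pt q) = 1" "q \<in> Q \<Longrightarrow> h (fst (pt q)) = 1"
  using pt_TM0 pt_base h_one by (auto simp: Q_def)

lemma cutoff_hh: "slit.cutoff (S c) hh" by (rule cutoff_slit[OF cutoff])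

abbreviation vec where "vec q \<xi> \<equiv> slit.push (S c) (pt q) \<xi>"

lemma vec: assumes "q \<in> Q" shows "vec q \<xi> \<in> T (pt q)" "vec q \<xi> (S c) = \<xi>"
  by (rule slit.push_tangent[OF pt_slit[OF assms]] slit.push_coord[OF pt_slit[OF assms]])+

lemma vec_eq: "q \<in> Q \<Longrightarrow> \<xi> \<in> T (pt q) \<Longrightarrow> vec q (\<xi> (S c)) = \<xi>"
  by (rule slit.push_coords[OF _ pt_slit])

definition ext :: "'e \<times> 'e \<Rightarrow> ('m, 'e) tfield"
  where "ext \<xi> = (\<lambda>z. hh z *\<^sub>R slit.push (S c) z \<xi>)"

lemma ext_field: "vector_field (slit_atlas A) (ext \<xi>)"
  unfolding ext_def by (rule slit.cutoff_field[OF cutoff_hh, of "\<lambda>_. \<xi>"]) (rule smooth_on_const)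

lemma ext_pt: "q \<in> Q \<Longrightarrow> ext \<xi> (pt q) = vec q \<xi>"
  by (simp add: ext_def hh_one(2) pt_TM0)

definition sec :: "'e \<Rightarrow> ('m, 'e) psection" where "sec w = cut_section c h (\<lambda>_. w)"

lemma sec_section: "pullback_section A (sec w)"
  unfolding sec_def by (rule cut_section[OF cutoff smooth_on_const])

lemma sec_pt: assumes "q \<in> Q" shows "sec w (pt q) = push c (fst (pt q)) w" "sec w (pt q) c = w"
proof -
  show "sec w (pt q) = push c (fst (pt q)) w"
    unfolding sec_def cut_section_def using pt_TM0[OF assms] by (simp only: if_True hh_one(2)[OF assms] scaleR_one)
  then show "sec w (pt q) c = w" by (simp add: push_coord[OF pt_chart[OF assms]])
qed

lemma h_out: "x \<notin> fst c \<Longrightarrow> h x = 0" using cutoff by (simp add: cutoff_def)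

lemma sec_plus: "sec (a + b) = sec a + sec b"
proof (rule ext)
  fix z show "sec (a + b) z = (sec a + sec b) z"
  proof (cases "fst z \<in> fst c")
    case True
    then have "c \<in> charts_at A (fst z)" using cA by (simp add: charts_at_def)
    then show ?thesis using linear_add[OF push_linear] by (simp add: sec_def cut_section_def scaleR_add_right)
  next
    case False then show ?thesis by (simp add: sec_def cut_section_def h_out)
  qed
qed

lemma sec_scale: "sec (r *\<^sub>R a) = (\<lambda>z. r *\<^sub>R sec a z)"
proof (rule ext)
  fix z show "sec (r *\<^sub>R a) z = r *\<^sub>R sec a z"
  proof (cases "fst z \<in> fst c")
    case True
    then have "c \<in> charts_at A (fst z)" using cA by (simp add: charts_at_def)
    then show ?thesis using linear_cmul[OF push_linear] by (simp add: sec_def cut_section_def)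
  next
    case False then show ?thesis by (simp add: sec_def cut_section_def h_out)
  qed
qed

definition om :: "'e \<times> 'e \<Rightarrow> 'e \<times> 'e \<Rightarrow> 'e \<Rightarrow> 'e"
  where "om q \<xi> w = D (pt q) (vec q \<xi>) (sec w) c"

lemma om_linear: assumes q: "q \<in> Q" shows "linear (\<lambda>\<xi>. om q \<xi> w)" "linear (\<lambda>w. om q \<xi> w)"
proof -
  note lin = slit.push_linear[OF pt_slit[OF q]]
  show "linear (\<lambda>\<xi>. om q \<xi> w)"
  proof (rule linearI)
    show "om q (a + b) w = om q a w + om q b w" for a b
      unfolding om_def linear_add[OF lin] D_add[OF pt_TM0[OF q] sec_section vec(1)[OF q] vec(1)[OF q]]
      by (rule plus_fun_apply)
    show "om q (r *\<^sub>R a) w = r *\<^sub>R om q a w" for r a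
      unfolding om_def linear_cmul[OF lin] D_scale[OF pt_TM0[OF q] sec_section vec(1)[OF q]]
      by (rule scaleR_fun_apply)
  qed
  show "linear (\<lambda>w. om q \<xi> w)"
  proof (rule linearI)
    show "om q \<xi> (a + b) = om q \<xi> a + om q \<xi> b" for a b
      unfolding om_def sec_plus D_plus[OF pt_TM0[OF q] vec(1)[OF q] sec_section sec_section]
      by (rule plus_fun_apply)
    show "om q \<xi> (r *\<^sub>R a) = r *\<^sub>R om q \<xi> a" for r a
      unfolding om_def sec_scale D_const[OF pt_TM0[OF q] vec(1)[OF q] sec_section]
      by (rule scaleR_fun_apply)
  qed
qed

lemma om_smooth: "smooth_on Q (\<lambda>q. om q \<xi> w)"
proof (rule smooth_on_cong[OF open_QQ _ smooth_on_subset[OF section_smooth[OF covd_section[OF ext_field sec_section] cA] Q_sub]])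
  show "covd A D (ext \<xi>) (sec w) (pt q) c = om q \<xi> w" if "q \<in> Q" for q
    using pt_TM0[OF that] by (simp add: covd_def extend_by_zero_def om_def ext_pt[OF that])
qed

text \<open>The coordinate expression of a connection that is defined on global sections. With \<open>f0\<close> the
  square of the cutoff function, \<open>f0 Y\<close> is the sum of the global sections \<open>f i * sec i\<close>, where \<open>f i\<close> is the
  cut-off \<open>i\<close>-th component of \<open>Y\<close>; the Leibniz rule applies to both sides, and \<open>f0 = 1\<close> near \<open>pt q\<close>.\<close>

lemma D_coord:
  assumes q: "q \<in> Q" and Y: "pullback_section A Y" and \<xi>: "\<xi> \<in> T (pt q)"
  shows "D (pt q) \<xi> Y c = dd (\<lambda>p. Y (pt p) c) q (\<xi> (S c)) + om q (\<xi> (S c)) (Y (pt q) c)"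
proof -
  let ?Y = "\<lambda>p. Y (pt p) c"
  note z = pt_TM0[OF q] and sc = slit_chart_in[OF cA]
  have imW: "snd (S c) ` fst (S c) = W c" by (rule slit_image_self[OF cA])
  have sY: "smooth_on (W c) ?Y" by (rule section_smooth[OF Y cA])
  define f where "f i = (\<lambda>z. hh z * (\<lambda>p. ?Y p \<bullet> i) (snd (S c) z))" for i
  define f0 where "f0 = (\<lambda>z. hh z * (\<lambda>p. hh (pt p)) (snd (S c) z))"
  have sf: "smooth_function (slit_atlas A) (f i)" for i
    unfolding f_def by (rule slit.cutoff_function[OF cutoff_hh, of "\<lambda>p. ?Y p \<bullet> i"])
      (simp only: imW smooth_on_inner[OF open_W[OF cA] sY smooth_on_const])
  have shh: "smooth_on (snd (S c) ` fst (S c)) (\<lambda>p. hh (pt p))" using cutoff_hh by (simp add: slit.cutoff_def)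
  have sf0: "smooth_function (slit_atlas A) f0"
    unfolding f0_def by (rule slit.cutoff_function[OF cutoff_hh shh])
  have eq: "(\<lambda>z. f0 z *\<^sub>R Y z) = (\<lambda>z. \<Sum>i\<in>Basis. f i z *\<^sub>R sec i z)"
  proof (rule ext)
    fix z
    show "f0 z *\<^sub>R Y z = (\<Sum>i\<in>Basis. f i z *\<^sub>R sec i z)"
    proof (cases "z \<in> fst (S c)")
      case True
      then have z: "z \<in> TM0 A" "c \<in> charts_at A (fst z)" using cA by (auto simp: slit_chart_simps charts_at_def)
      have inv: "pt (snd (S c) z) = z" by (rule slit.chart_inv_coord[OF sc True])
      have "Y z = push c (fst z) (Y z c)" by (rule push_coords[OF section_tangent[OF Y z(1)] z(2), symmetric])
      also have "\<dots> = (\<Sum>i\<in>Basis. (Y z c \<bullet> i) *\<^sub>R push c (fst z) i)"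
      proof -
        have "push c (fst z) (Y z c) = push c (fst z) (\<Sum>i\<in>Basis. (Y z c \<bullet> i) *\<^sub>R i)"
          by (simp only: euclidean_representation)
        then show ?thesis by (simp only: linear_sum[OF push_linear[OF z(2)]] linear_cmul[OF push_linear[OF z(2)]])
      qed
      finally have Yz: "Y z = (\<Sum>i\<in>Basis. (Y z c \<bullet> i) *\<^sub>R push c (fst z) i)" .
      have "f0 z *\<^sub>R Y z = (hh z * hh z) *\<^sub>R (\<Sum>i\<in>Basis. (Y z c \<bullet> i) *\<^sub>R push c (fst z) i)"
        unfolding f0_def inv Yz[symmetric] ..
      also have "\<dots> = (\<Sum>i\<in>Basis. f i z *\<^sub>R sec i z)"
        unfolding scaleR_sum_right f_def inv sec_def cut_section_def using z(1)
        by (intro sum.cong refl) (simp only: if_True scaleR_scaleR mult_ac)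
      finally show ?thesis .
    next
      case False
      then have "hh z = 0" using h_out by (auto simp: slit_chart_simps)
      then show ?thesis unfolding f0_def f_def by (simp only: mult_zero_left scaleR_zero_left sum.neutral_const)
    qed
  qed
  have one: "f0 (pt p) = 1" and fi: "f i (pt p) = ?Y p \<bullet> i" if "p \<in> Q" for p i
    using hh_one(1)[OF that] pt_coord[OF that] by (simp_all only: f0_def f_def mult_1)
  have dc: "deriv_along (slit_atlas A) (pt q) \<xi> k = dd (\<lambda>p. k (pt p)) q (\<xi> (S c))" if "smooth_function (slit_atlas A) k" for k
  proof -
    have "smooth_on (W c) (\<lambda>p. k (pt p))"
      using bspec[OF that[unfolded smooth_function_def] sc] unfolding imW o_def .
    then have "(\<lambda>p. k (pt p)) differentiable (at q)" by (rule smooth_on_differentiable[OF _ Q_W[OF q]])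
    then show ?thesis using slit.deriv_along_coord[OF pt_slit[OF q] \<xi>, of k] by (simp only: pt_coord[OF q])
  qed
  have d0: "deriv_along (slit_atlas A) (pt q) \<xi> f0 = 0"
  proof -
    have "dd (\<lambda>p. f0 (pt p)) q = dd (\<lambda>p. 1) q" by (rule frechet_derivative_cong_open[OF open_QQ q one])
    then show ?thesis by (simp add: dc[OF sf0])
  qed
  have di: "deriv_along (slit_atlas A) (pt q) \<xi> (f i) = dd ?Y q (\<xi> (S c)) \<bullet> i" for i
  proof -
    have "dd (\<lambda>p. f i (pt p)) q = dd (\<lambda>p. ?Y p \<bullet> i) q" by (rule frechet_derivative_cong_open[OF open_QQ q fi])
    moreover have "dd (\<lambda>p. ?Y p \<bullet> i) q w = dd ?Y q w \<bullet> i" for w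
      by (rule dd_bounded_linear[OF bounded_linear_inner_left smooth_on_differentiable[OF sY Q_W[OF q]]])
    ultimately show ?thesis by (simp add: dc[OF sf])
  qed
  have "D (pt q) \<xi> Y = D (pt q) \<xi> (\<lambda>z. f0 z *\<^sub>R Y z)"
    unfolding D_leibniz[OF z \<xi> sf0 Y] d0 one[OF q] by (simp only: scaleR_zero_left scaleR_one add_0_left)
  also have "\<dots> = (\<Sum>i\<in>Basis. D (pt q) \<xi> (\<lambda>z. f i z *\<^sub>R sec i z))"
    unfolding eq by (rule conjunct1[OF D_sum[OF z \<xi> finite_Basis section_scale[OF sf sec_section]]])
  also have "\<dots> = (\<Sum>i\<in>Basis. (dd ?Y q (\<xi> (S c)) \<bullet> i) *\<^sub>R sec i (pt q) + (?Y q \<bullet> i) *\<^sub>R D (pt q) \<xi> (sec i))"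
    by (intro sum.cong refl) (simp only: D_leibniz[OF z \<xi> sf sec_section] di fi[OF q])
  finally have "D (pt q) \<xi> Y c = (\<Sum>i\<in>Basis. (dd ?Y q (\<xi> (S c)) \<bullet> i) *\<^sub>R sec i (pt q) + (?Y q \<bullet> i) *\<^sub>R D (pt q) \<xi> (sec i)) c"
    by simp
  also have "\<dots> = (\<Sum>i\<in>Basis. (dd ?Y q (\<xi> (S c)) \<bullet> i) *\<^sub>R i + (?Y q \<bullet> i) *\<^sub>R om q (\<xi> (S c)) i)"
    unfolding linear_sum[OF linear_eval[of c]]
    by (intro sum.cong refl) (simp only: plus_fun_apply scaleR_fun_apply sec_pt(2)[OF q] om_def vec_eq[OF q \<xi>])
  also have "\<dots> = dd ?Y q (\<xi> (S c)) + om q (\<xi> (S c)) (?Y q)"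
    by (simp only: sum.distrib euclidean_representation linear_family_expand[OF om_linear(2)[OF q], symmetric])
  finally show ?thesis .
qed

abbreviation g where "g \<equiv> G c"

lemma smooth_gQ: "smooth_on Q (\<lambda>q. g q a b)" by (rule smooth_on_subset[OF smooth_G[OF cA] Q_sub])

lemma metric_pt:
  "q \<in> Q \<Longrightarrow> a \<in> tangent_space A (fst (pt q)) \<Longrightarrow> b \<in> tangent_space A (fst (pt q)) \<Longrightarrow>
    finsler_metric A F (pt q) a b = g q (a c) (b c)"
  using finsler_metric_coord[OF pt_TM0 pt_chart] by (simp only: pt_coord)

lemma g_metric:
  assumes q: "q \<in> Q"
  shows "dd (\<lambda>q. g q a b) q \<xi> = g q (om q \<xi> a) b + g q a (om q \<xi> b)"
proof -
  note t = section_tangent[OF sec_section pt_TM0[OF q]]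
  let ?k = "\<lambda>z. finsler_metric A F z (sec a z) (sec b z)"
  have e: "?k (pt p) = g p a b" if "p \<in> Q" for p
    using metric_pt[OF that section_tangent[OF sec_section pt_TM0[OF that]] section_tangent[OF sec_section pt_TM0[OF that]]]
    by (simp only: sec_pt(2)[OF that])
  have "(\<lambda>p. ?k (pt p)) differentiable (at q)"
    by (rule differentiable_cong_open[OF smooth_on_differentiable[OF smooth_gQ q] open_QQ q e[symmetric]])
  then have "deriv_along (slit_atlas A) (pt q) (vec q \<xi>) ?k = dd (\<lambda>p. ?k (pt p)) q \<xi>"
    using slit.deriv_along_coord[OF pt_slit[OF q] vec(1)[OF q], of ?k] by (simp only: pt_coord[OF q] vec(2)[OF q])
  also have "dd (\<lambda>p. ?k (pt p)) q = dd (\<lambda>q. g q a b) q" by (rule frechet_derivative_cong_open[OF open_QQ q e])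
  finally have d: "deriv_along (slit_atlas A) (pt q) (vec q \<xi>) ?k = dd (\<lambda>q. g q a b) q \<xi>" .
  have compat: "deriv_along (slit_atlas A) (pt q) (vec q \<xi>) ?k
      = finsler_metric A F (pt q) (D (pt q) (vec q \<xi>) (sec a)) (sec b (pt q))
      + finsler_metric A F (pt q) (sec a (pt q)) (D (pt q) (vec q \<xi>) (sec b))"
    by (rule cartan[unfolded cartan_connection_def, THEN conjunct2, THEN conjunct1, rule_format,
          OF pt_TM0[OF q] vec(1)[OF q] conjI[OF sec_section sec_section]])
  show ?thesis
    using compat D_tangent[OF pt_TM0[OF q] sec_section vec(1)[OF q]] t
    unfolding d by (simp only: metric_pt[OF q] sec_pt(2)[OF q] om_def)
qed

lemma rho_ext: "rho A (ext \<xi>) = sec (fst \<xi>)"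
proof (rule ext)
  fix z
  show "rho A (ext \<xi>) z = sec (fst \<xi>) z"
  proof (cases "z \<in> TM0 A")
    case z: True
    have t: "ext \<xi> z \<in> T z" by (rule slit_field_tangent[OF ext_field z])
    have r: "rho A (ext \<xi>) z = rho_at A z (ext \<xi> z)" using z by (simp add: rho_def extend_by_zero_def)
    show ?thesis
    proof (cases "fst z \<in> fst c")
      case True
      then have cz: "c \<in> charts_at A (fst z)" using cA by (simp add: charts_at_def)
      have "ext \<xi> z (S c) = h (fst z) *\<^sub>R \<xi>"
        using slit.push_coord[OF slit_charts_atI[OF z cz]] z by (simp add: ext_def scaleR_fun_apply)
      then show ?thesis unfolding r rho_at_coord[OF z cz t] using z linear_cmul[OF push_linear[OF cz]]
        by (simp add: sec_def cut_section_def)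
    next
      case False
      obtain c' where c': "c' \<in> charts_at A (fst z)" using TM0D(3)[OF z] carrier_charts by blast
      have "ext \<xi> z (S c') = 0" using False by (simp add: ext_def scaleR_fun_apply h_out)
      then show ?thesis unfolding r rho_at_coord[OF z c' t] using False linear_0[OF push_linear[OF c']]
        by (simp add: sec_def cut_section_def h_out)
    qed
  qed (simp add: rho_def extend_by_zero_def sec_def cut_section_def)
qed

lemma rho_at_pt: "q \<in> Q \<Longrightarrow> \<xi> \<in> T (pt q) \<Longrightarrow> rho_at A (pt q) \<xi> = push c (fst (pt q)) (fst (\<xi> (S c)))"
  by (rule rho_at_coord[OF pt_TM0 pt_chart])

lemma bracket_pt:
  assumes q: "q \<in> Q" and X: "vector_field (slit_atlas A) X" and Y: "vector_field (slit_atlas A) Y"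
  shows "lie_bracket (slit_atlas A) X Y (pt q) \<in> T (pt q)"
    "lie_bracket (slit_atlas A) X Y (pt q) (S c) =
      dd (\<lambda>p. Y (pt p) (S c)) q (X (pt q) (S c)) - dd (\<lambda>p. X (pt p) (S c)) q (Y (pt q) (S c))"
proof -
  have "pt q \<in> carrier_of (slit_atlas A)" using pt_TM0[OF q] by (simp add: slit_carrier)
  then show "lie_bracket (slit_atlas A) X Y (pt q) \<in> T (pt q)"
    by (rule slit.lie_bracket_tangent[OF slit.open_subset_carrier _ X Y])
  show "lie_bracket (slit_atlas A) X Y (pt q) (S c) =
      dd (\<lambda>p. Y (pt p) (S c)) q (X (pt q) (S c)) - dd (\<lambda>p. X (pt p) (S c)) q (Y (pt q) (S c))"
    using pt_slit[OF q] by (simp only: lie_bracket_def if_True pt_coord[OF q])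
qed

lemma bracket_ext: assumes q: "q \<in> Q" shows "lie_bracket (slit_atlas A) (ext \<xi>) (ext \<zeta>) (pt q) (S c) = 0"
proof -
  have "dd (\<lambda>p. ext \<xi> (pt p) (S c)) q = dd (\<lambda>p. \<xi>) q" for \<xi>
    by (rule frechet_derivative_cong_open[OF open_QQ q]) (simp only: ext_pt vec)
  then show ?thesis by (simp add: bracket_pt(2)[OF q ext_field ext_field])
qed

text \<open>The vertical field \<open>ext (0, d)\<close> is its own vertical part, and coordinate fields commute.\<close>

lemma om_tors_v:
  assumes q: "q \<in> Q"
  shows "g q (om q (0, d) a) b = g q (om q (0, d) b) a"
proof -
  let ?X = "ext (0, d)"
  note z = pt_TM0[OF q]
  have hp: "hpart A D ?X = 0"
  proof (rule ext)
    fix z show "hpart A D ?X z = 0 z"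
    proof (cases "z \<in> TM0 A")
      case z: True
      have t: "?X z \<in> T z" by (rule slit_field_tangent[OF ext_field z])
      have "rho_at A z (?X z) = 0" using fun_cong[OF rho_ext[of "(0, d)"], of z] sec_scale[of 0 0] z
        by (simp add: rho_def extend_by_zero_def)
      then have "?X z - 0 \<in> vertical_space A z" using t by (simp add: vertical_space_def)
      moreover have "0 \<in> horizontal_space A D z" using mu_at_0[OF z] slit.tangent_zero by (simp add: horizontal_space_def)
      ultimately show ?thesis using hpart_unique[OF z, of ?X 0] t by simp
    qed (simp add: hpart_def extend_by_zero_def)
  qed
  then have vp: "vpart A D ?X = ?X" unfolding vpart_def by (simp only: hp diff_zero)
  have tor: "torsion A D ?X (ext (a, 0)) (pt q) \<in> tangent_space A (fst (pt q)) \<and>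
     torsion A D ?X (ext (a, 0)) (pt q) c = om q (0, d) a" for a
  proof -
    have r0: "rho A ?X = sec 0" using rho_ext[of "(0, d)"] by simp
    have ra: "rho A (ext (a, 0)) = sec a" using rho_ext[of "(a, 0)"] by simp
    have b: "rho A (lie_bracket (slit_atlas A) ?X (ext (a, 0))) (pt q) = 0"
    proof -
      have "rho_at A (pt q) (lie_bracket (slit_atlas A) ?X (ext (a, 0)) (pt q)) = push c (fst (pt q)) (fst (0 :: 'e \<times> 'e))"
        unfolding rho_at_pt[OF q bracket_pt(1)[OF q ext_field ext_field]] bracket_ext[OF q] ..
      then show ?thesis using linear_0[OF push_linear[OF pt_chart[OF q]]] z by (simp add: rho_def extend_by_zero_def)
    qed
    have e: "torsion A D ?X (ext (a, 0)) (pt q) = D (pt q) (vec q (0, d)) (sec a) - D (pt q) (vec q (a, 0)) (sec 0)"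
      using z by (simp only: torsion_def minus_apply b r0 ra covd_def extend_by_zero_def if_True ext_pt[OF q] diff_zero)
    show ?thesis
    proof
      show "torsion A D ?X (ext (a, 0)) (pt q) \<in> tangent_space A (fst (pt q))"
        unfolding e by (intro subspace_diff[OF tangent_subspace] D_tangent[OF z sec_section vec(1)[OF q]])
      have "torsion A D ?X (ext (a, 0)) (pt q) c = om q (0, d) a - om q (a, 0) 0"
        unfolding e om_def by (rule minus_apply)
      then show "torsion A D ?X (ext (a, 0)) (pt q) c = om q (0, d) a"
        by (simp only: linear_0[OF om_linear(2)[OF q]] diff_zero)
    qed
  qed
  have m: "finsler_metric A F (pt q) (torsion A D ?X (ext (a, 0)) (pt q)) (rho A (ext (b, 0)) (pt q)) = g q (om q (0, d) a) b" for a b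
    using metric_pt[OF q conjunct1[OF tor] section_tangent[OF sec_section z]]
    by (simp only: rho_ext fst_conv conjunct2[OF tor] sec_pt(2)[OF q])
  have "\<forall>X Y Z. vector_field (slit_atlas A) X \<and> vector_field (slit_atlas A) Y \<and> vector_field (slit_atlas A) Z \<longrightarrow>
       (\<forall>z\<in>TM0 A.
          finsler_metric A F z (torsion A D (vpart A D X) Y z) (rho A Z z) =
          finsler_metric A F z (torsion A D (vpart A D X) Z z) (rho A Y z))"
    by (rule cartan[unfolded cartan_connection_def, THEN conjunct2, THEN conjunct2, THEN conjunct2])
  then have "finsler_metric A F (pt q) (torsion A D (vpart A D ?X) (ext (a, 0)) (pt q)) (rho A (ext (b, 0)) (pt q)) =
          finsler_metric A F (pt q) (torsion A D (vpart A D ?X) (ext (b, 0)) (pt q)) (rho A (ext (a, 0)) (pt q))"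
    using ext_field z by blast
  then show ?thesis by (simp only: vp m)
qed

sublocale lmc: local_metric_connection Q om g
  by (rule local_metric_connection.intro)
    (rule open_QQ om_linear(1) om_linear(2) om_smooth G_linear(2)[OF cA Q_W] G_sym[OF cA Q_W]
      G_pos[OF cA Q_W] smooth_gQ G_vert_sym[OF cA Q_W] G_vert_v[OF cA Q_W] g_metric om_tors_v; assumption)+

end

subsection \<open>Horizontal and vertical lifts\<close>

context finsler_chart
begin

lemma mu_pt:
  assumes q: "q \<in> Q" and \<xi>: "\<xi> \<in> T (pt q)"
  shows "mu_at A D (pt q) \<xi> c = snd (\<xi> (S c)) + lmc.N q (fst (\<xi> (S c)))"
proof -
  have e: "canonical_section A (pt p) c = snd p" if "p \<in> Q" for p
    by (rule canonical_section_coord[OF cA Q_W[OF that]])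
  have "dd (\<lambda>p. canonical_section A (pt p) c) q = dd snd q"
    by (rule frechet_derivative_cong_open[OF open_QQ q e])
  then show ?thesis
    unfolding mu_at_def D_coord[OF q canonical_section_pullback \<xi>] e[OF q] lmc.om_v[OF q] by (simp only: dd_snd)
qed

lemma hor_pt:
  assumes q: "q \<in> Q"
  shows "\<xi> \<in> horizontal_space A D (pt q) \<longleftrightarrow> \<xi> \<in> T (pt q) \<and> \<xi> (S c) = lmc.H q (fst (\<xi> (S c)))"
proof -
  have "mu_at A D (pt q) \<xi> = 0 \<longleftrightarrow> \<xi> (S c) = lmc.H q (fst (\<xi> (S c)))" if t: "\<xi> \<in> T (pt q)"
  proof -
    have m: "mu_at A D (pt q) \<xi> \<in> tangent_space A (fst (pt q))"
      unfolding mu_at_def by (rule D_tangent[OF pt_TM0[OF q] canonical_section_pullback t])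
    have "mu_at A D (pt q) \<xi> = 0 \<longleftrightarrow> mu_at A D (pt q) \<xi> c = 0"
      using tangent_eqI[OF m tangent_zero pt_chart[OF q]] by auto
    also have "\<dots> \<longleftrightarrow> snd (\<xi> (S c)) = - lmc.N q (fst (\<xi> (S c)))"
      unfolding mu_pt[OF q t] by (simp add: eq_neg_iff_add_eq_0)
    finally show ?thesis by (simp add: lmc.H_def prod_eq_iff)
  qed
  then show ?thesis by (auto simp: horizontal_space_def)
qed

lemma ver_pt:
  assumes q: "q \<in> Q"
  shows "\<xi> \<in> vertical_space A (pt q) \<longleftrightarrow> \<xi> \<in> T (pt q) \<and> fst (\<xi> (S c)) = 0"
proof -
  have "rho_at A (pt q) \<xi> = 0 \<longleftrightarrow> fst (\<xi> (S c)) = 0" if t: "\<xi> \<in> T (pt q)"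
    unfolding rho_at_pt[OF q t]
    using push_coord[OF pt_chart[OF q], of "fst (\<xi> (S c))"] linear_0[OF push_linear[OF pt_chart[OF q]]] by auto
  then show ?thesis by (auto simp: vertical_space_def)
qed

lemma hpart_pt:
  assumes q: "q \<in> Q" and X: "X (pt q) \<in> T (pt q)"
  shows "hpart A D X (pt q) = vec q (lmc.H q (fst (X (pt q) (S c))))"
proof (rule hpart_unique[where X = X and z = "pt q", OF pt_TM0[OF q] X])
  let ?\<xi> = "vec q (lmc.H q (fst (X (pt q) (S c))))"
  show "?\<xi> \<in> horizontal_space A D (pt q)"
    unfolding hor_pt[OF q] vec(2)[OF q] using vec(1)[OF q] by (simp add: lmc.H_def)
  show "X (pt q) - ?\<xi> \<in> vertical_space A (pt q)"
    unfolding ver_pt[OF q] using subspace_diff[OF slit.tangent_subspace X vec(1)[OF q]]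
    by (simp add: vec(2)[OF q] lmc.H_def)
qed

lemma hlift_pt:
  assumes q: "q \<in> Q" and Y: "Y (pt q) \<in> tangent_space A (fst (pt q))"
  shows "hlift A D Y (pt q) = vec q (lmc.H q (Y (pt q) c))"
proof -
  let ?\<xi> = "vec q (lmc.H q (Y (pt q) c))"
  have "(THE \<xi>. \<xi> \<in> horizontal_space A D (pt q) \<and> rho_at A (pt q) \<xi> = Y (pt q)) = ?\<xi>"
  proof (rule the_equality)
    have "rho_at A (pt q) ?\<xi> = Y (pt q)"
      unfolding rho_at_pt[OF q vec(1)[OF q]] vec(2)[OF q] using push_coords[OF Y pt_chart[OF q]] by (simp add: lmc.H_def)
    then show "?\<xi> \<in> horizontal_space A D (pt q) \<and> rho_at A (pt q) ?\<xi> = Y (pt q)"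
      unfolding hor_pt[OF q] vec(2)[OF q] using vec(1)[OF q] by (simp add: lmc.H_def)
    fix \<zeta> assume z: "\<zeta> \<in> horizontal_space A D (pt q) \<and> rho_at A (pt q) \<zeta> = Y (pt q)"
    then have t: "\<zeta> \<in> T (pt q)" "\<zeta> (S c) = lmc.H q (fst (\<zeta> (S c)))" using hor_pt[OF q] by auto
    have "fst (\<zeta> (S c)) = Y (pt q) c"
      using z push_coord[OF pt_chart[OF q], of "fst (\<zeta> (S c))"] unfolding rho_at_pt[OF q t(1)] by simp
    then show "\<zeta> = ?\<xi>" using vec_eq[OF q t(1)] t(2) by simp
  qed
  then show ?thesis using pt_TM0[OF q] by (simp add: hlift_def extend_by_zero_def)
qed

lemma vlift_pt:
  assumes q: "q \<in> Q" and Y: "Y (pt q) \<in> tangent_space A (fst (pt q))"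
  shows "vlift A D Y (pt q) = vec q (0, Y (pt q) c)"
proof -
  let ?\<xi> = "vec q (0, Y (pt q) c)"
  have N0: "lmc.N q 0 = 0" by (rule linear_0[OF lmc.N_linear[OF q]])
  have "(THE \<xi>. \<xi> \<in> vertical_space A (pt q) \<and> mu_at A D (pt q) \<xi> = Y (pt q)) = ?\<xi>"
  proof (rule the_equality)
    have "mu_at A D (pt q) ?\<xi> = Y (pt q)"
    proof (rule tangent_eqI[OF _ Y pt_chart[OF q]])
      show "mu_at A D (pt q) ?\<xi> \<in> tangent_space A (fst (pt q))"
        unfolding mu_at_def by (rule D_tangent[OF pt_TM0[OF q] canonical_section_pullback vec(1)[OF q]])
      show "mu_at A D (pt q) ?\<xi> c = Y (pt q) c"
        unfolding mu_pt[OF q vec(1)[OF q]] vec(2)[OF q] by (simp add: N0)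
    qed
    then show "?\<xi> \<in> vertical_space A (pt q) \<and> mu_at A D (pt q) ?\<xi> = Y (pt q)"
      unfolding ver_pt[OF q] vec(2)[OF q] using vec(1)[OF q] by simp
    fix \<zeta> assume z: "\<zeta> \<in> vertical_space A (pt q) \<and> mu_at A D (pt q) \<zeta> = Y (pt q)"
    then have t: "\<zeta> \<in> T (pt q)" "fst (\<zeta> (S c)) = 0" using ver_pt[OF q] by auto
    have "snd (\<zeta> (S c)) = Y (pt q) c"
      using mu_pt[OF q t(1)] z t(2) N0 by simp
    then have "\<zeta> (S c) = (0, Y (pt q) c)" using t(2) by (simp add: prod_eq_iff)
    then show "\<zeta> = ?\<xi>" using vec_eq[OF q t(1)] by simp
  qed
  then show ?thesis using pt_TM0[OF q] by (simp add: vlift_def extend_by_zero_def)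
qed

lemma smooth_H_family: "smooth_on Q y \<Longrightarrow> smooth_on Q (\<lambda>q. lmc.H q (y q))"
  by (rule smooth_on_linear_family[of Q "lmc.H", OF open_QQ lmc.H_linear lmc.smooth_H])

lemma field_smooth_Q: "vector_field (slit_atlas A) X \<Longrightarrow> smooth_on Q (\<lambda>p. X (pt p) (S c))"
  by (rule smooth_on_subset[OF slit_field_smooth[OF _ cA] Q_sub])

lemma section_smooth_Q: "pullback_section A Y \<Longrightarrow> smooth_on Q (\<lambda>p. Y (pt p) c)"
  by (rule smooth_on_subset[OF section_smooth[OF _ cA] Q_sub])

lemma hpart_smooth_Q:
  assumes X: "vector_field (slit_atlas A) X" shows "smooth_on Q (\<lambda>p. hpart A D X (pt p) (S c))"
proof (rule smooth_on_cong[OF open_QQ _ smooth_H_family[OF smooth_on_fst[OF open_QQ field_smooth_Q[OF X]]]])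
  show "lmc.H p (fst (X (pt p) (S c))) = hpart A D X (pt p) (S c)" if "p \<in> Q" for p
    by (simp only: hpart_pt[where X = X, OF that slit_field_tangent[OF X pt_TM0[OF that]]] vec(2)[OF that])
qed

lemma hlift_smooth_Q:
  assumes Y: "pullback_section A Y" shows "smooth_on Q (\<lambda>p. hlift A D Y (pt p) (S c))"
proof (rule smooth_on_cong[OF open_QQ _ smooth_H_family[OF section_smooth_Q[OF Y]]])
  show "lmc.H p (Y (pt p) c) = hlift A D Y (pt p) (S c)" if "p \<in> Q" for p
    by (simp only: hlift_pt[of p Y, OF that section_tangent[OF Y pt_TM0[OF that]]] vec(2)[OF that])
qed

lemma vlift_smooth_Q:
  assumes Y: "pullback_section A Y" shows "smooth_on Q (\<lambda>p. vlift A D Y (pt p) (S c))"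
proof (rule smooth_on_cong[OF open_QQ _ smooth_on_Pair[OF open_QQ smooth_on_const section_smooth_Q[OF Y]]])
  show "(0, Y (pt p) c) = vlift A D Y (pt p) (S c)" if "p \<in> Q" for p
    by (simp only: vlift_pt[of p Y, OF that section_tangent[OF Y pt_TM0[OF that]]] vec(2)[OF that])
qed

end

context finsler_cartan
begin

lemma finsler_chart_exists:
  assumes x: "x \<in> carrier_of A"
  obtains c h P where "finsler_chart A M F D c h P" "c \<in> charts_at A x" "snd c x \<in> P"
proof -
  obtain c where c: "c \<in> charts_at A x" using x carrier_charts by blast
  obtain h P where "cutoff c h" "open P" "snd c x \<in> P" "P \<subseteq> snd c ` fst c" "\<forall>u\<in>P. h (chart_inv c u) = 1"
    using cutoff_exists[OF manifold charts_atD[OF c]] by blast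
  then have "finsler_chart A M F D c h P" by unfold_locales auto
  then show ?thesis using that c \<open>snd c x \<in> P\<close> by blast
qed

text \<open>Charts as above cover the manifold. Smoothness of horizontal parts and of lifts, which are
  defined pointwise, is therefore read off from their coordinate expressions.\<close>

lemma slit_field_localI:
  assumes t: "\<And>z. z \<notin> TM0 A \<Longrightarrow> X z = 0"
    and loc: "\<And>c h P q. finsler_chart A M F D c h P \<Longrightarrow> q \<in> finsler_chart.Q P \<Longrightarrow> X (chart_inv (S c) q) \<in> T (chart_inv (S c) q)"
    and sm: "\<And>c h P. finsler_chart A M F D c h P \<Longrightarrow> smooth_on (finsler_chart.Q P) (\<lambda>p. X (chart_inv (S c) p) (S c))"
  shows "vector_field (slit_atlas A) X"
proof -
  have ex: "\<exists>c h P. finsler_chart A M F D c h P \<and> c \<in> charts_at A (fst z) \<and> snd (S c) z \<in> finsler_chart.Q P"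
    if z: "z \<in> TM0 A" for z
  proof -
    obtain c h P where c: "finsler_chart A M F D c h P" "c \<in> charts_at A (fst z)" "snd c (fst z) \<in> P"
      using finsler_chart_exists[OF TM0D(3)[OF z]] by blast
    interpret fc: finsler_chart A M F D c h P by (rule c(1))
    have "snd (S c) z \<in> fc.Q" using c(3) TM0_coord_nonzero[OF z c(2)] by (simp add: fc.Q_def slit_chart_simps)
    then show ?thesis using c by blast
  qed
  show ?thesis
  proof (rule slit.vector_field_localI)
    show "X z = 0" if "z \<notin> carrier_of (slit_atlas A)" for z using t that by (simp add: slit_carrier)
    fix z assume "z \<in> carrier_of (slit_atlas A)"
    then have z: "z \<in> TM0 A" by (simp add: slit_carrier)
    obtain c h P where c: "finsler_chart A M F D c h P" "c \<in> charts_at A (fst z)" "snd (S c) z \<in> finsler_chart.Q P"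
      using ex[OF z] by blast
    interpret fc: finsler_chart A M F D c h P by (rule c(1))
    have zc: "z \<in> fst (S c)" using z charts_atD(2)[OF c(2)] by (simp add: slit_chart_simps)
    have inv: "chart_inv (S c) (snd (S c) z) = z" by (rule slit.chart_inv_coord[OF slit_chart_in[OF fc.cA] zc])
    show "X z \<in> T z" using loc[OF c(1,3)] by (simp only: inv)
    have "fst (S c) \<inter> carrier_of (slit_atlas A) = fst (S c)" by (auto simp: slit_carrier slit_chart_simps)
    then have "snd (S c) ` (fst (S c) \<inter> carrier_of (slit_atlas A)) = W c" by (simp only: slit_image_self[OF fc.cA])
    then show "\<exists>C\<in>charts_at (slit_atlas A) z. \<exists>Wa. open Wa \<and> snd C z \<in> Wa \<and> Wa \<subseteq> snd C ` (fst C \<inter> carrier_of (slit_atlas A)) \<and>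
         smooth_on Wa (\<lambda>u. X (chart_inv C u) C)"
      using fc.open_QQ c(3) fc.Q_sub sm[OF c(1)] by (intro bexI[OF _ slit_charts_atI[OF z c(2)]] exI[of _ fc.Q]) simp
  qed
qed

lemma hpart_field: assumes X: "vector_field (slit_atlas A) X" shows "vector_field (slit_atlas A) (hpart A D X)"
proof (rule slit_field_localI)
  show "hpart A D X z = 0" if "z \<notin> TM0 A" for z using that by (simp add: hpart_def extend_by_zero_def)
  fix c h P assume fc: "finsler_chart A M F D c h P"
  interpret fc: finsler_chart A M F D c h P by (rule fc)
  show "smooth_on fc.Q (\<lambda>p. hpart A D X (chart_inv (S c) p) (S c))" by (rule fc.hpart_smooth_Q[OF X])
  show "hpart A D X (chart_inv (S c) q) \<in> T (chart_inv (S c) q)" if "q \<in> fc.Q" for q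
    unfolding fc.hpart_pt[where X = X, OF that slit_field_tangent[OF X fc.pt_TM0[OF that]]] by (rule fc.vec(1)[OF that])
qed

lemma hlift_field: assumes Y: "pullback_section A Y" shows "vector_field (slit_atlas A) (hlift A D Y)"
proof (rule slit_field_localI)
  show "hlift A D Y z = 0" if "z \<notin> TM0 A" for z using that by (simp add: hlift_def extend_by_zero_def)
  fix c h P assume fc: "finsler_chart A M F D c h P"
  interpret fc: finsler_chart A M F D c h P by (rule fc)
  show "smooth_on fc.Q (\<lambda>p. hlift A D Y (chart_inv (S c) p) (S c))" by (rule fc.hlift_smooth_Q[OF Y])
  show "hlift A D Y (chart_inv (S c) q) \<in> T (chart_inv (S c) q)" if "q \<in> fc.Q" for q
    unfolding fc.hlift_pt[of q Y, OF that section_tangent[OF Y fc.pt_TM0[OF that]]] by (rule fc.vec(1)[OF that])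
qed

lemma vlift_field: assumes Y: "pullback_section A Y" shows "vector_field (slit_atlas A) (vlift A D Y)"
proof (rule slit_field_localI)
  show "vlift A D Y z = 0" if "z \<notin> TM0 A" for z using that by (simp add: vlift_def extend_by_zero_def)
  fix c h P assume fc: "finsler_chart A M F D c h P"
  interpret fc: finsler_chart A M F D c h P by (rule fc)
  show "smooth_on fc.Q (\<lambda>p. vlift A D Y (chart_inv (S c) p) (S c))" by (rule fc.vlift_smooth_Q[OF Y])
  show "vlift A D Y (chart_inv (S c) q) \<in> T (chart_inv (S c) q)" if "q \<in> fc.Q" for q
    unfolding fc.vlift_pt[of q Y, OF that section_tangent[OF Y fc.pt_TM0[OF that]]] by (rule fc.vec(1)[OF that])
qed

lemma curvature_tangent:
  assumes z: "z \<in> TM0 A" and X: "vector_field (slit_atlas A) X" and Y: "vector_field (slit_atlas A) Y" and Z: "pullback_section A Z"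
  shows "curvature A D X Y Z z \<in> tangent_space A (fst z)"
proof -
  have "lie_bracket (slit_atlas A) X Y z \<in> T z"
    by (rule slit.lie_bracket_tangent[OF slit.open_subset_carrier _ X Y]) (simp add: slit_carrier z)
  then have "covd A D (lie_bracket (slit_atlas A) X Y) Z z \<in> tangent_space A (fst z)"
    using D_tangent[OF z Z] z by (simp add: covd_def extend_by_zero_def)
  moreover have "curvature A D X Y Z z = covd A D X (covd A D Y Z) z - covd A D Y (covd A D X Z) z
      - covd A D (lie_bracket (slit_atlas A) X Y) Z z"
    by (simp add: curvature_def)
  ultimately show ?thesis
    by (simp only:) (intro subspace_diff[OF tangent_subspace] section_tangent[OF covd_section[OF X covd_section[OF Y Z]] z]
        section_tangent[OF covd_section[OF Y covd_section[OF X Z]] z])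
qed

end

context finsler_chart
begin

text \<open>The bracket of the horizontal lifts of two coordinate fields is vertical, so that the torsion
  reduces to the difference of the two covariant derivatives.\<close>

lemma om_tors_h: assumes q: "q \<in> Q" shows "om q (lmc.H q a) b = om q (lmc.H q b) a"
proof -
  let ?X = "ext (a, 0)" and ?Y = "ext (b, 0)"
  let ?hX = "hpart A D ?X" and ?hY = "hpart A D ?Y"
  note z = pt_TM0[OF q]
  have hp: "hpart A D (ext (a, 0)) (pt p) = vec p (lmc.H p a)" if "p \<in> Q" for p a
    using hpart_pt[where X = "ext (a, 0)", OF that slit_field_tangent[OF ext_field pt_TM0[OF that]]] by (simp only: ext_pt[OF that] vec(2)[OF that] fst_conv)
  have dh: "dd (\<lambda>p. hpart A D (ext (a, 0)) (pt p) (S c)) q \<xi> = (0, - lmc.dN q \<xi> a)" for a \<xi>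
  proof -
    have "dd (\<lambda>p. hpart A D (ext (a, 0)) (pt p) (S c)) q = dd (\<lambda>p. lmc.H p a) q"
      by (rule frechet_derivative_cong_open[OF open_QQ q]) (simp only: hp vec(2))
    then show ?thesis by (simp only: lmc.dd_H[OF q])
  qed
  have "fst (lie_bracket (slit_atlas A) ?hX ?hY (pt q) (S c)) = 0"
    unfolding bracket_pt(2)[OF q hpart_field[OF ext_field] hpart_field[OF ext_field]] dh by simp
  then have b: "rho A (lie_bracket (slit_atlas A) ?hX ?hY) (pt q) = 0"
    using rho_at_pt[OF q bracket_pt(1)[OF q hpart_field[OF ext_field] hpart_field[OF ext_field]]]
      linear_0[OF push_linear[OF pt_chart[OF q]]] z by (simp add: rho_def extend_by_zero_def)
  have "\<forall>X Y. vector_field (slit_atlas A) X \<and> vector_field (slit_atlas A) Y \<longrightarrow> torsion A D (hpart A D X) (hpart A D Y) = 0"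
    by (rule cartan[unfolded cartan_connection_def, THEN conjunct2, THEN conjunct2, THEN conjunct1])
  then have "torsion A D ?hX ?hY = 0" using ext_field by blast
  then have "torsion A D ?hX ?hY (pt q) c = 0" by simp
  moreover have "torsion A D ?hX ?hY (pt q) = D (pt q) (vec q (lmc.H q a)) (sec b) - D (pt q) (vec q (lmc.H q b)) (sec a)"
    using z by (simp only: torsion_def minus_apply b rho_hpart[OF ext_field] rho_ext fst_conv covd_def extend_by_zero_def if_True hp[OF q] diff_zero)
  ultimately show ?thesis by (simp add: om_def)
qed

sublocale lc: local_cartan Q om g
  by (rule local_cartan.intro[OF lmc.local_metric_connection_axioms])
    (rule local_cartan_axioms.intro, rule om_tors_h)

subsection \<open>Curvature and nullity in a chart\<close>

lemma covd_pt:
  assumes p: "p \<in> Q" and X: "vector_field (slit_atlas A) X" and Z: "pullback_section A Z"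
  shows "covd A D X Z (pt p) c = dd (\<lambda>p. Z (pt p) c) p (X (pt p) (S c)) + om p (X (pt p) (S c)) (Z (pt p) c)"
  using pt_TM0[OF p] D_coord[OF p Z slit_field_tangent[OF X pt_TM0[OF p]]] by (simp add: covd_def extend_by_zero_def)

lemma covd_covd_pt:
  assumes q: "q \<in> Q" and X: "vector_field (slit_atlas A) X" and Y: "vector_field (slit_atlas A) Y" and Z: "pullback_section A Z"
  shows "covd A D X (covd A D Y Z) (pt q) c =
    dd (\<lambda>p. dd (\<lambda>p. Z (pt p) c) p (Y (pt q) (S c))) q (X (pt q) (S c))
    + dd (\<lambda>p. Z (pt p) c) q (dd (\<lambda>p. Y (pt p) (S c)) q (X (pt q) (S c)))
    + (lmc.d_om q (X (pt q) (S c)) (Y (pt q) (S c)) (Z (pt q) c)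
      + om q (dd (\<lambda>p. Y (pt p) (S c)) q (X (pt q) (S c))) (Z (pt q) c)
      + om q (Y (pt q) (S c)) (dd (\<lambda>p. Z (pt p) c) q (X (pt q) (S c))))
    + om q (X (pt q) (S c)) (dd (\<lambda>p. Z (pt p) c) q (Y (pt q) (S c)) + om q (Y (pt q) (S c)) (Z (pt q) c))"
proof -
  let ?Z = "\<lambda>p. Z (pt p) c" and ?Y = "\<lambda>p. Y (pt p) (S c)" and ?x = "X (pt q) (S c)"
  note sZ = section_smooth_Q[OF Z] and sY = field_smooth_Q[OF Y]
  have s1: "smooth_on Q (\<lambda>p. dd ?Z p (?Y p))" by (rule smooth_on_dd[OF open_QQ sZ sY])
  have s2: "smooth_on Q (\<lambda>p. om p (?Y p) (?Z p))" by (rule lmc.smooth_om[OF sY sZ])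
  have "dd (\<lambda>p. covd A D Y Z (pt p) c) q = dd (\<lambda>p. dd ?Z p (?Y p) + om p (?Y p) (?Z p)) q"
    by (rule frechet_derivative_cong_open[OF open_QQ q covd_pt[OF _ Y Z]])
  moreover have "dd (\<lambda>p. dd ?Z p (?Y p) + om p (?Y p) (?Z p)) q ?x = dd (\<lambda>p. dd ?Z p (?Y p)) q ?x + dd (\<lambda>p. om p (?Y p) (?Z p)) q ?x"
    by (rule dd_add[OF smooth_on_differentiable[OF s1 q] smooth_on_differentiable[OF s2 q]])
  moreover have "dd (\<lambda>p. dd ?Z p (?Y p)) q ?x = dd (\<lambda>p. dd ?Z p (?Y q)) q ?x + dd ?Z q (dd ?Y q ?x)"
    by (rule dd_linear_family[of Q q "\<lambda>p. dd ?Z p", OF open_QQ q smooth_on_linear_dd[OF sZ]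
          smooth_on_dd_const[OF open_QQ sZ] smooth_on_differentiable[OF sY q]])
  moreover have "dd (\<lambda>p. om p (?Y p) (?Z p)) q ?x = lmc.d_om q ?x (?Y q) (?Z q) + om q (dd ?Y q ?x) (?Z q) + om q (?Y q) (dd ?Z q ?x)"
    unfolding lmc.d_om_def by (rule lmc.dd_om[OF q smooth_on_differentiable[OF sY q] smooth_on_differentiable[OF sZ q]])
  ultimately show ?thesis
    unfolding covd_pt[OF q X covd_section[OF Y Z]] covd_pt[OF q Y Z] by simp
qed

lemma curvature_pt:
  assumes q: "q \<in> Q" and X: "vector_field (slit_atlas A) X" and Y: "vector_field (slit_atlas A) Y" and Z: "pullback_section A Z"
  shows "curvature A D X Y Z (pt q) c = lmc.Om q (X (pt q) (S c)) (Y (pt q) (S c)) (Z (pt q) c)"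
proof -
  let ?Z = "\<lambda>p. Z (pt p) c" and ?Y = "\<lambda>p. Y (pt p) (S c)" and ?X = "\<lambda>p. X (pt p) (S c)"
  note sZ = section_smooth_Q[OF Z]
  let ?b = "dd ?Y q (?X q) - dd ?X q (?Y q)"
  have br: "covd A D (lie_bracket (slit_atlas A) X Y) Z (pt q) c = dd ?Z q ?b + om q ?b (?Z q)"
    using pt_TM0[OF q] D_coord[OF q Z bracket_pt(1)[OF q X Y]]
    by (simp add: covd_def extend_by_zero_def bracket_pt(2)[OF q X Y])
  have com: "dd (\<lambda>p. dd ?Z p (?Y q)) q (?X q) = dd (\<lambda>p. dd ?Z p (?X q)) q (?Y q)"
    by (rule dd_dd_commute[OF open_QQ q sZ])
  have l: "dd ?Z q ?b = dd ?Z q (dd ?Y q (?X q)) - dd ?Z q (dd ?X q (?Y q))"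
    by (rule linear_diff[OF smooth_on_linear_dd[OF sZ q]])
  show ?thesis
    unfolding curvature_def minus_apply covd_covd_pt[OF q X Y Z] covd_covd_pt[OF q Y X Z] br com l
    by (simp add: lmc.Om_def lmc.om_simps[OF q] algebra_simps)
qed

text \<open>The term in \<open>P\<close> vanishes: \<open>\<mu>\<close> is zero on the horizontal vector \<open>Y\<close>, and both arguments of the
  antisymmetric part enter linearly.\<close>

lemma related_pt:
  assumes q: "q \<in> Q" and X: "vector_field (slit_atlas A) X" and Y: "vector_field (slit_atlas A) Y" and Z: "pullback_section A Z"
    and hX: "X (pt q) \<in> horizontal_space A D (pt q)" and hY: "Y (pt q) \<in> horizontal_space A D (pt q)"
  shows "related_curvature A F D k X Y Z (pt q) \<in> tangent_space A (fst (pt q))"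
    "related_curvature A F D k X Y Z (pt q) c = lc.Rb k q (fst (X (pt q) (S c))) (fst (Y (pt q) (S c))) (Z (pt q) c)"
proof -
  note z = pt_TM0[OF q]
  let ?mY = "mu A D Y"
  have mY: "pullback_section A ?mY" unfolding mu_def by (rule covd_section[OF Y canonical_section_pullback])
  have mY0: "?mY (pt q) c = 0" using hY z by (simp add: mu_def covd_def extend_by_zero_def horizontal_space_def mu_at_def)
  note rX = rho_section[OF X]
  have rc: "rho A X (pt q) c = fst (X (pt q) (S c))" if X: "vector_field (slit_atlas A) X" for X
    using z rho_at_pt[OF q slit_field_tangent[OF X z]] push_coord[OF pt_chart[OF q]] by (simp add: rho_def extend_by_zero_def)
  have hv: "hv_curvature A D U V Z (pt q) c = lmc.Om q (lmc.H q (U (pt q) c)) (0, V (pt q) c) (Z (pt q) c)"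
    if U: "pullback_section A U" and V: "pullback_section A V" for U V
    unfolding hv_curvature_def curvature_pt[OF q hlift_field[OF U] vlift_field[OF V] Z]
      hlift_pt[of q U, OF q section_tangent[OF U z]] vlift_pt[of q V, OF q section_tangent[OF V z]] vec(2)[OF q] ..
  have "hv_curvature A D (rho A X) ?mY Z (pt q) c = 0"
    unfolding hv[OF rX mY] mY0 zero_prod_def[symmetric] by (rule linear_0[OF lmc.Om_linear(2)[OF q]])
  moreover have "hv_curvature A D ?mY (rho A X) Z (pt q) c = 0"
    unfolding hv[OF mY rX] mY0 linear_0[OF lmc.H_linear[OF q]] by (rule linear_0[OF lmc.Om_linear(1)[OF q]])
  ultimately have anti: "hv_curvature_antisym A D (rho A X) ?mY Z (pt q) c = 0"
    unfolding hv_curvature_antisym_def by (simp only: scaleR_fun_apply minus_apply diff_zero scaleR_zero_right)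
  have "hv_curvature_antisym A D (rho A X) ?mY Z (pt q)
      = (1/2) *\<^sub>R (hv_curvature A D (rho A X) ?mY Z (pt q) - hv_curvature A D ?mY (rho A X) Z (pt q))"
    unfolding hv_curvature_antisym_def by (simp only: scaleR_fun_apply minus_apply)
  then have hvt: "hv_curvature_antisym A D (rho A X) ?mY Z (pt q) \<in> tangent_space A (fst (pt q))"
    using subspace_scale[OF tangent_subspace subspace_diff[OF tangent_subspace
        curvature_tangent[OF z hlift_field[OF rX] vlift_field[OF mY] Z] curvature_tangent[OF z hlift_field[OF mY] vlift_field[OF rX] Z]], of "1/2"]
    unfolding hv_curvature_def by simp
  note tX = section_tangent[OF rX z] and tY = section_tangent[OF rho_section[OF Y] z] and tZ = section_tangent[OF Z z]
  have e: "related_curvature A F D k X Y Z (pt q) = curvature A D X Y Z (pt q) - (k *\<^sub>R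
      (finsler_metric A F (pt q) (rho A Y (pt q)) (Z (pt q)) *\<^sub>R rho A X (pt q)
       - finsler_metric A F (pt q) (rho A X (pt q)) (Z (pt q)) *\<^sub>R rho A Y (pt q))
      + hv_curvature_antisym A D (rho A X) ?mY Z (pt q))"
    by (simp only: related_curvature_def eta_def minus_apply)
  show "related_curvature A F D k X Y Z (pt q) \<in> tangent_space A (fst (pt q))"
    unfolding e
    by (intro subspace_diff[OF tangent_subspace] subspace_add[OF tangent_subspace] subspace_scale[OF tangent_subspace]
        curvature_tangent[OF z X Y Z] tX tY hvt)
  have h: "X (pt q) (S c) = lmc.H q (fst (X (pt q) (S c)))" "Y (pt q) (S c) = lmc.H q (fst (Y (pt q) (S c)))"
    using hX hY hor_pt[OF q] by blast+
  have R: "lmc.Om q (X (pt q) (S c)) (Y (pt q) (S c)) w = lc.R q (fst (X (pt q) (S c))) (fst (Y (pt q) (S c))) w" for w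
    unfolding lc.R_def using h by simp
  show "related_curvature A F D k X Y Z (pt q) c = lc.Rb k q (fst (X (pt q) (S c))) (fst (Y (pt q) (S c))) (Z (pt q) c)"
    unfolding e minus_apply plus_fun_apply scaleR_fun_apply curvature_pt[OF q X Y Z] R anti
      metric_pt[OF q tX tZ] metric_pt[OF q tY tZ] rc[OF X] rc[OF Y]
    by (simp add: lc.Rb_def lc.B_def)
qed

text \<open>\<open>K k q\<close> consists of the coordinates of the nullity vectors at \<open>pt q\<close>.\<close>

definition K :: "real \<Rightarrow> 'e \<times> 'e \<Rightarrow> 'e set" where "K k q = {a. \<forall>b w. lc.Rb k q a b w = 0}"

lemma nullity_hspace_pt:
  assumes q: "q \<in> Q"
  shows "\<xi> \<in> nullity_hspace A F D k (pt q) \<longleftrightarrow> \<xi> \<in> horizontal_space A D (pt q) \<and> fst (\<xi> (S c)) \<in> K k q"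
proof (intro iffI conjI)
  assume n: "\<xi> \<in> nullity_hspace A F D k (pt q)"
  then show h: "\<xi> \<in> horizontal_space A D (pt q)" by (simp add: nullity_hspace_def)
  then have t: "\<xi> \<in> T (pt q)" using hor_pt[OF q] by blast
  have eX: "ext (\<xi> (S c)) (pt q) = \<xi>" using ext_pt[OF q] vec_eq[OF q t] by simp
  have "lc.Rb k q (fst (\<xi> (S c))) b w = 0" for b w
  proof -
    have eY: "ext (lmc.H q b) (pt q) (S c) = lmc.H q b" using ext_pt[OF q] vec(2)[OF q] by simp
    have hY: "ext (lmc.H q b) (pt q) \<in> horizontal_space A D (pt q)"
      unfolding hor_pt[OF q] eY using slit_field_tangent[OF ext_field pt_TM0[OF q]] by (simp add: lmc.H_def)
    have f: "fst (lmc.H q b) = b" by (simp add: lmc.H_def)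
    have hX: "ext (\<xi> (S c)) (pt q) \<in> horizontal_space A D (pt q)" using h eX by simp
    have "related_curvature A F D k (ext (\<xi> (S c))) (ext (lmc.H q b)) (sec w) (pt q) = 0"
      using n eX hY ext_field sec_section unfolding nullity_hspace_def by blast
    then have "related_curvature A F D k (ext (\<xi> (S c))) (ext (lmc.H q b)) (sec w) (pt q) c = 0" by simp
    from trans[OF related_pt(2)[OF q ext_field ext_field sec_section hX hY, symmetric] this]
    show ?thesis unfolding eX eY f sec_pt(2)[OF q] .
  qed
  then show "fst (\<xi> (S c)) \<in> K k q" by (simp add: K_def)
next
  assume a: "\<xi> \<in> horizontal_space A D (pt q) \<and> fst (\<xi> (S c)) \<in> K k q"
  have "related_curvature A F D k X Y Z (pt q) = 0"
    if X: "vector_field (slit_atlas A) X" and Y: "vector_field (slit_atlas A) Y" and Z: "pullback_section A Z"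
      and eX: "X (pt q) = \<xi>" and hY: "Y (pt q) \<in> horizontal_space A D (pt q)" for X Y Z
  proof -
    have hX: "X (pt q) \<in> horizontal_space A D (pt q)" using a eX by simp
    show ?thesis
    proof (rule tangent_eqI[OF related_pt(1)[OF q X Y Z hX hY] tangent_zero pt_chart[OF q]])
      show "related_curvature A F D k X Y Z (pt q) c = 0 c"
        using a unfolding related_pt(2)[OF q X Y Z hX hY] eX by (simp add: K_def)
    qed
  qed
  then show "\<xi> \<in> nullity_hspace A F D k (pt q)" using a unfolding nullity_hspace_def by blast
qed

lemma nullity_image:
  assumes q: "q \<in> Q"
  shows "rho_at A (pt q) ` nullity_hspace A F D k (pt q) = push c (fst (pt q)) ` K k q"
proof (intro set_eqI iffI)
  fix t assume "t \<in> rho_at A (pt q) ` nullity_hspace A F D k (pt q)"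
  then obtain \<xi> where \<xi>: "\<xi> \<in> nullity_hspace A F D k (pt q)" "t = rho_at A (pt q) \<xi>" by blast
  then have h: "\<xi> \<in> T (pt q)" "fst (\<xi> (S c)) \<in> K k q" using nullity_hspace_pt[OF q] hor_pt[OF q] by auto
  then show "t \<in> push c (fst (pt q)) ` K k q" using \<xi>(2) rho_at_pt[OF q h(1)] by simp
next
  fix t assume "t \<in> push c (fst (pt q)) ` K k q"
  then obtain a where a: "a \<in> K k q" "t = push c (fst (pt q)) a" by blast
  let ?\<xi> = "vec q (lmc.H q a)"
  have f: "fst (lmc.H q a) = a" by (simp add: lmc.H_def)
  have "?\<xi> \<in> nullity_hspace A F D k (pt q)"
    unfolding nullity_hspace_pt[OF q] hor_pt[OF q] vec(2)[OF q] f using a vec(1)[OF q] by simp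
  moreover have "t = rho_at A (pt q) ?\<xi>" unfolding rho_at_pt[OF q vec(1)[OF q]] vec(2)[OF q] f a(2) ..
  ultimately show "t \<in> rho_at A (pt q) ` nullity_hspace A F D k (pt q)" by blast
qed

lemma nullity_space_pt:
  assumes q: "q \<in> Q" and ind: "nullity_independent_of_direction A F D k"
  shows "nullity_space A F D k (chart_inv c (fst q)) = push c (chart_inv c (fst q)) ` K k q"
proof -
  note z = pt_TM0[OF q] and b = pt_base[OF q]
  have "rho_at A w ` nullity_hspace A F D k w = rho_at A (pt q) ` nullity_hspace A F D k (pt q)"
    if "w \<in> TM0 A" "fst w = chart_inv c (fst q)" for w
    by (rule ind[unfolded nullity_independent_of_direction_def, rule_format, OF that(1) z]) (simp only: that(2) b)
  then have "nullity_space A F D k (chart_inv c (fst q)) = rho_at A (pt q) ` nullity_hspace A F D k (pt q)"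
    unfolding nullity_space_def using z b by blast
  then show ?thesis unfolding nullity_image[OF q] b .
qed

lemma K_subspace: assumes "q \<in> Q" shows "subspace (K k q)"
  using linear_0[OF lc.Rb_linear(1)[OF assms]] linear_add[OF lc.Rb_linear(1)[OF assms]] linear_cmul[OF lc.Rb_linear(1)[OF assms]]
  by (simp add: subspace_def K_def)

end

section \<open>Smooth frames of kernels\<close>

lemma dim_injective_image:
  fixes f :: "'a::euclidean_space \<Rightarrow> 'b::real_vector"
  assumes f: "linear f" "inj f" and V: "subspace V"
  shows "dim (f ` V) = dim V"
proof -
  obtain B where B: "B \<subseteq> V" "independent B" "V \<subseteq> span B" "card B = dim V" using basis_exists[of V] by blast
  have "span B = V" using B V span_minimal by blast
  then have "span (f ` B) = f ` V" using linear_span_image[OF f(1), of B] by simp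
  then have "span (f ` B) = span (f ` V)" using linear_subspace_image[OF f(1) V] span_eq_iff by metis
  moreover have "independent (f ` B)" by (rule linear_independent_injective_image[OF f(1) B(2) inj_on_subset[OF f(2) subset_UNIV]])
  ultimately have "dim (f ` V) = card (f ` B)" by (rule dim_eq_card)
  then show ?thesis using card_image[OF inj_on_subset[OF f(2)], of B] B(4) by simp
qed

text \<open>The subspaces \<open>Ker u\<close> are the null spaces of positive semidefinite forms \<open>s u\<close>. Let \<open>\<Phi> u\<close> be the
  symmetric operator of \<open>s u\<close> plus the orthogonal projection to \<open>Ker u0\<close>. It is positive definite at
  \<open>u0\<close>, hence injective nearby; it maps \<open>Ker u\<close> into \<open>Ker u0\<close>, and onto it as the dimensions agree.
  So solving \<open>\<Phi> u y = b\<close> for an orthonormal basis of \<open>Ker u0\<close> produces the frame.\<close>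

lemma kernel_frame:
  fixes s :: "'a::euclidean_space \<Rightarrow> 'b::euclidean_space \<Rightarrow> 'b \<Rightarrow> real"
  assumes S: "open S" "u0 \<in> S"
    and l1: "\<And>u b. u \<in> S \<Longrightarrow> linear (\<lambda>a. s u a b)"
    and sm: "\<And>a b. smooth_on S (\<lambda>u. s u a b)"
    and pos: "\<And>u a. u \<in> S \<Longrightarrow> 0 \<le> s u a a"
    and ker: "\<And>u a. u \<in> S \<Longrightarrow> a \<in> Ker u \<longleftrightarrow> (\<forall>b. s u a b = 0)"
    and ker2: "\<And>u a. u \<in> S \<Longrightarrow> s u a a = 0 \<Longrightarrow> a \<in> Ker u"
    and dim: "\<And>u. u \<in> S \<Longrightarrow> dim (Ker u) = r"
    and sub: "\<And>u. u \<in> S \<Longrightarrow> subspace (Ker u)"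
    and l2: "\<And>u a. u \<in> S \<Longrightarrow> linear (\<lambda>b. s u a b)"
  shows "\<exists>W y. open W \<and> u0 \<in> W \<and> W \<subseteq> S \<and> (\<forall>i<r. smooth_on W (y i)) \<and>
    (\<forall>u\<in>W. Ker u = span ((\<lambda>i. y i u) ` {..<r}))"
proof -
  obtain B where B: "B \<subseteq> Ker u0" "pairwise orthogonal B" "\<And>x. x \<in> B \<Longrightarrow> norm x = 1"
    "independent B" "card B = dim (Ker u0)" "span B = Ker u0"
    using orthonormal_basis_subspace[OF sub[OF S(2)]] by blast
  have finB: "finite B" using B(4) independent_imp_finite by blast
  have cB: "card B = r" using B(5) dim[OF S(2)] by simp
  define \<Phi> where "\<Phi> u a = (\<Sum>i\<in>Basis. s u a i *\<^sub>R i) + (\<Sum>b\<in>B. (a \<bullet> b) *\<^sub>R b)" for u a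
  have lin: "linear (\<Phi> u)" if "u \<in> S" for u
    unfolding \<Phi>_def[abs_def]
    by (intro linear_compose_add linear_compose_sum ballI)
      (use l1[OF that] in \<open>auto simp: linear_iff inner_add_left scaleR_add_left\<close>)
  have smP: "smooth_on S (\<lambda>u. \<Phi> u a)" for a
    unfolding \<Phi>_def by (intro smooth_on_add smooth_on_sum smooth_on_scaleR S(1) sm smooth_on_const)
  have inner: "\<Phi> u a \<bullet> a = s u a a + (\<Sum>b\<in>B. (a \<bullet> b)\<^sup>2)" if "u \<in> S" for u a
  proof -
    have "s u a a = (\<Sum>i\<in>Basis. (a \<bullet> i) *\<^sub>R s u a i)" by (rule linear_family_expand[OF l2[OF that]])
    moreover have "\<Phi> u a \<bullet> a = (\<Sum>i\<in>Basis. s u a i * (i \<bullet> a)) + (\<Sum>b\<in>B. (a \<bullet> b) * (b \<bullet> a))"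
      by (simp add: \<Phi>_def inner_add_left inner_sum_left)
    ultimately show ?thesis by (simp add: inner_commute[of _ a] power2_eq_square mult.commute)
  qed
  have inj0: "a = 0" if "\<Phi> u0 a = 0" for a
  proof -
    have z: "s u0 a a + (\<Sum>b\<in>B. (a \<bullet> b)\<^sup>2) = 0" using inner[OF S(2), of a] that by simp
    have n: "0 \<le> (\<Sum>b\<in>B. (a \<bullet> b)\<^sup>2)" by (intro sum_nonneg) simp
    have s0: "s u0 a a = 0" "(\<Sum>b\<in>B. (a \<bullet> b)\<^sup>2) = 0" using z n pos[OF S(2), of a] by linarith+
    have "a \<bullet> b = 0" if "b \<in> B" for b using s0(2) that finB by (simp add: sum_nonneg_eq_0_iff)
    then have "\<forall>b\<in>B. orthogonal a b" by (simp add: orthogonal_def)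
    then have "orthogonal a x" if "x \<in> span B" for x using orthogonal_to_span[OF that] by blast
    moreover have "a \<in> span B" using ker2[OF S(2) s0(1)] B(6) by simp
    ultimately have "orthogonal a a" by blast
    then show "a = 0" by (simp add: orthogonal_self)
  qed
  obtain G \<beta> W where W: "0 < (\<beta>::real)" "open W" "u0 \<in> W" "W \<subseteq> S" "\<forall>q\<in>W. \<forall>y. \<beta> * norm y \<le> norm (\<Phi> q y)"
    and "(G \<longlongrightarrow> (0::real)) (at u0)"
  proof -
    have "\<exists>G B T. 0 < B \<and> open T \<and> u0 \<in> T \<and> T \<subseteq> S \<and> (\<forall>q\<in>T. \<forall>y. B * norm y \<le> norm (\<Phi> q y)) \<and>
        (G \<longlongrightarrow> (0::real)) (at u0) \<and> (\<forall>q\<in>S. \<forall>y. norm (\<Phi> q y - \<Phi> u0 y) \<le> G q * norm y)"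
      by (rule linear_family_bounded_below[of S u0 \<Phi>, OF S lin smooth_on_imp_continuous[OF smP] inj0])
    then show thesis using that by blast
  qed
  have inj: "y = 0" if "u \<in> W" "\<Phi> u y = 0" for u y
  proof -
    have "\<beta> * norm y \<le> norm (\<Phi> u y)" using W(5) that(1) by blast
    then show ?thesis using W(1) by (simp add: that(2) mult_le_0_iff)
  qed
  have injW: "inj (\<Phi> u)" if "u \<in> W" for u
    using inj[OF that] lin W(4) that by (metis linear_injective_0 subsetD)
  have surj: "surj (\<Phi> u)" if "u \<in> W" for u
    using linear_injective_imp_surjective[OF lin injW[OF that]] W(4) that by blast
  define y where "y b u = inv (\<Phi> u) b" for b u
  have y: "\<Phi> u (y b u) = b" if "u \<in> W" for u b
    unfolding y_def by (rule surj_f_inv_f[OF surj[OF that]])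
  have smy: "smooth_on W (y b)" for b
    by (rule smooth_on_linear_solve[of W \<Phi> "\<lambda>_. b", OF W(2) lin smooth_on_subset[OF smP W(4)] inj smooth_on_const y])
      (use W(4) in blast)+
  have im: "\<Phi> u ` Ker u = Ker u0" if u: "u \<in> W" for u
  proof -
    have uS: "u \<in> S" using u W(4) by blast
    have sub': "\<Phi> u ` Ker u \<subseteq> Ker u0"
    proof
      fix x assume "x \<in> \<Phi> u ` Ker u"
      then obtain a where a: "a \<in> Ker u" "x = \<Phi> u a" by blast
      have "x = (\<Sum>b\<in>B. (a \<bullet> b) *\<^sub>R b)" using a ker[OF uS] by (simp add: \<Phi>_def)
      also have "\<dots> \<in> span B" by (intro span_sum span_scale span_base)
      finally show "x \<in> Ker u0" using B(6) by simp
    qed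
    have "dim (\<Phi> u ` Ker u) = dim (Ker u0)"
      using dim_injective_image[OF lin[OF uS] injW[OF u] sub[OF uS]] dim[OF uS] dim[OF S(2)] by simp
    then show ?thesis
      using subspace_dim_equal[OF linear_subspace_image[OF lin[OF uS] sub[OF uS]] sub[OF S(2)] sub'] by simp
  qed
  have kspan: "Ker u = span ((\<lambda>b. y b u) ` B)" if u: "u \<in> W" for u
  proof -
    have uS: "u \<in> S" using u W(4) by blast
    have "\<Phi> u ` ((\<lambda>b. y b u) ` B) = B" using y[OF u] by (simp add: image_image)
    then have "\<Phi> u ` span ((\<lambda>b. y b u) ` B) = span B"
      using linear_span_image[OF lin[OF uS], of "(\<lambda>b. y b u) ` B"] by simp
    then have "\<Phi> u ` span ((\<lambda>b. y b u) ` B) = \<Phi> u ` Ker u" using im[OF u] B(6) by simp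
    then show ?thesis using inj_image_eq_iff[OF injW[OF u]] by blast
  qed
  obtain e where e: "bij_betw e {0..<card B} B" using ex_bij_betw_nat_finite[OF finB] by blast
  have eB: "e ` {..<r} = B" using e cB by (simp add: bij_betw_def atLeast0LessThan)
  have "Ker u = span ((\<lambda>i. y (e i) u) ` {..<r})" if "u \<in> W" for u
    unfolding kspan[OF that] eB[symmetric] by (simp add: image_image)
  then show ?thesis using W(2-4) smy by (intro exI[of _ W] exI[of _ "\<lambda>i. y (e i)"]) simp
qed

section \<open>The nullity distribution\<close>

context finsler_chart
begin

text \<open>At a minimum of \<open>E\<close>, that is of \<open>F\<^sup>2\<close>, on a translate \<open>v0 + V\<close> that misses the origin, the
  fibre derivative \<open>2 g(v,\<cdot>)\<close> of \<open>E\<close> vanishes on \<open>V\<close>. A minimum exists because \<open>E\<close> grows quadratically.\<close>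

lemma orthogonal_direction:
  assumes u: "u \<in> P" and V: "subspace V" "V \<noteq> UNIV"
  shows "\<exists>v. v \<noteq> 0 \<and> (\<forall>a\<in>V. g (u, v) a v = 0)"
proof -
  obtain v0 where v0: "v0 \<notin> V" using V(2) by blast
  have uc: "u \<in> snd c ` fst c" using u P_sub by blast
  have W: "(u, w) \<in> W c" if "w \<noteq> 0" for w using uc that by simp
  define f where "f w = E c (u, w)" for w
  have cont: "continuous_on (- {0}) f"
  proof -
    have "continuous_on (- {0}) (\<lambda>w. (u, w))" by (intro continuous_intros)
    from continuous_on_compose2[OF smooth_on_imp_continuous[OF smooth_E[OF cA]] this] W
    show ?thesis by (auto simp: f_def)
  qed
  have pos: "0 < f w" if "w \<noteq> 0" for w unfolding f_def by (rule E_pos[OF cA W[OF that]])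
  have "sphere (0::'e) 1 \<noteq> {}" by simp
  then obtain w1 where w1: "w1 \<in> sphere 0 1" "\<And>w. w \<in> sphere 0 1 \<Longrightarrow> f w1 \<le> f w"
    using continuous_attains_inf[OF compact_sphere _ continuous_on_subset[OF cont], of 0 1] by force
  define m where "m = f w1"
  have m: "0 < m" unfolding m_def by (rule pos) (use w1 in auto)
  have lower: "m * (norm w)\<^sup>2 \<le> f w" if w: "w \<noteq> 0" for w
  proof -
    have "f (norm w *\<^sub>R (w /\<^sub>R norm w)) = norm w ^ Suc (Suc 0) * f (w /\<^sub>R norm w)"
      unfolding f_def by (rule E_homogeneous[OF cA uc]) (use w in auto)
    moreover have "m \<le> f (w /\<^sub>R norm w)" unfolding m_def by (rule w1(2)) (use w in simp)
    ultimately show ?thesis using w by (simp add: power2_eq_square mult.commute mult_left_mono)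
  qed
  have nz: "v0 + w \<noteq> 0" if "w \<in> V" for w
    using v0 subspace_neg[OF V(1) that] by (metis add_eq_0_iff2)
  \<comment> \<open>outside this compact set \<open>E\<close> exceeds its value at \<open>v0\<close>\<close>
  define C where "C = {w \<in> V. m * (norm (v0 + w))\<^sup>2 \<le> f v0}"
  have v00: "v0 \<noteq> 0" using v0 subspace_0[OF V(1)] by auto
  have C0: "0 \<in> C" using lower[OF v00] subspace_0[OF V(1)] by (simp add: C_def)
  have "closed C"
  proof -
    have "closed {w. m * (norm (v0 + w))\<^sup>2 \<le> f v0}" by (intro closed_Collect_le continuous_intros)
    moreover have "C = V \<inter> {w. m * (norm (v0 + w))\<^sup>2 \<le> f v0}" by (auto simp: C_def)
    ultimately show ?thesis using closed_subspace[OF V(1)] by auto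
  qed
  moreover have "bounded C"
    unfolding bounded_iff
  proof (intro exI ballI)
    fix w assume "w \<in> C"
    then have "(norm (v0 + w))\<^sup>2 \<le> f v0 / m" using m by (simp add: C_def field_simps)
    moreover have "norm (v0 + w) \<le> 1 + (norm (v0 + w))\<^sup>2"
    proof -
      have "0 \<le> (norm (v0 + w) - 1/2)\<^sup>2" by simp
      then show ?thesis by (simp add: power2_eq_square algebra_simps)
    qed
    moreover have "norm w \<le> norm (v0 + w) + norm v0" using norm_triangle_ineq4[of "v0 + w" v0] by simp
    ultimately show "norm w \<le> 1 + f v0 / m + norm v0" by linarith
  qed
  ultimately have "compact C" by (simp add: compact_eq_bounded_closed)
  moreover have "continuous_on C (\<lambda>w. f (v0 + w))"
    by (rule continuous_on_compose2[OF cont]) (auto intro!: continuous_intros simp: C_def nz)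
  ultimately obtain w0 where w0: "w0 \<in> C" "\<And>w. w \<in> C \<Longrightarrow> f (v0 + w0) \<le> f (v0 + w)"
    using continuous_attains_inf[of C "\<lambda>w. f (v0 + w)"] C0 by blast
  have w0V: "w0 \<in> V" using w0(1) by (simp add: C_def)
  have min: "f (v0 + w0) \<le> f (v0 + w)" if w: "w \<in> V" for w
  proof (cases "w \<in> C")
    case False
    then have "f v0 < m * (norm (v0 + w))\<^sup>2" using w by (simp add: C_def)
    also have "\<dots> \<le> f (v0 + w)" by (rule lower[OF nz[OF w]])
    finally show ?thesis using w0(2)[OF C0] by simp
  qed (rule w0(2))
  define v where "v = v0 + w0"
  have v: "v \<noteq> 0" unfolding v_def by (rule nz[OF w0V])
  have "g (u, v) a v = 0" if a: "a \<in> V" for a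
  proof -
    have d: "E c differentiable (at (u, v))" by (rule smooth_on_differentiable[OF smooth_E[OF cA] W[OF v]])
    have "((\<lambda>t. (u, v + t *\<^sub>R a)) has_derivative (\<lambda>t. (0, t *\<^sub>R a))) (at 0)"
      by (auto intro!: derivative_eq_intros)
    moreover have "(E c has_derivative dd (E c) (u, v)) (at ((\<lambda>t. (u, v + t *\<^sub>R a)) 0))"
      using d[unfolded frechet_derivative_works] by simp
    ultimately have "((\<lambda>t. E c (u, v + t *\<^sub>R a)) has_derivative (\<lambda>t. dd (E c) (u, v) (0, t *\<^sub>R a))) (at 0)"
      by (rule has_derivative_compose)
    moreover have "dd (E c) (u, v) (t *\<^sub>R (0, a)) = t *\<^sub>R dd (E c) (u, v) (0, a)" for t
      by (rule linear_cmul[OF linear_frechet_derivative[OF d]])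
    ultimately have "((\<lambda>t. E c (u, v + t *\<^sub>R a)) has_real_derivative dd (E c) (u, v) (0, a)) (at 0)"
      by (simp add: has_field_derivative_def mult_commute_abs)
    moreover have "E c (u, v + 0 *\<^sub>R a) \<le> E c (u, v + t *\<^sub>R a)" for t
    proof -
      have "w0 + t *\<^sub>R a \<in> V" using w0V a V(1) by (simp add: subspace_add subspace_scale)
      from min[OF this] show ?thesis by (simp add: f_def v_def add.assoc)
    qed
    ultimately have "dd (E c) (u, v) (0, a) = 0"
      using DERIV_local_min[of "\<lambda>t. E c (u, v + t *\<^sub>R a)" _ 0 1] by simp
    then have "2 * g (u, v) v a = 0" using G_v[OF cA W[OF v], of a] by simp
    then show ?thesis using G_sym[OF cA W[OF v], of a v] by simp
  qed
  then show ?thesis using v by blast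
qed

lemma K_direction:
  assumes q: "q \<in> Q" "q' \<in> Q" "fst q = fst q'" and ind: "nullity_independent_of_direction A F D k"
  shows "K k q = K k q'"
proof -
  have e: "push c (chart_inv c (fst q)) ` K k q = push c (chart_inv c (fst q)) ` K k q'"
    using nullity_space_pt[OF q(1) ind] nullity_space_pt[OF q(2) ind] q(3) by simp
  have "inj (push c (chart_inv c (fst q)))"
    using push_coord[OF pt_chart[OF q(1)]] unfolding pt_base[OF q(1)] by (metis injI)
  then show ?thesis using e inj_image_eq_iff by blast
qed

lemma dim_K:
  assumes q: "q \<in> Q" and ind: "nullity_independent_of_direction A F D k"
  shows "dim (K k q) = nullity_index A F D k (chart_inv c (fst q))"
proof -
  have ch: "c \<in> charts_at A (chart_inv c (fst q))" using pt_chart[OF q] by (simp only: pt_base[OF q])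
  have "inj (push c (chart_inv c (fst q)))" using push_coord[OF ch] by (metis injI)
  from dim_injective_image[OF push_linear[OF ch] this K_subspace[OF q]]
  show ?thesis by (simp add: nullity_index_def nullity_space_pt[OF q ind])
qed

text \<open>By independence of the direction one may use a constant direction \<open>e\<close> in the chart. The nullity
  space then is the null space of the form obtained from the squared coefficients of \<open>Rb\<close> at \<open>(u, e)\<close>.\<close>

lemma nullity_frame:
  assumes ind: "nullity_independent_of_direction A F D k" and u0: "u0 \<in> P"
    and dim: "\<And>u. u \<in> P \<Longrightarrow> nullity_index A F D k (chart_inv c u) = r"
  shows "\<exists>W y. open W \<and> u0 \<in> W \<and> W \<subseteq> P \<and> (\<forall>i<r. smooth_on W (y i)) \<and>
    (\<forall>u\<in>W. nullity_space A F D k (chart_inv c u) = span ((\<lambda>i. push c (chart_inv c u) (y i u)) ` {..<r}))"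
proof -
  obtain e :: 'e where e: "e \<in> Basis" using nonempty_Basis by blast
  have e0: "e \<noteq> 0" using e nonzero_Basis by blast
  have Qe: "(u, e) \<in> Q" if "u \<in> P" for u using that e0 by (simp add: Q_def)
  define s where "s u a b = (\<Sum>i\<in>Basis. \<Sum>j\<in>Basis. lc.Rb k (u, e) a i j \<bullet> lc.Rb k (u, e) b i j)" for u a b
  have sR: "smooth_on P (\<lambda>u. lc.Rb k (u, e) a i j)" for a i j
    by (rule smooth_on_compose[OF open_P open_QQ _ smooth_on_Pair[OF open_P smooth_on_ident smooth_on_const] lc.smooth_Rb])
      (use Qe in blast)
  note add = linear_add[OF lc.Rb_linear(1)[OF Qe]] and cmul = linear_cmul[OF lc.Rb_linear(1)[OF Qe]]
  have Rb0: "a \<in> K k (u, e)" if u: "u \<in> P" and z: "\<And>i j. i \<in> Basis \<Longrightarrow> j \<in> Basis \<Longrightarrow> lc.Rb k (u, e) a i j = 0" for u a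
  proof -
    have "lc.Rb k (u, e) a b w = 0" for b w
    proof -
      have 1: "lc.Rb k (u, e) a i w = 0" if "i \<in> Basis" for i
        unfolding linear_family_expand[OF lc.Rb_linear(3)[OF Qe[OF u], where k = k and a = a and b = i], of w]
        by (rule sum.neutral) (use z[OF that] in simp)
      show ?thesis
        unfolding linear_family_expand[OF lc.Rb_linear(2)[OF Qe[OF u], where k = k and a = a and w = w], of b]
        by (rule sum.neutral) (use 1 in simp)
    qed
    then show ?thesis by (simp add: K_def)
  qed
  have "\<exists>W y. open W \<and> u0 \<in> W \<and> W \<subseteq> P \<and> (\<forall>i<r. smooth_on W (y i)) \<and>
    (\<forall>u\<in>W. K k (u, e) = span ((\<lambda>i. y i u) ` {..<r}))"
  proof (rule kernel_frame[OF open_P u0, where s = s])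
    fix u assume u: "u \<in> P"
    show "linear (\<lambda>a. s u a b)" for b
      by (rule linearI) (simp_all add: s_def add[OF u] cmul[OF u] inner_add_left sum.distrib sum_distrib_left)
    show "linear (\<lambda>b. s u a b)" for a
      by (rule linearI) (simp_all add: s_def add[OF u] cmul[OF u] inner_add_right sum.distrib sum_distrib_left)
    show nn: "0 \<le> s u a a" for a unfolding s_def by (intro sum_nonneg) simp
    show k2: "a \<in> K k (u, e)" if "s u a a = 0" for a
    proof (rule Rb0[OF u])
      fix i j :: 'e assume ij: "i \<in> Basis" "j \<in> Basis"
      have "(\<Sum>j\<in>Basis. lc.Rb k (u, e) a i j \<bullet> lc.Rb k (u, e) a i j) = 0"
        using that ij(1) unfolding s_def by (simp add: sum_nonneg_eq_0_iff sum_nonneg)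
      then show "lc.Rb k (u, e) a i j = 0" using ij(2) by (simp add: sum_nonneg_eq_0_iff)
    qed
    show "a \<in> K k (u, e) \<longleftrightarrow> (\<forall>b. s u a b = 0)" for a
      using k2[of a] by (auto simp: K_def s_def)
    show "dim (K k (u, e)) = r" using dim_K[OF Qe[OF u] ind] dim[OF u] by simp
    show "subspace (K k (u, e))" by (rule K_subspace[OF Qe[OF u]])
  next
    show "smooth_on P (\<lambda>u. s u a b)" for a b
      unfolding s_def by (intro smooth_on_sum smooth_on_inner open_P sR)
  qed
  then obtain W y where W: "open W" "u0 \<in> W" "W \<subseteq> P" "\<forall>i<r. smooth_on W (y i)"
    "\<forall>u\<in>W. K k (u, e) = span ((\<lambda>i. y i u) ` {..<r})" by blast
  have "nullity_space A F D k (chart_inv c u) = span ((\<lambda>i. push c (chart_inv c u) (y i u)) ` {..<r})" if "u \<in> W" for u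
  proof -
    have uQ: "(u, e) \<in> Q" using that W(3) Qe by blast
    have ch: "c \<in> charts_at A (chart_inv c u)" using pt_chart[OF uQ] by (simp only: pt_base[OF uQ] fst_conv)
    have "nullity_space A F D k (chart_inv c u) = push c (chart_inv c u) ` span ((\<lambda>i. y i u) ` {..<r})"
      using nullity_space_pt[OF uQ ind] W(5) that by simp
    then show ?thesis using linear_span_image[OF push_linear[OF ch], of "(\<lambda>i. y i u) ` {..<r}"] by (simp add: image_image)
  qed
  then show ?thesis using W(1-4) by blast
qed

end

context finsler_cartan
begin

lemma finsler_chart_within:
  assumes V: "openin M V" and x: "x \<in> V"
  obtains c h P where "finsler_chart A M F D c h P" "c \<in> charts_at A x" "snd c x \<in> P" "P \<subseteq> snd c ` (fst c \<inter> V)"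
proof -
  have "x \<in> carrier_of A"
    using openin_subset[OF V] x manifold by (auto simp: smooth_manifold_def carrier_of_def)
  then obtain c h P where c: "finsler_chart A M F D c h P" "c \<in> charts_at A x" "snd c x \<in> P"
    using finsler_chart_exists by blast
  interpret fc: finsler_chart A M F D c h P by (rule c(1))
  let ?P = "P \<inter> snd c ` (fst c \<inter> V)"
  have "finsler_chart A M F D c h ?P"
    using fc.cutoff fc.open_P fc.P_sub fc.h_one manifold_chart_open[OF manifold fc.cA V]
    by unfold_locales auto
  moreover have "snd c x \<in> ?P" using c(3) x charts_atD(2)[OF c(2)] by blast
  ultimately show ?thesis using that c(2) by blast
qed

lemma nullity_distribution:
  assumes ind: "nullity_independent_of_direction A F D k" and U: "openin M U"
    and rank: "\<And>x. x \<in> U \<Longrightarrow> nullity_index A F D k x = r"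
  shows "distribution_on M A U r (nullity_space A F D k)"
  unfolding distribution_on_def
proof (intro conjI ballI)
  fix x assume x: "x \<in> U"
  obtain c h P where fc: "finsler_chart A M F D c h P" "c \<in> charts_at A x" "snd c x \<in> P" "P \<subseteq> snd c ` (fst c \<inter> U)"
    by (rule finsler_chart_within[OF U x])
  interpret fc: finsler_chart A M F D c h P by (rule fc(1))
  have inv: "chart_inv c (snd c x) = x" by (rule chart_inv_coord[OF charts_atD[OF fc(2)]])
  obtain e :: 'e where e: "e \<noteq> 0" using nonempty_Basis nonzero_Basis by blast
  have q: "(snd c x, e) \<in> fc.Q" using fc(3) e by (simp add: fc.Q_def)
  have ns: "nullity_space A F D k x = push c x ` fc.K k (snd c x, e)"
    using fc.nullity_space_pt[OF q ind] by (simp add: inv)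
  show "subspace (nullity_space A F D k x)"
    unfolding ns by (rule linear_subspace_image[OF push_linear[OF fc(2)] fc.K_subspace[OF q]])
  show "nullity_space A F D k x \<subseteq> tangent_space A x"
    unfolding ns using push_tangent[OF fc(2)] by blast
  show "dim (nullity_space A F D k x) = r" using rank[OF x] by (simp add: nullity_index_def)
  have "nullity_index A F D k (chart_inv c u) = r" if uP: "u \<in> P" for u
  proof (rule rank)
    obtain y where "y \<in> fst c" "y \<in> U" "u = snd c y" using fc(4) uP by blast
    then show "chart_inv c u \<in> U" using chart_inv_coord[OF fc.cA] by simp
  qed
  from fc.nullity_frame[OF ind fc(3) this]
  obtain W y where W: "open W" "snd c x \<in> W" "W \<subseteq> P" "\<forall>i<r. smooth_on W (y i)"
    "\<forall>u\<in>W. nullity_space A F D k (chart_inv c u) = span ((\<lambda>i. push c (chart_inv c u) (y i u)) ` {..<r})" by blast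
  have Wc: "W \<subseteq> snd c ` fst c" using W(3) fc.P_sub by blast
  define V where "V = chart_inv c ` W"
  have oV: "openin M V" unfolding V_def by (rule manifold_chart_inv_open[OF manifold fc.cA W(1) Wc])
  have VU: "V \<subseteq> U"
  proof
    fix z assume "z \<in> V"
    then obtain u where u: "u \<in> W" "z = chart_inv c u" by (auto simp: V_def)
    then obtain y where "y \<in> fst c" "y \<in> U" "u = snd c y" using fc(4) W(3) by blast
    then show "z \<in> U" using chart_inv_coord[OF fc.cA] u(2) by simp
  qed
  have Vc: "z \<in> fst c \<and> snd c z \<in> W" if zV: "z \<in> V" for z
  proof -
    obtain u where u: "u \<in> W" "z = chart_inv c u" using zV by (auto simp: V_def)
    then have "u \<in> snd c ` fst c" using Wc by blast
    then show ?thesis using u chart_inv_mem[OF fc.cA] coord_chart_inv[OF fc.cA] by simp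
  qed
  have cV: "c \<in> charts_at A z" if "z \<in> V" for z using Vc[OF that] fc.cA by (simp add: charts_at_def)
  define X where "X i z = (if z \<in> V then push c z (y i (snd c z)) else 0)" for i z
  have XV: "X i z = push c z (y i (snd c z))" if "z \<in> V" for i z using that by (simp add: X_def)
  have "vector_field_on A V (X i)" if i: "i < r" for i
  proof (rule vector_field_localI)
    show "X i z \<in> tangent_space A z" if "z \<in> V" for z unfolding XV[OF that] by (rule push_tangent[OF cV[OF that]])
    show "X i z = 0" if "z \<notin> V" for z using that by (simp add: X_def)
    fix z assume z: "z \<in> V"
    have "W \<subseteq> snd c ` (fst c \<inter> V)"
    proof
      fix u assume u: "u \<in> W"
      then have "chart_inv c u \<in> fst c \<inter> V" "snd c (chart_inv c u) = u"
        using Wc chart_inv_mem[OF fc.cA] coord_chart_inv[OF fc.cA] by (auto simp: V_def)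
      then show "u \<in> snd c ` (fst c \<inter> V)" by (metis imageI)
    qed
    moreover have "smooth_on W (\<lambda>u. X i (chart_inv c u) c)"
    proof (rule smooth_on_cong[OF W(1) _ W(4)[rule_format, OF i]])
      fix u assume u: "u \<in> W"
      then have v: "chart_inv c u \<in> V" "snd c (chart_inv c u) = u"
        using Wc coord_chart_inv[OF fc.cA] by (auto simp: V_def)
      show "y i u = X i (chart_inv c u) c" unfolding XV[OF v(1)] push_coord[OF cV[OF v(1)]] v(2) ..
    qed
    ultimately show "\<exists>c\<in>charts_at A z. \<exists>W. open W \<and> snd c z \<in> W \<and> W \<subseteq> snd c ` (fst c \<inter> V) \<and>
        smooth_on W (\<lambda>u. X i (chart_inv c u) c)"
      using cV[OF z] W(1) Vc[OF z] by blast
  qed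
  moreover have "nullity_space A F D k z = span ((\<lambda>i. X i z) ` {..<r})" if z: "z \<in> V" for z
  proof -
    have "chart_inv c (snd c z) = z" using Vc[OF z] chart_inv_coord[OF fc.cA] by blast
    then show ?thesis using W(5)[rule_format, of "snd c z"] Vc[OF z] by (simp add: XV[OF z])
  qed
  moreover have "x \<in> V" using W(2) inv by (metis V_def imageI)
  ultimately show "\<exists>V E. openin M V \<and> x \<in> V \<and> V \<subseteq> U \<and> (\<forall>i<r. vector_field_on A V (E i)) \<and>
       (\<forall>y\<in>V. nullity_space A F D k y = span ((\<lambda>i::nat. E i y) ` {..<r}))"
    using oV VU by (intro exI[of _ V] exI[of _ X]) simp
qed

text \<open>Both fields take values in the nullity spaces in all directions, so the pointwise result applies
  in a direction orthogonal to the nullity space; the bracket is a nullity vector there, and hence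
  in every direction.\<close>

lemma nullity_involutive:
  assumes ind: "nullity_independent_of_direction A F D k" and U: "openin M U"
    and rank: "\<And>x. x \<in> U \<Longrightarrow> nullity_index A F D k x < DIM('e)"
  shows "involutive_on M A U (nullity_space A F D k)"
  unfolding involutive_on_def
proof (intro allI impI ballI, elim conjE)
  fix V X Y x
  assume V: "openin M V" "V \<subseteq> U" and X: "vector_field_on A V X" and Y: "vector_field_on A V Y"
    and N: "\<forall>x\<in>V. X x \<in> nullity_space A F D k x \<and> Y x \<in> nullity_space A F D k x" and x: "x \<in> V"
  obtain c h P where fc: "finsler_chart A M F D c h P" "c \<in> charts_at A x" "snd c x \<in> P" "P \<subseteq> snd c ` (fst c \<inter> V)"
    by (rule finsler_chart_within[OF V(1) x])
  interpret fc: finsler_chart A M F D c h P by (rule fc(1))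
  have inv: "chart_inv c (snd c x) = x" by (rule chart_inv_coord[OF charts_atD[OF fc(2)]])
  let ?X = "\<lambda>u. X (chart_inv c u) c" and ?Y = "\<lambda>u. Y (chart_inv c u) c" and ?u = "snd c x"
  have uV: "?u \<in> snd c ` (fst c \<inter> V)" using fc(3,4) by blast
  have dX: "?X differentiable (at ?u)" by (rule smooth_on_differentiable[OF field_smooth[OF X fc.cA] uV])
  have dY: "?Y differentiable (at ?u)" by (rule smooth_on_differentiable[OF field_smooth[OF Y fc.cA] uV])
  have nK: "Z (chart_inv c (fst q)) c \<in> fc.K k q"
    if q: "q \<in> fc.Q" and Z: "\<And>x. x \<in> V \<Longrightarrow> Z x \<in> nullity_space A F D k x" for q Z
  proof -
    have "fst q \<in> P" using q by (auto simp: fc.Q_def)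
    then obtain y where "y \<in> fst c" "y \<in> V" "fst q = snd c y" using fc(4) by blast
    then have "chart_inv c (fst q) \<in> V" using chart_inv_coord[OF fc.cA] by simp
    from Z[OF this] obtain a where a: "a \<in> fc.K k q" "Z (chart_inv c (fst q)) = push c (chart_inv c (fst q)) a"
      unfolding fc.nullity_space_pt[OF q ind] by blast
    have "c \<in> charts_at A (chart_inv c (fst q))" using fc.pt_chart[OF q] by (simp only: fc.pt_base[OF q])
    then show ?thesis using a push_coord by simp
  qed
  have XK: "?X (fst q) \<in> fc.K k q" and YK: "?Y (fst q) \<in> fc.K k q" if "q \<in> fc.Q" for q
    using nK[OF that, of X] nK[OF that, of Y] N by blast+
  obtain e :: 'e where e: "e \<noteq> 0" using nonempty_Basis nonzero_Basis by blast
  have qe: "(?u, e) \<in> fc.Q" using fc(3) e by (simp add: fc.Q_def)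
  have "dim (fc.K k (?u, e)) < DIM('e)"
    using fc.dim_K[OF qe ind] rank[of x] x V(2) by (simp add: inv subset_iff)
  then have "fc.K k (?u, e) \<noteq> UNIV" by (metis dim_UNIV less_irrefl)
  then obtain v where v: "v \<noteq> 0" "\<forall>a\<in>fc.K k (?u, e). fc.g (?u, v) a v = 0"
    using fc.orthogonal_direction[OF fc(3) fc.K_subspace[OF qe]] by blast
  have qv: "(?u, v) \<in> fc.Q" using fc(3) v by (simp add: fc.Q_def)
  have Kv: "fc.K k (?u, e) = fc.K k (?u, v)" by (rule fc.K_direction[OF qe qv _ ind]) simp
  have "fc.g (?u, v) (?X ?u) v = 0" "fc.g (?u, v) (?Y ?u) v = 0"
    using v(2) XK[OF qe] YK[OF qe] by simp_all
  then have "fc.lc.Rb k (?u, v) (dd ?Y ?u (?X ?u) - dd ?X ?u (?Y ?u)) z w = 0" for z w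
    by (intro fc.lc.nullity_involutive[OF qv dX dY _ _ v(1)])
      (use XK YK in \<open>auto simp: fc.K_def\<close>)
  then have T: "dd ?Y ?u (?X ?u) - dd ?X ?u (?Y ?u) \<in> fc.K k (?u, v)" by (simp add: fc.K_def)
  have "open_subset V" unfolding open_subset_def using manifold_chart_open[OF manifold _ V(1)] by blast
  from lie_bracket_tangent[OF this x X Y] have t: "lie_bracket A X Y x \<in> tangent_space A x" .
  have "lie_bracket A X Y x c = dd ?Y ?u (?X ?u) - dd ?X ?u (?Y ?u)"
    using fc(2) by (simp add: lie_bracket_def inv)
  then have "lie_bracket A X Y x = push c x (dd ?Y ?u (?X ?u) - dd ?X ?u (?Y ?u))"
    using push_coords[OF t fc(2)] by simp
  then show "lie_bracket A X Y x \<in> nullity_space A F D k x"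
    using fc.nullity_space_pt[OF qv ind] T by (simp add: inv)
qed

end

theorem theorem1p1:
  fixes M :: "'m topology" and A :: "('m, 'e::euclidean_space) chart set"
    and F :: "('m, 'e) tpoint \<Rightarrow> real" and D :: "('m, 'e) conn"
    and k :: real and U :: "'m set" and r :: nat
  assumes "smooth_manifold M A" and "connected_space M"
    and "finsler_structure A F" and "cartan_connection A F D"
    and "0 \<le> k"
    and "nullity_independent_of_direction A F D k"
    and "openin M U"
    and "\<forall>x\<in>U. nullity_index A F D k x = r"
    and "0 < r" and "r < DIM('e)"
  shows "distribution_on M A U r (nullity_space A F D k) \<and>
    involutive_on M A U (nullity_space A F D k)"
proof -
  interpret smooth_atlas A by (rule manifold_smooth_atlas[OF assms(1)])
  interpret finsler_cartan A M F D by unfold_locales (rule assms)+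
  show ?thesis
    using nullity_distribution[OF assms(6,7)] nullity_involutive[OF assms(6,7)] assms(8,10) by simp
qed

end
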